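(* Assume $\Lambda=I_d$, let $\delta\in(0,1)$, and suppose $p=\tfrac12-c_p$ where $c_p\in(0,1/2)$ is an absolute constant. There are constants $C>1$, $c>0$ depending only on $c_p$ such that if assumptions (A1)–(A3) hold with this $C$, then with probability at least $1-10\delta$ over the pre-training data $\{\mu_\tau,(x_{\tau,i},y_{\tau,i})_{i=1}^{N+1}\}_{\tau=1}^B$, the max-margin solution $W_{\mathrm{MM}}$ satisfies the following for a freshly sampled test task $\{\mu,(x_i,y_i)_{i=1}^{M+1}\}$, with $\rho:=\frac{c_B\wedge1}{\log^2(2B^2/\delta)}$: (i) (memorization) \[\mathbb P_{(x_i,y_i)_{i=1}^M,\,\mu}\big(\exists k\in[M]:\ \operatorname{sign}(\hat y(E(x_k);W_{\mathrm{MM}}))\neq y_k\big)\le 4M\exp\!\Big(-\frac{c\rho\sqrt d}{\sqrt M}\Big)+8M\exp\!\Big(-\frac{c\rho d}{M(\tilde R^2\vee\tilde R)}\Big);\] (ii) (near-optimal test error) \[\mathbb P_{(x_i,y_i)_{i=1}^{M+1},\,\mu}\big(\operatorname{sign}(\hat y(E(x_{M+1});W_{\mathrm{MM}}))\neq y_{M+1}\big)\le p+2e^{-cM}+2e^{-c\rho\sqrt d}+4e^{-c\rho\tilde R}+2\exp\!\Big(-\frac{c\rho M^{1/2}\tilde R^2}{\sqrt d}\Big).\]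
   Context: Pre-training data: let $\Lambda\succ0$ be a symmetric positive-definite $d\times d$ matrix (in this statement $\Lambda=I_d$), $B,N\ge1$ integers, $R>0$. For $\tau=1,\dots,B$ and $i=1,\dots,N+1$: $\mu_\tau\sim\mathrm{Unif}(R\cdot\mathbb S^{d-1})$ i.i.d., $z_{\tau,i}\sim\mathcal N(0,\Lambda)$ i.i.d., $y_{\tau,i}\sim\mathrm{Unif}(\{\pm1\})$ i.i.d., all mutually independent, $x_{\tau,i}=y_{\tau,i}\mu_\tau+z_{\tau,i}$. Write $\hat\mu_\tau=\frac1N\sum_{i=1}^N y_{\tau,i}x_{\tau,i}$, $x_\tau=x_{\tau,N+1}$, $y_\tau=y_{\tau,N+1}$. The max-margin solution is $W_{\mathrm{MM}}=\arg\min\{\|U\|_F^2:\ \hat\mu_\tau^\top U\,y_\tau x_\tau\ge1\ \forall\tau\in[B]\}$. Assumptions, for a constant $C>1$: (A1) $R^2\ge C^2\sqrt{d\,\mathrm{tr}(\Lambda^2)}\vee C^2\big(\tfrac{\mathrm{tr}(\Lambda)}{d}\vee\sqrt{\tfrac{\mathrm{tr}(\Lambda^2)}{N}}\vee\|\Lambda\|_2\big)\log(2B/\delta)$; (A2) $B\ge c_Bd$ for some $c_B>0$; (A3) $d\ge C\log^4(2B^2/\delta)$. Test distribution: for $M\ge1$, $\tilde R>0$, $p\in[0,1/2)$, and $i=1,\dots,M+1$: $\tilde y_i\sim\mathrm{Unif}(\{\pm1\})$; $y_i=\tilde y_i$ w.p. $1-p$ and $y_i=-\tilde y_i$ w.p.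 $p$; $\mu\sim\mathrm{Unif}(\tilde R\cdot\mathbb S^{d-1})$; $z_i\sim\mathcal N(0,\Lambda)$; $x_i=\tilde y_i\mu+z_i$; all mutually independent. For $x\in\mathbb R^d$, $E(x)$ denotes the prompt with in-context examples $(x_i,y_i)_{i=1}^M$ and query $x$, and the prediction is $\hat y(E(x);W)=\big(\frac1M\sum_{i=1}^M y_ix_i\big)^\top Wx$. *)

theory Defs
  imports "HOL-Probability.Probability"
begin

text \<open>Vectors in R^d are represented as functions nat => real, only coordinates i < d
  matter (measurable space: PiM over {..<d}). d x d matrices are nat => nat => real,
  only entries i,j < d matter. This allows the constants C, c to be quantified
  before the dimension d.\<close>

definition vspace :: "nat \<Rightarrow> (nat \<Rightarrow> real) measure" where
  "vspace d = PiM {..<d} (\<lambda>_. lborel)"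

definition inner_d :: "nat \<Rightarrow> (nat \<Rightarrow> real) \<Rightarrow> (nat \<Rightarrow> real) \<Rightarrow> real" where
  "inner_d d u v = (\<Sum>i<d. u i * v i)"

definition norm_d :: "nat \<Rightarrow> (nat \<Rightarrow> real) \<Rightarrow> real" where
  "norm_d d u = sqrt (\<Sum>i<d. (u i)\<^sup>2)"

definition matvec :: "nat \<Rightarrow> (nat \<Rightarrow> nat \<Rightarrow> real) \<Rightarrow> (nat \<Rightarrow> real) \<Rightarrow> (nat \<Rightarrow> real)" where
  "matvec d U v = (\<lambda>i. \<Sum>j<d. U i j * v j)"

definition frob_sq :: "nat \<Rightarrow> (nat \<Rightarrow> nat \<Rightarrow> real) \<Rightarrow> real" where
  "frob_sq d U = (\<Sum>i<d. \<Sum>j<d. (U i j)\<^sup>2)"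

definition gauss :: "nat \<Rightarrow> (nat \<Rightarrow> real) measure" where
  "gauss d = PiM {..<d} (\<lambda>_. density lborel std_normal_density)"

text \<open>Uniform distribution on the sphere of radius R in R^d: normalized surface (= cone)
  measure, i.e. the radial projection of the uniform distribution on the open unit ball.\<close>
definition unit_ball_d :: "nat \<Rightarrow> (nat \<Rightarrow> real) set" where
  "unit_ball_d d = {x \<in> space (vspace d). (\<Sum>i<d. (x i)\<^sup>2) < 1}"

definition unif_sphere :: "nat \<Rightarrow> real \<Rightarrow> (nat \<Rightarrow> real) measure" where
  "unif_sphere d R = distr (uniform_measure (vspace d) (unit_ball_d d)) (vspace d)
      (\<lambda>x. restrict (\<lambda>i. R * x i / norm_d d x) {..<d})"

definition rad :: "real measure" where
  "rad = measure_pmf (pmf_of_set {-1, 1})"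

text \<open>A raw sample omega assigns to each task tau in {1..B} a pair (mu_tau, f) where
  f i = (z_{tau,i}, y_{tau,i}) for i in {1..N+1}.\<close>
definition pretrain :: "nat \<Rightarrow> nat \<Rightarrow> nat \<Rightarrow> real
    \<Rightarrow> (nat \<Rightarrow> (nat \<Rightarrow> real) \<times> (nat \<Rightarrow> (nat \<Rightarrow> real) \<times> real)) measure" where
  "pretrain d B N R = PiM {1..B} (\<lambda>_. unif_sphere d R \<Otimes>\<^sub>M PiM {1..N+1} (\<lambda>_. gauss d \<Otimes>\<^sub>M rad))"

definition pt_mu :: "(nat \<Rightarrow> (nat \<Rightarrow> real) \<times> (nat \<Rightarrow> (nat \<Rightarrow> real) \<times> real)) \<Rightarrow> nat \<Rightarrow> (nat \<Rightarrow> real)" where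
  "pt_mu \<omega> \<tau> = fst (\<omega> \<tau>)"

definition pt_y :: "(nat \<Rightarrow> (nat \<Rightarrow> real) \<times> (nat \<Rightarrow> (nat \<Rightarrow> real) \<times> real)) \<Rightarrow> nat \<Rightarrow> nat \<Rightarrow> real" where
  "pt_y \<omega> \<tau> i = snd (snd (\<omega> \<tau>) i)"

definition pt_x :: "(nat \<Rightarrow> (nat \<Rightarrow> real) \<times> (nat \<Rightarrow> (nat \<Rightarrow> real) \<times> real)) \<Rightarrow> nat \<Rightarrow> nat \<Rightarrow> (nat \<Rightarrow> real)" where
  "pt_x \<omega> \<tau> i = (\<lambda>j. pt_y \<omega> \<tau> i * pt_mu \<omega> \<tau> j + fst (snd (\<omega> \<tau>) i) j)"

definition muhat :: "nat \<Rightarrow> (nat \<Rightarrow> (nat \<Rightarrow> real) \<times> (nat \<Rightarrow> (nat \<Rightarrow> real) \<times> real)) \<Rightarrow> nat \<Rightarrow> (nat \<Rightarrow> real)" where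
  "muhat N \<omega> \<tau> = (\<lambda>j. (1 / real N) * (\<Sum>i=1..N. pt_y \<omega> \<tau> i * pt_x \<omega> \<tau> i j))"

definition mm_feasible :: "nat \<Rightarrow> nat \<Rightarrow> nat \<Rightarrow> (nat \<Rightarrow> (nat \<Rightarrow> real) \<times> (nat \<Rightarrow> (nat \<Rightarrow> real) \<times> real))
    \<Rightarrow> (nat \<Rightarrow> nat \<Rightarrow> real) \<Rightarrow> bool" where
  "mm_feasible d B N \<omega> U \<longleftrightarrow> (\<forall>\<tau>\<in>{1..B}.
     inner_d d (muhat N \<omega> \<tau>) (matvec d U (\<lambda>j. pt_y \<omega> \<tau> (N+1) * pt_x \<omega> \<tau> (N+1) j)) \<ge> 1)"

definition is_max_margin :: "nat \<Rightarrow> nat \<Rightarrow> nat \<Rightarrow> (nat \<Rightarrow> (nat \<Rightarrow> real) \<times> (nat \<Rightarrow> (nat \<Rightarrow> real) \<times> real))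
    \<Rightarrow> (nat \<Rightarrow> nat \<Rightarrow> real) \<Rightarrow> bool" where
  "is_max_margin d B N \<omega> W \<longleftrightarrow> mm_feasible d B N \<omega> W \<and>
     (\<forall>U. mm_feasible d B N \<omega> U \<longrightarrow> frob_sq d W \<le> frob_sq d U)"

text \<open>A raw test sample theta = (mu, f) with f i = (ytilde_i, flip_i, z_i) for i in {1..M+1};
  flip_i ~ Bernoulli(p) indicates y_i = - ytilde_i.\<close>
definition test_space :: "nat \<Rightarrow> nat \<Rightarrow> real \<Rightarrow> real
    \<Rightarrow> ((nat \<Rightarrow> real) \<times> (nat \<Rightarrow> real \<times> bool \<times> (nat \<Rightarrow> real))) measure" where
  "test_space d M Rt p = unif_sphere d Rt \<Otimes>\<^sub>M
     PiM {1..M+1} (\<lambda>_. rad \<Otimes>\<^sub>M (measure_pmf (bernoulli_pmf p) \<Otimes>\<^sub>M gauss d))"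

definition ts_y :: "((nat \<Rightarrow> real) \<times> (nat \<Rightarrow> real \<times> bool \<times> (nat \<Rightarrow> real))) \<Rightarrow> nat \<Rightarrow> real" where
  "ts_y \<theta> i = (if fst (snd (snd \<theta> i)) then - fst (snd \<theta> i) else fst (snd \<theta> i))"

definition ts_x :: "((nat \<Rightarrow> real) \<times> (nat \<Rightarrow> real \<times> bool \<times> (nat \<Rightarrow> real))) \<Rightarrow> nat \<Rightarrow> (nat \<Rightarrow> real)" where
  "ts_x \<theta> i = (\<lambda>j. fst (snd \<theta> i) * fst \<theta> j + snd (snd (snd \<theta> i)) j)"

definition yhat :: "nat \<Rightarrow> nat \<Rightarrow> ((nat \<Rightarrow> real) \<times> (nat \<Rightarrow> real \<times> bool \<times> (nat \<Rightarrow> real)))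
    \<Rightarrow> (nat \<Rightarrow> nat \<Rightarrow> real) \<Rightarrow> (nat \<Rightarrow> real) \<Rightarrow> real" where
  "yhat d M \<theta> W x = inner_d d (\<lambda>j. (1 / real M) * (\<Sum>i=1..M. ts_y \<theta> i * ts_x \<theta> i j)) (matvec d W x)"

definition memo_err_event :: "nat \<Rightarrow> nat \<Rightarrow> real \<Rightarrow> real \<Rightarrow> (nat \<Rightarrow> nat \<Rightarrow> real)
    \<Rightarrow> ((nat \<Rightarrow> real) \<times> (nat \<Rightarrow> real \<times> bool \<times> (nat \<Rightarrow> real))) set" where
  "memo_err_event d M Rt p W = {\<theta> \<in> space (test_space d M Rt p).
     \<exists>k\<in>{1..M}. sgn (yhat d M \<theta> W (ts_x \<theta> k)) \<noteq> ts_y \<theta> k}"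

definition test_err_event :: "nat \<Rightarrow> nat \<Rightarrow> real \<Rightarrow> real \<Rightarrow> (nat \<Rightarrow> nat \<Rightarrow> real)
    \<Rightarrow> ((nat \<Rightarrow> real) \<times> (nat \<Rightarrow> real \<times> bool \<times> (nat \<Rightarrow> real))) set" where
  "test_err_event d M Rt p W = {\<theta> \<in> space (test_space d M Rt p).
     sgn (yhat d M \<theta> W (ts_x \<theta> (M+1))) \<noteq> ts_y \<theta> (M+1)}"

end

theory Submission
  imports Defs
begin

text \<open>Only two features of $W = W_{MM}$ matter: $F = \|W\|_F > 0$ and
  $\mathrm{tr} W \ge c_0 \rho \sqrt d\, F$. On the training side, comparing $W$ with the feasible
  matrix $2R^{-2} I$ in the first-order optimality condition gives $\mathrm{tr} W \ge R^2 F^2 / 2$,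
  and pairing $W$ with $S = \sum_\tau \hat\mu_\tau (y_\tau x_\tau)^T$, whose Frobenius norm is small
  because different tasks are nearly orthogonal, bounds $F$ from below. On the test side every term of
  $y \hat y$ is a bilinear or quadratic form in independent sub-Gaussian vectors, hence has
  exponential tails on the scale of $F$, while $\mathrm{tr} W$ provides the signal. Since $F$ itself
  is the scale, no spectral information about $W$ is ever needed.\<close>

section \<open>Sub-Gaussian vectors\<close>

text \<open>Only the sign of a prediction counts, so the test bounds depend on W through the
  scale-free ratio \<kappa> = tr W / F, which Cauchy-Schwarz caps at sqrt d; training yields
  \<kappa> \<ge> \<rho> sqrt d / 1728. The squared logarithm in \<rho> stems from the Gram matrices
  of the tasks: a union bound over B^2 pairs limits their entries at the scale K = 288 R^2 L with L
  = ln (2 B^2 / \<delta>), so F is at least of order sqrt (\<beta> d) / (R^2 L) with \<beta> = min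
  c_B 1, and R cancels against the R^2 in tr W / F \<ge> R^2 F / 2. What comes out is of order sqrt
  \<rho>, which is then weakened to \<rho>. Two obstacles shape the rest. The prefactors 2, 4 and 8
  of the claim are explicit, so every two-sided tail has to end with prefactor exactly 2, paid for
  in the exponent. And the centres follow a radial projection of the uniform law on a ball, whose
  coordinates are dependent: their quadratic forms are dominated by Gaussian ones, and for these a
  rotation of two independent copies replaces a quadratic form by a bilinear one.\<close>

lemma std_normal_mgf:
  "(\<integral>\<^sup>+x. ennreal (exp (a * x)) \<partial>density lborel std_normal_density) = ennreal (exp (a\<^sup>2 / 2))"
proof -
  have *: "std_normal_density x * exp (a * x) = exp (a\<^sup>2 / 2) * normal_density a 1 x" for x :: real
  proof -
    have "- (x\<^sup>2 / 2) + a * x = a\<^sup>2/2 + - ((x - a)\<^sup>2 / 2)"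
      by (simp add: power2_eq_square field_simps)
    then have "exp (- (x\<^sup>2 / 2)) * exp (a * x) = exp (a\<^sup>2/2) * exp (- ((x - a)\<^sup>2 / 2))"
      by (metis exp_add)
    then show ?thesis
      by (simp add: normal_density_def field_simps)
  qed
  have "(\<integral>\<^sup>+x. ennreal (exp (a * x)) \<partial>density lborel std_normal_density)
      = (\<integral>\<^sup>+x. ennreal (exp (a\<^sup>2 / 2)) * ennreal (normal_density a 1 x) \<partial>lborel)"
    by (subst nn_integral_density) (auto simp: ennreal_mult[symmetric] * intro!: nn_integral_cong)
  also have "\<dots> = ennreal (exp (a\<^sup>2 / 2)) * (\<integral>\<^sup>+x. ennreal (normal_density a 1 x) \<partial>lborel)"
    by (subst nn_integral_cmult) auto
  also have "(\<integral>\<^sup>+x. ennreal (normal_density a 1 x) \<partial>lborel) = 1"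
    using prob_space.emeasure_space_1[OF prob_space_normal_density[of 1 a]]
    by (simp add: emeasure_density)
  finally show ?thesis by simp
qed

text \<open>Tilting by the exponential of t x^2 turns the standard density into s times the density
  of N(0, s^2), where s^2 = 1 / (1 - 2 t); the integral is therefore s itself.\<close>

lemma std_normal_exp_square:
  assumes "t < 1/2"
  shows "(\<integral>\<^sup>+x. ennreal (exp (t * x\<^sup>2)) \<partial>density lborel std_normal_density)
    = ennreal (1 / sqrt (1 - 2 * t))"
proof -
  define s where "s = 1 / sqrt (1 - 2 * t)"
  have s: "s > 0" "s\<^sup>2 = 1 / (1 - 2*t)" using assms by (auto simp: s_def power_divide)
  have *: "std_normal_density x * exp (t * x\<^sup>2) = s * normal_density 0 s x" for x :: real
  proof -
    have "- (x\<^sup>2 / 2) + t * x\<^sup>2 = - (x\<^sup>2 / (2 * s\<^sup>2))"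
      using assms by (simp add: s field_simps)
    then have "exp (- (x\<^sup>2 / 2)) * exp (t * x\<^sup>2) = exp (- (x\<^sup>2 / (2 * s\<^sup>2)))"
      by (metis exp_add)
    moreover have "sqrt (2 * pi * s\<^sup>2) = sqrt (2*pi) * s"
      using s(1) by (simp add: real_sqrt_mult)
    ultimately show ?thesis
      using s(1) by (simp add: normal_density_def field_simps)
  qed
  have "(\<integral>\<^sup>+x. ennreal (exp (t * x\<^sup>2)) \<partial>density lborel std_normal_density)
      = (\<integral>\<^sup>+x. ennreal s * ennreal (normal_density 0 s x) \<partial>lborel)"
    using s(1) by (subst nn_integral_density) (auto simp: ennreal_mult[symmetric] * intro!: nn_integral_cong)
  also have "\<dots> = ennreal s * (\<integral>\<^sup>+x. ennreal (normal_density 0 s x) \<partial>lborel)"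
    by (subst nn_integral_cmult) auto
  also have "(\<integral>\<^sup>+x. ennreal (normal_density 0 s x) \<partial>lborel) = 1"
    using prob_space.emeasure_space_1[OF prob_space_normal_density[of s 0]] s(1)
    by (simp add: emeasure_density)
  finally show ?thesis by (simp add: s_def)
qed

lemma prob_space_std_normal: "prob_space (density lborel std_normal_density)"
  by (rule prob_space_normal_density) simp

lemma product_prob_space_std_normal:
  "product_prob_space (\<lambda>_::nat. density lborel std_normal_density)"
  by (intro product_prob_space.intro product_prob_space_axioms.intro product_sigma_finite.intro
      prob_space_std_normal prob_space_imp_sigma_finite)

lemma prob_space_gauss: "prob_space (gauss d)"
  unfolding gauss_def by (rule prob_space_PiM) (rule prob_space_std_normal)

lemma sets_gauss [measurable_cong]: "sets (gauss d) = sets (vspace d)"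
  unfolding gauss_def vspace_def by (rule sets_PiM_cong) auto

lemma space_gauss: "space (gauss d) = space (vspace d)"
  by (rule sets_eq_imp_space_eq) (rule sets_gauss)

lemma measurable_vspace_component:
  "i < d \<Longrightarrow> (\<lambda>x. x i) \<in> borel_measurable (vspace d)"
  unfolding vspace_def using measurable_component_singleton[of i "{..<d}" "\<lambda>_. lborel"]
  by (metis lessThan_iff measurable_lborel1)

lemma measurable_gauss_component:
  "i < d \<Longrightarrow> (\<lambda>x. x i) \<in> borel_measurable (gauss d)"
  by (simp add: measurable_cong_sets[OF sets_gauss refl] measurable_vspace_component)

lemma gauss_mgf:
  "(\<integral>\<^sup>+z. ennreal (exp (inner_d d a z)) \<partial>gauss d) = ennreal (exp (inner_d d a a / 2))"
proof -
  interpret product_prob_space "\<lambda>_::nat. density lborel std_normal_density"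
    by (rule product_prob_space_std_normal)
  have "(\<integral>\<^sup>+z. ennreal (exp (inner_d d a z)) \<partial>gauss d)
     = (\<integral>\<^sup>+z. (\<Prod>i<d. ennreal (exp (a i * z i))) \<partial>gauss d)"
    by (simp add: inner_d_def exp_sum prod_ennreal)
  also have "\<dots> = (\<Prod>i<d. ennreal (exp ((a i)\<^sup>2/2)))"
    unfolding gauss_def by (subst product_nn_integral_prod) (auto simp: std_normal_mgf)
  also have "\<dots> = ennreal (exp (inner_d d a a / 2))"
    by (simp add: inner_d_def prod_ennreal exp_sum sum_divide_distrib power2_eq_square)
  finally show ?thesis .
qed

text \<open>v is the variance proxy. The extra prefactor K is carried along because the sphere bound
  is obtained with K = 2, whereas Gaussian noise has K = 1. Keeping the vector u apart from the
  measure P lets coordinates and averages on a product space be such vectors without passing to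
  image measures.\<close>

definition subgauss :: "nat \<Rightarrow> 'a measure \<Rightarrow> ('a \<Rightarrow> nat \<Rightarrow> real) \<Rightarrow> real \<Rightarrow> real \<Rightarrow> bool" where
  "subgauss d P u K v \<longleftrightarrow> prob_space P \<and> (\<forall>i<d. (\<lambda>w. u w i) \<in> borel_measurable P) \<and>
     (\<forall>a. (\<integral>\<^sup>+w. ennreal (exp (inner_d d a (u w))) \<partial>P) \<le> ennreal (K * exp (v * inner_d d a a / 2)))"

lemma subgauss_prob_space: "subgauss d P u K v \<Longrightarrow> prob_space P"
  by (simp add: subgauss_def)

lemma subgauss_measurable: "subgauss d P u K v \<Longrightarrow> i < d \<Longrightarrow> (\<lambda>w. u w i) \<in> borel_measurable P"
  by (simp add: subgauss_def)

lemma subgaussD: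
  "subgauss d P u K v \<Longrightarrow>
   (\<integral>\<^sup>+w. ennreal (exp (inner_d d a (u w))) \<partial>P) \<le> ennreal (K * exp (v * inner_d d a a / 2))"
  by (simp add: subgauss_def)

lemma inner_d_nonneg: "inner_d d a a \<ge> 0"
  by (auto simp: inner_d_def intro!: sum_nonneg)

lemma subgauss_mono:
  assumes "subgauss d P u K v" "v \<le> v'" "K \<ge> 0"
  shows "subgauss d P u K v'"
proof -
  have "ennreal (K * exp (v * inner_d d a a / 2)) \<le> ennreal (K * exp (v' * inner_d d a a / 2))" for a
    using assms by (intro ennreal_leI mult_left_mono) (auto intro: mult_right_mono inner_d_nonneg)
  then show ?thesis using assms unfolding subgauss_def by (meson order_trans)
qed

lemma subgauss_gauss: "subgauss d (gauss d) (\<lambda>z. z) 1 1"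
  using prob_space_gauss by (simp add: subgauss_def gauss_mgf measurable_gauss_component)

lemma inner_d_measurable:
  assumes "\<And>i. i < d \<Longrightarrow> (\<lambda>w. u w i) \<in> borel_measurable P"
    "\<And>i. i < d \<Longrightarrow> (\<lambda>w. v w i) \<in> borel_measurable P"
  shows "(\<lambda>w. inner_d d (u w) (v w)) \<in> borel_measurable P"
  unfolding inner_d_def using assms by (intro borel_measurable_sum) auto

lemma matvec_measurable:
  assumes "\<And>i. i < d \<Longrightarrow> (\<lambda>w. u w i) \<in> borel_measurable P"
  shows "(\<lambda>w. matvec d A (u w) i) \<in> borel_measurable P"
  unfolding matvec_def using assms by (intro borel_measurable_sum) auto

lemma inner_d_scale: "inner_d d (\<lambda>i. c * a i) b = c * inner_d d a b"
  by (simp add: inner_d_def sum_distrib_left mult.assoc)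

lemma inner_d_scale2: "inner_d d a (\<lambda>i. c * b i) = c * inner_d d a b"
  by (simp add: inner_d_def sum_distrib_left mult_ac)

lemma inner_d_add: "inner_d d (\<lambda>i. a i + b i) e = inner_d d a e + inner_d d b e"
  by (simp add: inner_d_def sum.distrib distrib_right)

lemma inner_d_add2: "inner_d d e (\<lambda>i. a i + b i) = inner_d d e a + inner_d d e b"
  by (simp add: inner_d_def sum.distrib distrib_left)

lemma inner_d_commute: "inner_d d a b = inner_d d b a"
  by (simp add: inner_d_def mult.commute)

text \<open>The square in the exponent is linearised by an independent standard Gaussian $g$:
  $e^{c x^2} = E\, e^{\sqrt{2c}\, g x}$.\<close>
lemma subgauss_exp_inner_square:
  assumes S: "subgauss d P u K v" and c: "c \<ge> 0" and small: "2 * c * v * inner_d d a a < 1"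
    and K: "K \<ge> 0"
  shows "(\<integral>\<^sup>+w. ennreal (exp (c * (inner_d d a (u w))\<^sup>2)) \<partial>P)
     \<le> ennreal (K / sqrt (1 - 2 * c * v * inner_d d a a))"
proof -
  let ?N = "density lborel std_normal_density"
  interpret P: prob_space P using S by (rule subgauss_prob_space)
  interpret N: prob_space ?N by (rule prob_space_std_normal)
  interpret PN: pair_sigma_finite P ?N ..
  have ms: "(\<lambda>w. inner_d d a (u w)) \<in> borel_measurable P"
    using subgauss_measurable[OF S] by (intro inner_d_measurable) auto
  have key: "inner_d d (\<lambda>i. (sqrt (2*c) * g) * a i) b = sqrt (2*c) * inner_d d a b * g" for g b
    by (subst inner_d_scale) simp
  have "(\<integral>\<^sup>+w. ennreal (exp (c * (inner_d d a (u w))\<^sup>2)) \<partial>P)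
     = (\<integral>\<^sup>+w. \<integral>\<^sup>+g. ennreal (exp ((sqrt (2*c) * inner_d d a (u w)) * g)) \<partial>?N \<partial>P)"
    using c by (simp add: std_normal_mgf power_mult_distrib)
  also have "\<dots> = (\<integral>\<^sup>+g. \<integral>\<^sup>+w. ennreal (exp ((sqrt (2*c) * inner_d d a (u w)) * g)) \<partial>P \<partial>?N)"
    by (rule PN.Fubini'[symmetric]) (use ms in measurable)
  also have "\<dots> = (\<integral>\<^sup>+g. \<integral>\<^sup>+w. ennreal (exp (inner_d d (\<lambda>i. (sqrt (2*c) * g) * a i) (u w))) \<partial>P \<partial>?N)"
    unfolding key ..
  also have "\<dots> \<le> (\<integral>\<^sup>+g. ennreal (K * exp (v * inner_d d (\<lambda>i. (sqrt (2*c) * g) * a i) (\<lambda>i. (sqrt (2*c) * g) * a i) / 2)) \<partial>?N)"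
    by (intro nn_integral_mono subgaussD[OF S])
  also have "\<dots> = (\<integral>\<^sup>+g. ennreal K * ennreal (exp ((c * v * inner_d d a a) * g\<^sup>2)) \<partial>?N)"
  proof (intro nn_integral_cong)
    fix g :: real
    have "v * inner_d d (\<lambda>i. (sqrt (2*c) * g) * a i) (\<lambda>i. (sqrt (2*c) * g) * a i) / 2
      = v * ((sqrt (2*c))\<^sup>2 * g\<^sup>2 * inner_d d a a) / 2"
      by (subst inner_d_scale, subst inner_d_scale2) (simp add: power2_eq_square)
    also have "\<dots> = (c * v * inner_d d a a) * g\<^sup>2"
      using c by simp
    finally have eq: "v * inner_d d (\<lambda>i. (sqrt (2*c) * g) * a i) (\<lambda>i. (sqrt (2*c) * g) * a i) / 2
      = (c * v * inner_d d a a) * g\<^sup>2" .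
    show "ennreal (K * exp (v * inner_d d (\<lambda>i. (sqrt (2*c) * g) * a i) (\<lambda>i. (sqrt (2*c) * g) * a i) / 2))
      = ennreal K * ennreal (exp ((c * v * inner_d d a a) * g\<^sup>2))"
      unfolding eq using K by (intro ennreal_mult) auto
  qed
  also have "\<dots> = ennreal K * ennreal (1 / sqrt (1 - 2 * (c * v * inner_d d a a)))"
    using small by (subst nn_integral_cmult) (auto simp: std_normal_exp_square)
  also have "\<dots> = ennreal (K / sqrt (1 - 2 * c * v * inner_d d a a))"
    using K small by (subst ennreal_mult[symmetric]) (auto simp: mult_ac)
  finally show ?thesis .
qed

lemma frob_sq_nonneg: "frob_sq d A \<ge> 0"
  by (auto simp: frob_sq_def intro!: sum_nonneg)

text \<open>Jensen's inequality for exp, after writing x i as the weight w i / F times F / w i * x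
  i. For a zero weight the quotient F / w i is 0 in HOL, so such an index has to come with x i =
  0.\<close>

lemma exp_sum_weighted_le:
  fixes x w :: "nat \<Rightarrow> real"
  assumes w: "\<And>i. i < d \<Longrightarrow> w i \<ge> 0" and pos: "(\<Sum>i<d. w i) > 0"
    and zero: "\<And>i. i < d \<Longrightarrow> w i = 0 \<Longrightarrow> x i = 0"
  defines "F \<equiv> \<Sum>i<d. w i"
  shows "exp (\<Sum>i<d. x i) \<le> (\<Sum>i<d. (w i / F) * exp (F / w i * x i))"
proof -
  have F: "F > 0" using pos by (simp add: F_def)
  have ne: "{..<d} \<noteq> {}" using pos by (intro notI) simp
  have "exp (\<Sum>i<d. (w i / F) *\<^sub>R (F / w i * x i)) \<le> (\<Sum>i<d. (w i / F) * exp (F / w i * x i))"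
    using w F ne by (intro convex_on_sum[OF _ _ exp_convex])
      (auto simp: sum_divide_distrib[symmetric] F_def[symmetric])
  moreover have "(\<Sum>i<d. (w i / F) *\<^sub>R (F / w i * x i)) = (\<Sum>i<d. x i)"
    using zero F by (intro sum.cong) auto
  ultimately show ?thesis by simp
qed

text \<open>Convexity of $\exp$ with row weights proportional to the squared row norms of $A$ reduces
  the claim to single rows; this gives the Frobenius norm as the scale without diagonalising.\<close>
lemma subgauss_exp_matvec_square:
  assumes S: "subgauss d P u K v" and K: "K \<ge> 0" and v: "v * frob_sq d A \<le> 1/4"
  shows "(\<integral>\<^sup>+w. ennreal (exp (inner_d d (matvec d A (u w)) (matvec d A (u w)) / 2)) \<partial>P)
     \<le> ennreal (max 1 (2 * K))"
proof -
  interpret P: prob_space P using S by (rule subgauss_prob_space)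
  note ms = subgauss_measurable[OF S]
  define w where "w i = inner_d d (A i) (A i)" for i
  define F where "F = (\<Sum>i<d. w i)"
  have F_frob: "F = frob_sq d A"
    by (simp add: F_def w_def inner_d_def frob_sq_def power2_eq_square)
  have w: "w i \<ge> 0" for i by (simp add: w_def inner_d_nonneg)
  have zero: "inner_d d (A i) b = 0" if "w i = 0" for i b
  proof -
    have "\<forall>j\<in>{..<d}. A i j * A i j = 0"
      using that unfolding w_def inner_d_def by (subst (asm) sum_nonneg_eq_0_iff) auto
    then show ?thesis by (simp add: inner_d_def)
  qed
  have mv: "inner_d d (matvec d A b) (matvec d A b) / 2 = (\<Sum>i<d. (inner_d d (A i) b)\<^sup>2 / 2)" for b
    by (simp add: inner_d_def matvec_def power2_eq_square sum_divide_distrib)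
  show ?thesis
  proof (cases "F = 0")
    \<comment> \<open>For a vanishing matrix the integral is 1; this case is the source of
      \<open>max 1\<close> in the bound.\<close>
    case True
    then have "\<forall>i\<in>{..<d}. w i = 0"
      unfolding F_def using w by (subst (asm) sum_nonneg_eq_0_iff) auto
    then have "inner_d d (matvec d A b) (matvec d A b) / 2 = 0" for b
      unfolding mv using zero by simp
    then show ?thesis by (simp add: P.emeasure_space_1)
  next
    case False
    then have F: "F > 0" using frob_sq_nonneg[of d A] F_frob by simp
    \<comment> \<open>Chosen so that 2 * \<open>?c i\<close> * v * w i = v * F for every row: all
      rows meet the same condition v * F < 1 and lose the same factor 1 / sqrt (1 - v * F), which is
      at most 2.\<close>
    let ?c = "\<lambda>i. F / w i / 2"
    have row: "(\<integral>\<^sup>+z. ennreal (w i / F * exp (F / w i * ((inner_d d (A i) (u z))\<^sup>2 / 2))) \<partial>P)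
        \<le> ennreal (w i / F * (2 * K))" for i
    proof (cases "w i = 0")
      case False
      then have wi: "w i > 0" using w[of i] by simp
      have eq: "2 * ?c i * v * inner_d d (A i) (A i) = v * F"
        using wi by (simp add: w_def[symmetric])
      have "(\<integral>\<^sup>+z. ennreal (exp (?c i * (inner_d d (A i) (u z))\<^sup>2)) \<partial>P)
        \<le> ennreal (K / sqrt (1 - 2 * ?c i * v * inner_d d (A i) (A i)))"
        using F wi v K by (intro subgauss_exp_inner_square[OF S]) (simp_all only: eq, simp_all add: F_frob)
      also have "\<dots> \<le> ennreal (2 * K)"
      proof (rule ennreal_leI)
        have "sqrt (1 - v * F) \<ge> sqrt (1/4)" using v F_frob by (intro real_sqrt_le_mono) simp
        then have "sqrt (1 - v * F) \<ge> 1/2" by (simp add: real_sqrt_divide)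
        then have "K / sqrt (1 - v * F) \<le> K / (1/2)" using K v F_frob by (intro divide_left_mono) auto
        then show "K / sqrt (1 - 2 * ?c i * v * inner_d d (A i) (A i)) \<le> 2 * K" by (simp only: eq) simp
      qed
      finally have *: "(\<integral>\<^sup>+z. ennreal (exp (?c i * (inner_d d (A i) (u z))\<^sup>2)) \<partial>P) \<le> ennreal (2*K)" .
      have [measurable]: "(\<lambda>z. inner_d d (A i) (u z)) \<in> borel_measurable P"
        using ms by (intro inner_d_measurable) auto
      have "(\<integral>\<^sup>+z. ennreal (w i / F * exp (F / w i * ((inner_d d (A i) (u z))\<^sup>2 / 2))) \<partial>P)
        = (\<integral>\<^sup>+z. ennreal (w i / F) * ennreal (exp (?c i * (inner_d d (A i) (u z))\<^sup>2)) \<partial>P)"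
        using F w by (simp add: ennreal_mult[symmetric])
      also have "\<dots> = ennreal (w i / F) * (\<integral>\<^sup>+z. ennreal (exp (?c i * (inner_d d (A i) (u z))\<^sup>2)) \<partial>P)"
        by (intro nn_integral_cmult) measurable
      also have "\<dots> \<le> ennreal (w i / F) * ennreal (2 * K)"
        by (intro mult_left_mono *) simp
      also have "\<dots> = ennreal (w i / F * (2 * K))"
        using F K w[of i] by (subst ennreal_mult[symmetric]) auto
      finally show ?thesis .
    qed simp
    have "(\<integral>\<^sup>+z. ennreal (exp (inner_d d (matvec d A (u z)) (matvec d A (u z)) / 2)) \<partial>P)
      \<le> (\<integral>\<^sup>+z. (\<Sum>i<d. ennreal (w i / F * exp (F / w i * ((inner_d d (A i) (u z))\<^sup>2 / 2)))) \<partial>P)"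
    proof (intro nn_integral_mono)
      fix z
      have "exp (\<Sum>i<d. (inner_d d (A i) (u z))\<^sup>2 / 2)
        \<le> (\<Sum>i<d. w i / F * exp (F / w i * ((inner_d d (A i) (u z))\<^sup>2 / 2)))"
        unfolding F_def using w F[unfolded F_def] zero by (intro exp_sum_weighted_le) auto
      then show "ennreal (exp (inner_d d (matvec d A (u z)) (matvec d A (u z)) / 2))
        \<le> (\<Sum>i<d. ennreal (w i / F * exp (F / w i * ((inner_d d (A i) (u z))\<^sup>2 / 2))))"
        unfolding mv using w F by (subst sum_ennreal) (auto intro!: ennreal_leI)
    qed
    also have "\<dots> = (\<Sum>i<d. (\<integral>\<^sup>+z. ennreal (w i / F * exp (F / w i * ((inner_d d (A i) (u z))\<^sup>2 / 2))) \<partial>P))"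
    proof (intro nn_integral_sum)
      fix i
      have [measurable]: "(\<lambda>z. inner_d d (A i) (u z)) \<in> borel_measurable P"
        using ms by (intro inner_d_measurable) auto
      show "(\<lambda>z. ennreal (w i / F * exp (F / w i * ((inner_d d (A i) (u z))\<^sup>2 / 2)))) \<in> borel_measurable P"
        by measurable
    qed
    also have "\<dots> \<le> (\<Sum>i<d. ennreal (w i / F * (2 * K)))"
      by (intro sum_mono row)
    also have "\<dots> = ennreal (\<Sum>i<d. w i / F * (2 * K))"
      using w F K by (intro sum_ennreal) auto
    also have "(\<Sum>i<d. w i / F * (2 * K)) = 2 * K"
      using F by (simp add: sum_distrib_right[symmetric] sum_divide_distrib[symmetric] F_def[symmetric])
    also have "ennreal (2*K) \<le> ennreal (max 1 (2 * K))" by (intro ennreal_leI) simp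
    finally show ?thesis .
  qed
qed

section \<open>Bilinear forms and their exponential moments\<close>

definition bilin :: "nat \<Rightarrow> (nat \<Rightarrow> nat \<Rightarrow> real) \<Rightarrow> (nat \<Rightarrow> real) \<Rightarrow> (nat \<Rightarrow> real) \<Rightarrow> real" where
  "bilin d A u v = inner_d d u (matvec d A v)"

definition mat_transp :: "(nat \<Rightarrow> nat \<Rightarrow> real) \<Rightarrow> nat \<Rightarrow> nat \<Rightarrow> real" where
  "mat_transp A = (\<lambda>i j. A j i)"

lemma bilin_altdef: "bilin d A u v = (\<Sum>i<d. \<Sum>j<d. A i j * u i * v j)"
  by (simp add: bilin_def inner_d_def matvec_def sum_distrib_left mult_ac)

lemma bilin_transp: "bilin d (mat_transp A) v u = bilin d A u v"
  unfolding bilin_altdef mat_transp_def by (subst sum.swap) (simp add: mult_ac)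

lemma bilin_transp': "bilin d A u v = inner_d d (matvec d (mat_transp A) u) v"
  by (subst bilin_transp[symmetric]) (simp add: bilin_def inner_d_commute)

lemma frob_sq_transp: "frob_sq d (mat_transp A) = frob_sq d A"
  unfolding frob_sq_def mat_transp_def by (rule sum.swap)

lemma bilin_measurable:
  assumes "\<And>i. i < d \<Longrightarrow> (\<lambda>w. u w i) \<in> borel_measurable P"
    "\<And>i. i < d \<Longrightarrow> (\<lambda>w. v w i) \<in> borel_measurable P"
  shows "(\<lambda>w. bilin d A (u w) (v w)) \<in> borel_measurable P"
  unfolding bilin_def using assms by (intro inner_d_measurable matvec_measurable) auto

lemma bilin_add: "bilin d A (\<lambda>i. a i + b i) e = bilin d A a e + bilin d A b e"
  by (simp add: bilin_altdef sum.distrib algebra_simps)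

lemma bilin_add2: "bilin d A e (\<lambda>i. a i + b i) = bilin d A e a + bilin d A e b"
  by (simp add: bilin_altdef sum.distrib algebra_simps)

lemma bilin_scale: "bilin d A (\<lambda>i. c * a i) b = c * bilin d A a b"
  by (simp add: bilin_altdef sum_distrib_left mult_ac)

lemma bilin_scale2: "bilin d A a (\<lambda>i. c * b i) = c * bilin d A a b"
  by (simp add: bilin_altdef sum_distrib_left mult_ac)

lemma bilin_mat_scale: "bilin d (\<lambda>i j. c * A i j) a b = c * bilin d A a b"
  by (simp add: bilin_altdef sum_distrib_left mult_ac)

lemma frob_sq_scale: "frob_sq d (\<lambda>i j. c * A i j) = c\<^sup>2 * frob_sq d A"
  by (simp add: frob_sq_def power_mult_distrib sum_distrib_left)

text \<open>Integrating the second vector out leaves K' times the exponential of v' |A^T u|^2 / 2,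
  the squared norm of a linear image of the first vector; \<open>subgauss_exp_matvec_square\<close>
  applies to it with the matrix sqrt v' A^T. K \<ge> 1 simplifies its \<open>max 1 (2 * K)\<close>
  to 2 * K.\<close>

lemma subgauss_exp_bilin:
  assumes S: "subgauss d P u K v" "subgauss d P' u' K' v'" and K: "K \<ge> 1" "K' \<ge> 1"
    and v: "v \<ge> 0" "v' \<ge> 0" and small: "v * v' * frob_sq d A \<le> 1/4"
  shows "(\<integral>\<^sup>+w. \<integral>\<^sup>+w'. ennreal (exp (bilin d A (u w) (u' w'))) \<partial>P' \<partial>P) \<le> ennreal (2 * K * K')"
proof -
  let ?A = "\<lambda>i j. sqrt v' * mat_transp A i j"
  have ms: "(\<lambda>w. inner_d d (matvec d B (u w)) (matvec d B (u w))) \<in> borel_measurable P" for B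
    using subgauss_measurable[OF S(1)] by (intro inner_d_measurable matvec_measurable) auto
  have fr: "v * frob_sq d ?A \<le> 1/4"
    using small v by (simp add: frob_sq_scale frob_sq_transp mult_ac)
  have mv: "matvec d ?A x = (\<lambda>i. sqrt v' * matvec d (mat_transp A) x i)" for x
    by (simp add: matvec_def sum_distrib_left mult_ac)
  have "inner_d d (matvec d ?A x) (matvec d ?A x) = (sqrt v')\<^sup>2 * inner_d d (matvec d (mat_transp A) x) (matvec d (mat_transp A) x)" for x
    unfolding mv by (subst inner_d_scale, subst inner_d_scale2) (simp add: power2_eq_square)
  then have eq: "v' * inner_d d (matvec d (mat_transp A) x) (matvec d (mat_transp A) x) / 2
      = inner_d d (matvec d ?A x) (matvec d ?A x) / 2" for x
    using v by simp
  have "(\<integral>\<^sup>+w. \<integral>\<^sup>+w'. ennreal (exp (bilin d A (u w) (u' w'))) \<partial>P' \<partial>P)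
      \<le> (\<integral>\<^sup>+w. ennreal (K' * exp (v' * inner_d d (matvec d (mat_transp A) (u w)) (matvec d (mat_transp A) (u w)) / 2)) \<partial>P)"
    unfolding bilin_transp' by (intro nn_integral_mono subgaussD[OF S(2)])
  also have "\<dots> = (\<integral>\<^sup>+w. ennreal K' * ennreal (exp (inner_d d (matvec d ?A (u w)) (matvec d ?A (u w)) / 2)) \<partial>P)"
    unfolding eq using K by (simp add: ennreal_mult)
  also have "\<dots> = ennreal K' * (\<integral>\<^sup>+w. ennreal (exp (inner_d d (matvec d ?A (u w)) (matvec d ?A (u w)) / 2)) \<partial>P)"
    using ms[of ?A] by (intro nn_integral_cmult) simp
  also have "\<dots> \<le> ennreal K' * ennreal (max 1 (2 * K))"
    using K fr by (intro mult_left_mono subgauss_exp_matvec_square[OF S(1)]) auto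
  also have "\<dots> = ennreal (2 * K * K')"
    using K by (simp add: ennreal_mult[symmetric] mult_ac)
  finally show ?thesis .
qed

section \<open>From exponential moments to tails\<close>

lemma exp_tail_bound:
  assumes P: "prob_space P" and X[measurable]: "X \<in> borel_measurable P"
    and le: "(\<integral>\<^sup>+w. ennreal (exp (X w)) \<partial>P) \<le> ennreal b" and b: "b \<ge> 0"
  shows "measure P {w\<in>space P. t \<le> X w} \<le> b * exp (- t)"
proof -
  interpret prob_space P by fact
  have "emeasure P {w\<in>space P. 1 \<le> ennreal (exp (- t)) * ennreal (exp (X w))}
     \<le> ennreal (exp (- t)) * (\<integral>\<^sup>+ w. ennreal (exp (X w)) * indicator (space P) w \<partial>P)"
    by (rule nn_integral_Markov_inequality) measurable
  also have "(\<integral>\<^sup>+ w. ennreal (exp (X w)) * indicator (space P) w \<partial>P) = (\<integral>\<^sup>+w. ennreal (exp (X w)) \<partial>P)"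
    by (intro nn_integral_cong) auto
  also have "ennreal (exp (- t)) * \<dots> \<le> ennreal (exp (- t)) * ennreal b"
    by (intro mult_left_mono le) simp
  also have "\<dots> = ennreal (b * exp (- t))" using b by (simp add: ennreal_mult[symmetric] mult.commute)
  also have "{w\<in>space P. 1 \<le> ennreal (exp (- t)) * ennreal (exp (X w))} = {w\<in>space P. t \<le> X w}"
    by (auto simp: ennreal_mult[symmetric] exp_add[symmetric] simp del: ennreal_1 simp flip: ennreal_1)
  finally show ?thesis
    using b by (simp add: emeasure_eq_measure)
qed

text \<open>Since probabilities are at most $1$, the constant in $16 e^{-t}$ can be traded against the
  exponent: $\min(1, 16 e^{-t}) \<le> (16 e^{-t})^{1/4}$.\<close>
lemma exp_abs_tail_bound:
  assumes P: "prob_space P" and X[measurable]: "X \<in> borel_measurable P"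
    and le: "(\<integral>\<^sup>+w. ennreal (exp (X w)) \<partial>P) \<le> ennreal 8"
    "(\<integral>\<^sup>+w. ennreal (exp (- X w)) \<partial>P) \<le> ennreal 8"
  shows "measure P {w\<in>space P. t \<le> \<bar>X w\<bar>} \<le> 2 * exp (- t / 4)"
proof -
  interpret prob_space P by fact
  let ?p = "measure P {w\<in>space P. t \<le> \<bar>X w\<bar>}"
  have "?p \<le> measure P ({w\<in>space P. t \<le> X w} \<union> {w\<in>space P. t \<le> - X w})"
    by (intro finite_measure_mono) auto
  also have "\<dots> \<le> measure P {w\<in>space P. t \<le> X w} + measure P {w\<in>space P. t \<le> - X w}"
    by (intro measure_Un_le) measurable
  also have "\<dots> \<le> 8 * exp (-t) + 8 * exp (-t)"
    by (intro add_mono exp_tail_bound P le) auto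
  finally have 1: "?p \<le> 16 * exp (-t)" by simp
  have p: "?p \<ge> 0" "?p \<le> 1" by auto
  have "?p ^ 4 \<le> ?p" using p power_decreasing[of 1 4 ?p] by simp
  also have "\<dots> \<le> (2 * exp (- t / 4)) ^ 4"
    using 1 by (simp add: power_mult_distrib exp_of_nat_mult[symmetric])
  finally show ?thesis
    by (rule power_le_imp_le_base[of _ 3, simplified numeral_3_eq_3[symmetric], simplified]) simp
qed

section \<open>Gaussian quadratic forms\<close>

lemma product_sigma_finite_lborel: "product_sigma_finite (\<lambda>_::nat. lborel :: real measure)"
  by (intro product_sigma_finite.intro lborel.sigma_finite_measure_axioms)

lemma sigma_finite_vspace: "sigma_finite_measure (vspace d)"
proof -
  interpret product_sigma_finite "\<lambda>_::nat. lborel :: real measure"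
    by (rule product_sigma_finite_lborel)
  interpret finite_product_sigma_finite "\<lambda>_::nat. lborel :: real measure" "{..<d}"
    by standard simp
  show ?thesis unfolding vspace_def by unfold_locales
qed

lemma space_vspace: "space (vspace d) = PiE {..<d} (\<lambda>_. UNIV)"
  by (simp add: vspace_def space_PiM)

lemma measurable_into_vspace:
  assumes "\<And>i. i < d \<Longrightarrow> (\<lambda>w. g w i) \<in> borel_measurable M"
  shows "(\<lambda>w. restrict (g w) {..<d}) \<in> measurable M (vspace d)"
  unfolding vspace_def using assms by (intro measurable_restrict) auto

lemma emeasure_vspace_PiE:
  assumes "\<And>i. i < d \<Longrightarrow> A i \<in> sets lborel"
  shows "emeasure (vspace d) (PiE {..<d} A) = (\<Prod>i<d. emeasure lborel (A i))"
proof -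
  interpret product_sigma_finite "\<lambda>_::nat. lborel :: real measure"
    by (rule product_sigma_finite_lborel)
  show ?thesis using assms unfolding vspace_def by (intro emeasure_PiM) auto
qed

text \<open>Boxes determine a product measure, and on a box the claim factors into d one-dimensional
  affine substitutions. The linear part is a multiple of the identity, so the Jacobian is a plain
  power. \<open>restrict\<close> keeps the image extensional, as the points of
  \<open>vspace d\<close> are.\<close>

lemma vspace_affine:
  assumes r: "r \<noteq> 0"
  shows "density (distr (vspace d) (vspace d) (\<lambda>x. restrict (\<lambda>i. c i + r * x i) {..<d}))
      (\<lambda>_. ennreal (\<bar>r\<bar> ^ d)) = vspace d" (is "density (distr _ _ ?T) _ = _")
proof -
  interpret product_sigma_finite "\<lambda>_::nat. lborel :: real measure"
    by (rule product_sigma_finite_lborel)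
  have T: "?T \<in> measurable (vspace d) (vspace d)"
    by (intro measurable_into_vspace borel_measurable_add borel_measurable_times borel_measurable_const measurable_vspace_component)
  have "density (distr (vspace d) (vspace d) ?T) (\<lambda>_. ennreal (\<bar>r\<bar> ^ d)) = PiM {..<d} (\<lambda>_. lborel)"
  proof (rule PiM_eqI)
    fix A :: "nat \<Rightarrow> real set"
    assume A: "\<And>i. i \<in> {..<d} \<Longrightarrow> A i \<in> sets lborel"
    define B where "B i = {x. c i + r * x \<in> A i}" for i
    have B: "B i \<in> sets lborel" if "i < d" for i
    proof -
      have [measurable]: "A i \<in> sets borel" using A that by simp
      have "B i = (\<lambda>x. c i + r * x) -` A i \<inter> space borel" by (auto simp: B_def)
      also have "\<dots> \<in> sets borel" by measurable
      finally show ?thesis by simp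
    qed
    have eB: "ennreal \<bar>r\<bar> * emeasure lborel (B i) = emeasure lborel (A i)" if "i < d" for i
    proof -
      have [measurable]: "A i \<in> sets borel" using A that by simp
      have "emeasure lborel (A i) = (\<integral>\<^sup>+x. indicator (A i) x \<partial>lborel)" by simp
      also have "\<dots> = ennreal \<bar>r\<bar> * (\<integral>\<^sup>+x. indicator (A i) (c i + r * x) \<partial>lborel)"
        using r by (intro nn_integral_real_affine) auto
      also have "(\<lambda>x. indicator (A i) (c i + r * x) :: ennreal) = indicator (B i)"
        by (auto simp: B_def indicator_def)
      finally show ?thesis using B[OF that] by simp
    qed
    have PA: "PiE {..<d} A \<in> sets (vspace d)"
      unfolding vspace_def using A by (intro sets_PiM_I_finite) auto
    have "?T -` PiE {..<d} A \<inter> space (vspace d) = PiE {..<d} B"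
    proof (intro set_eqI iffI)
      fix x assume "x \<in> ?T -` PiE {..<d} A \<inter> space (vspace d)"
      then show "x \<in> PiE {..<d} B"
        by (auto simp: space_vspace B_def PiE_def Pi_def)
    next
      fix x assume "x \<in> PiE {..<d} B"
      then show "x \<in> ?T -` PiE {..<d} A \<inter> space (vspace d)"
        by (auto simp: space_vspace B_def PiE_def Pi_def)
    qed
    then have "emeasure (density (distr (vspace d) (vspace d) ?T) (\<lambda>_. ennreal (\<bar>r\<bar> ^ d))) (PiE {..<d} A)
      = ennreal (\<bar>r\<bar> ^ d) * emeasure (vspace d) (PiE {..<d} B)"
      using PA T by (simp add: emeasure_density_const emeasure_distr)
    also have "\<dots> = (\<Prod>i<d. ennreal \<bar>r\<bar>) * (\<Prod>i<d. emeasure lborel (B i))"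
      using B by (subst emeasure_vspace_PiE) (auto simp: ennreal_power)
    also have "\<dots> = (\<Prod>i<d. emeasure lborel (A i))"
      unfolding prod.distrib[symmetric] using eB by (intro prod.cong) auto
    finally show "emeasure (density (distr (vspace d) (vspace d) ?T) (\<lambda>_. ennreal (\<bar>r\<bar> ^ d))) (PiE {..<d} A)
      = (\<Prod>i\<in>{..<d}. emeasure lborel (A i))" .
  qed (auto simp: vspace_def)
  then show ?thesis by (simp add: vspace_def)
qed

lemma nn_integral_vspace_affine:
  assumes f: "f \<in> borel_measurable (vspace d)" and r: "r \<noteq> 0"
  shows "(\<integral>\<^sup>+x. f x \<partial>vspace d)
    = ennreal (\<bar>r\<bar> ^ d) * (\<integral>\<^sup>+x. f (restrict (\<lambda>i. c i + r * x i) {..<d}) \<partial>vspace d)"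
    (is "_ = _ * (\<integral>\<^sup>+x. f (?T x) \<partial>_)")
proof -
  have T: "?T \<in> measurable (vspace d) (vspace d)"
    by (intro measurable_into_vspace borel_measurable_add borel_measurable_times borel_measurable_const measurable_vspace_component)
  have "(\<integral>\<^sup>+x. f x \<partial>vspace d)
      = (\<integral>\<^sup>+x. f x \<partial>density (distr (vspace d) (vspace d) ?T) (\<lambda>_. ennreal (\<bar>r\<bar> ^ d)))"
    by (simp only: vspace_affine[OF r])
  also have "\<dots> = (\<integral>\<^sup>+x. ennreal (\<bar>r\<bar> ^ d) * f x \<partial>distr (vspace d) (vspace d) ?T)"
    using f by (intro nn_integral_density) (simp_all add: measurable_distr_eq1)
  also have "\<dots> = (\<integral>\<^sup>+x. ennreal (\<bar>r\<bar> ^ d) * f (?T x) \<partial>vspace d)"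
    by (intro nn_integral_distr T) (use f in measurable)
  also have "\<dots> = ennreal (\<bar>r\<bar> ^ d) * (\<integral>\<^sup>+x. f (?T x) \<partial>vspace d)"
    by (rule nn_integral_cmult) (rule measurable_compose[OF T f])
  finally show ?thesis .
qed

section \<open>The Gaussian law as a density\<close>

definition gauss_density :: "nat \<Rightarrow> (nat \<Rightarrow> real) \<Rightarrow> real" where
  "gauss_density d x = (1 / sqrt (2 * pi)) ^ d * exp (- inner_d d x x / 2)"

lemma gauss_density_nonneg: "gauss_density d x \<ge> 0"
  by (simp add: gauss_density_def)

lemma inner_d_measurable_vspace [measurable]:
  "(\<lambda>x. inner_d d x x) \<in> borel_measurable (vspace d)"
  by (intro inner_d_measurable measurable_vspace_component)

lemma gauss_density_measurable [measurable]: "gauss_density d \<in> borel_measurable (vspace d)"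
  unfolding gauss_density_def by measurable

text \<open>\<open>gauss\<close> is a product of one-dimensional laws, but the substitutions below
  act on Lebesgue measure and mix two vectors, so a joint density is required. Both measures are
  compared on boxes.\<close>

lemma gauss_eq_density: "gauss d = density (vspace d) (\<lambda>x. ennreal (gauss_density d x))"
proof -
  interpret N: product_prob_space "\<lambda>_::nat. density lborel std_normal_density"
    by (rule product_prob_space_std_normal)
  interpret L: product_sigma_finite "\<lambda>_::nat. lborel :: real measure"
    by (rule product_sigma_finite_lborel)
  have "density (vspace d) (\<lambda>x. ennreal (gauss_density d x)) = PiM {..<d} (\<lambda>_. density lborel std_normal_density)"
  proof (rule N.PiM_eqI)
    fix A :: "nat \<Rightarrow> real set"
    assume "\<And>i. i \<in> {..<d} \<Longrightarrow> A i \<in> sets (density lborel std_normal_density)"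
    then have A: "\<And>i. i < d \<Longrightarrow> A i \<in> sets borel" by simp
    have PA: "PiE {..<d} A \<in> sets (vspace d)"
      unfolding vspace_def using A by (intro sets_PiM_I_finite) auto
    have gd: "gauss_density d x = (\<Prod>i<d. std_normal_density (x i))" for x
    proof -
      have "(\<Prod>i<d. std_normal_density (x i)) = (1 / sqrt (2 * pi)) ^ d * exp (\<Sum>i<d. - (x i)\<^sup>2 / 2)"
        unfolding std_normal_density_def prod.distrib exp_sum[OF finite_lessThan] by simp
      also have "(\<Sum>i<d. - (x i)\<^sup>2 / 2) = - inner_d d x x / 2"
        by (simp add: inner_d_def sum_negf sum_divide_distrib power2_eq_square)
      finally show ?thesis by (simp add: gauss_density_def)
    qed
    have "emeasure (density (vspace d) (\<lambda>x. ennreal (gauss_density d x))) (PiE {..<d} A)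
      = (\<integral>\<^sup>+x. ennreal (gauss_density d x) * indicator (PiE {..<d} A) x \<partial>vspace d)"
      using PA by (intro emeasure_density) measurable
    also have "\<dots> = (\<integral>\<^sup>+x. (\<Prod>i<d. ennreal (std_normal_density (x i)) * indicator (A i) (x i)) \<partial>vspace d)"
    proof (rule nn_integral_cong)
      fix x assume "x \<in> space (vspace d)"
      then have "indicator (PiE {..<d} A) x = (\<Prod>i<d. indicator (A i) (x i) :: ennreal)"
        by (auto simp: indicator_def space_vspace PiE_iff intro!: prod.neutral)
      then show "ennreal (gauss_density d x) * indicator (PiE {..<d} A) x
        = (\<Prod>i<d. ennreal (std_normal_density (x i)) * indicator (A i) (x i))"
        by (simp add: gd prod.distrib prod_ennreal)
    qed
    also have "\<dots> = (\<Prod>i<d. (\<integral>\<^sup>+x. ennreal (std_normal_density x) * indicator (A i) x \<partial>lborel))"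
      unfolding vspace_def using A by (intro L.product_nn_integral_prod) auto
    also have "\<dots> = (\<Prod>i<d. emeasure (density lborel std_normal_density) (A i))"
      using A by (intro prod.cong) (auto simp: emeasure_density)
    finally show "emeasure (density (vspace d) (\<lambda>x. ennreal (gauss_density d x))) (PiE {..<d} A)
      = (\<Prod>i\<in>{..<d}. emeasure (density lborel std_normal_density) (A i))" .
  next
    show "sets (density (vspace d) (\<lambda>x. ennreal (gauss_density d x)))
        = sets (PiM {..<d} (\<lambda>_. density lborel std_normal_density))"
      using sets_gauss[of d] by (simp add: gauss_def)
  qed simp
  then show ?thesis by (simp add: gauss_def)
qed

lemma nn_integral_gauss:
  assumes "f \<in> borel_measurable (vspace d)"
  shows "(\<integral>\<^sup>+x. f x \<partial>gauss d) = (\<integral>\<^sup>+x. ennreal (gauss_density d x) * f x \<partial>vspace d)"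
  unfolding gauss_eq_density using assms by (intro nn_integral_density) measurable

lemma bilin_restrict:
  "bilin d A (restrict u {..<d}) v = bilin d A u v" "bilin d A u (restrict v {..<d}) = bilin d A u v"
  by (simp_all add: bilin_altdef)

lemma inner_d_restrict:
  "inner_d d (restrict u {..<d}) v = inner_d d u v" "inner_d d u (restrict v {..<d}) = inner_d d u v"
  by (simp_all add: inner_d_def)

lemma nn_integral_gauss_pair:
  fixes F :: "(nat \<Rightarrow> real) \<times> (nat \<Rightarrow> real) \<Rightarrow> ennreal"
  assumes F [measurable]: "F \<in> borel_measurable (vspace d \<Otimes>\<^sub>M vspace d)"
  shows "(\<integral>\<^sup>+z. \<integral>\<^sup>+z'. F (z, z') \<partial>gauss d \<partial>gauss d)
    = (\<integral>\<^sup>+z. \<integral>\<^sup>+z'. ennreal (gauss_density d z) * ennreal (gauss_density d z') * F (z, z') \<partial>vspace d \<partial>vspace d)"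
proof -
  let ?V = "vspace d" and ?g = "\<lambda>z. ennreal (gauss_density d z)"
  interpret sigma_finite_measure ?V by (rule sigma_finite_vspace)
  have g [measurable]: "?g \<in> borel_measurable ?V" by measurable
  have sec: "(\<lambda>z'. F (z, z')) \<in> borel_measurable ?V" if "z \<in> space ?V" for z
    using that by measurable
  have "(\<integral>\<^sup>+z. \<integral>\<^sup>+z'. F (z, z') \<partial>gauss d \<partial>gauss d) = (\<integral>\<^sup>+z. \<integral>\<^sup>+z'. ?g z' * F (z, z') \<partial>?V \<partial>gauss d)"
    by (intro nn_integral_cong nn_integral_gauss sec) (simp add: space_gauss)
  also have "\<dots> = (\<integral>\<^sup>+z. ?g z * (\<integral>\<^sup>+z'. ?g z' * F (z, z') \<partial>?V) \<partial>?V)"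
    by (rule nn_integral_gauss) measurable
  also have "\<dots> = (\<integral>\<^sup>+z. \<integral>\<^sup>+z'. ?g z * (?g z' * F (z, z')) \<partial>?V \<partial>?V)"
    by (intro nn_integral_cong nn_integral_cmult[symmetric] borel_measurable_times_ennreal g sec)
  finally show ?thesis by (simp add: mult.assoc)
qed

text \<open>The pair $(z, z')$ is rotated to $z = (u+v)/\sqrt 2$, $z' = (v-u)/\sqrt 2$ in two affine
  substitutions, each in a single variable: first $z' = z - \sqrt 2\, u$, then $z = (u+v)/\sqrt 2$.\<close>
lemma gauss_exp_quadratic_difference:
  "(\<integral>\<^sup>+z. \<integral>\<^sup>+z'. ennreal (exp (bilin d A z z - bilin d A z' z')) \<partial>gauss d \<partial>gauss d)
   = (\<integral>\<^sup>+u. \<integral>\<^sup>+v. ennreal (exp (bilin d (\<lambda>i j. A i j + A j i) u v)) \<partial>gauss d \<partial>gauss d)"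
proof -
  let ?V = "vspace d"
  interpret sigma_finite_measure ?V by (rule sigma_finite_vspace)
  interpret VV: pair_sigma_finite ?V ?V ..
  let ?g = "gauss_density d"
  \<comment> \<open>The full integrand with both densities, so that only Lebesgue measure remains to
    be transformed.\<close>
  define h where "h z z' = ?g z * ?g z' * exp (bilin d A z z - bilin d A z' z')" for z z'
  have hm [measurable]: "(\<lambda>w. h (p w) (q w)) \<in> borel_measurable P"
    if "\<And>i. i < d \<Longrightarrow> (\<lambda>w. p w i) \<in> borel_measurable P" "\<And>i. i < d \<Longrightarrow> (\<lambda>w. q w i) \<in> borel_measurable P"
    for p q and P :: "'b measure"
  proof -
    have [measurable]: "(\<lambda>w. inner_d d (p w) (p w)) \<in> borel_measurable P"
      "(\<lambda>w. inner_d d (q w) (q w)) \<in> borel_measurable P"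
      "(\<lambda>w. bilin d A (p w) (p w)) \<in> borel_measurable P" "(\<lambda>w. bilin d A (q w) (q w)) \<in> borel_measurable P"
      using that by (auto intro!: inner_d_measurable bilin_measurable)
    show ?thesis unfolding h_def gauss_density_def by measurable
  qed
  have h_restrict: "h (restrict z {..<d}) z' = h z z'" "h z (restrict z' {..<d}) = h z z'" for z z'
    by (simp_all add: h_def gauss_density_def inner_d_restrict bilin_restrict)
  have to_V: "(\<integral>\<^sup>+z. \<integral>\<^sup>+z'. ennreal (f z z') \<partial>gauss d \<partial>gauss d)
      = (\<integral>\<^sup>+z. \<integral>\<^sup>+z'. ennreal (?g z * ?g z' * f z z') \<partial>?V \<partial>?V)"
    if "case_prod f \<in> borel_measurable (?V \<Otimes>\<^sub>M ?V)" "\<And>z z'. f z z' \<ge> 0" for f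
    using nn_integral_gauss_pair[OF measurable_compose[OF that(1) measurable_ennreal]] that(2)
    by (simp add: ennreal_mult gauss_density_nonneg)
  have comp: "(\<lambda>w. fst w i) \<in> borel_measurable (?V \<Otimes>\<^sub>M ?V)" "(\<lambda>w. snd w i) \<in> borel_measurable (?V \<Otimes>\<^sub>M ?V)"
    if "i < d" for i
    using that by (auto intro: measurable_compose[OF _ measurable_vspace_component])
  have bil: "case_prod (\<lambda>z z'. exp (bilin d B z z')) \<in> borel_measurable (?V \<Otimes>\<^sub>M ?V)"
    "case_prod (\<lambda>z z'. exp (bilin d B z z - bilin d B z' z')) \<in> borel_measurable (?V \<Otimes>\<^sub>M ?V)" for B
  proof -
    have [measurable]: "(\<lambda>w. bilin d B (fst w) (snd w)) \<in> borel_measurable (?V \<Otimes>\<^sub>M ?V)"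
      "(\<lambda>w. bilin d B (fst w) (fst w)) \<in> borel_measurable (?V \<Otimes>\<^sub>M ?V)"
      "(\<lambda>w. bilin d B (snd w) (snd w)) \<in> borel_measurable (?V \<Otimes>\<^sub>M ?V)"
      by (intro bilin_measurable comp; assumption)+
    show "case_prod (\<lambda>z z'. exp (bilin d B z z')) \<in> borel_measurable (?V \<Otimes>\<^sub>M ?V)"
    "case_prod (\<lambda>z z'. exp (bilin d B z z - bilin d B z' z')) \<in> borel_measurable (?V \<Otimes>\<^sub>M ?V)"
      unfolding case_prod_unfold by measurable
  qed
  let ?s = "sqrt 2"
  have "(\<integral>\<^sup>+z. \<integral>\<^sup>+z'. ennreal (exp (bilin d A z z - bilin d A z' z')) \<partial>gauss d \<partial>gauss d)
    = (\<integral>\<^sup>+z. \<integral>\<^sup>+z'. ennreal (h z z') \<partial>?V \<partial>?V)"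
    unfolding h_def by (rule to_V) (auto intro: bil)
  \<comment> \<open>Substitution z' = z - sqrt 2 u at fixed z, with Jacobian (sqrt 2)^d.\<close>
  also have "\<dots> = (\<integral>\<^sup>+z. ennreal (?s ^ d) * (\<integral>\<^sup>+u. ennreal (h z (\<lambda>i. z i + (- ?s) * u i)) \<partial>?V) \<partial>?V)"
  proof (rule nn_integral_cong)
    fix z :: "nat \<Rightarrow> real"
    have [measurable]: "(\<lambda>z'. h z z') \<in> borel_measurable ?V"
      by (intro hm borel_measurable_const measurable_vspace_component) auto
    show "(\<integral>\<^sup>+z'. ennreal (h z z') \<partial>?V) = ennreal (?s ^ d) * (\<integral>\<^sup>+u. ennreal (h z (\<lambda>i. z i + (- ?s) * u i)) \<partial>?V)"
      by (subst nn_integral_vspace_affine[of _ _ "- ?s" z]) (simp_all only: h_restrict, simp_all)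
  qed
  also have "\<dots> = ennreal (?s ^ d) * (\<integral>\<^sup>+z. \<integral>\<^sup>+u. ennreal (h z (\<lambda>i. z i + (- ?s) * u i)) \<partial>?V \<partial>?V)"
  proof (rule nn_integral_cmult)
    have "(\<lambda>w. h (fst w) (\<lambda>i. fst w i + (- ?s) * snd w i)) \<in> borel_measurable (?V \<Otimes>\<^sub>M ?V)"
      by (intro hm borel_measurable_add borel_measurable_times borel_measurable_const comp)
    then show "(\<lambda>z. \<integral>\<^sup>+u. ennreal (h z (\<lambda>i. z i + (- ?s) * u i)) \<partial>?V) \<in> borel_measurable ?V"
      by (intro borel_measurable_nn_integral) (simp add: case_prod_unfold)
  qed
  \<comment> \<open>The swap makes u the fixed variable for the second substitution z = (u + v) /
    sqrt 2, whose Jacobian (1 / sqrt 2)^d cancels the first one at the end.\<close>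
  also have "(\<integral>\<^sup>+z. \<integral>\<^sup>+u. ennreal (h z (\<lambda>i. z i + (- ?s) * u i)) \<partial>?V \<partial>?V)
     = (\<integral>\<^sup>+u. \<integral>\<^sup>+z. ennreal (h z (\<lambda>i. z i + (- ?s) * u i)) \<partial>?V \<partial>?V)"
  proof (rule VV.Fubini'[symmetric])
    have "(\<lambda>w. h (fst w) (\<lambda>i. fst w i + (- ?s) * snd w i)) \<in> borel_measurable (?V \<Otimes>\<^sub>M ?V)"
      by (intro hm borel_measurable_add borel_measurable_times borel_measurable_const comp)
    then show "(\<lambda>(z, u). ennreal (h z (\<lambda>i. z i + (- ?s) * u i))) \<in> borel_measurable (?V \<Otimes>\<^sub>M ?V)"
      by (simp add: case_prod_unfold)
  qed
  also have "\<dots> = (\<integral>\<^sup>+u. ennreal ((1/?s) ^ d) *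
      (\<integral>\<^sup>+v. ennreal (h (\<lambda>i. u i / ?s + (1/?s) * v i) (\<lambda>i. - (u i / ?s) + (1/?s) * v i)) \<partial>?V) \<partial>?V)"
  proof (rule nn_integral_cong)
    fix u assume "u \<in> space ?V"
    have m: "(\<lambda>z. h z (\<lambda>i. z i + (- ?s) * u i)) \<in> borel_measurable ?V" by (intro hm borel_measurable_add borel_measurable_times borel_measurable_const measurable_vspace_component)
    have *: "h (restrict x {..<d}) (\<lambda>i. restrict x {..<d} i + (- ?s) * u i) = h x (\<lambda>i. x i + (- ?s) * u i)" for x
    proof -
      have "h (restrict x {..<d}) (\<lambda>i. restrict x {..<d} i + (- ?s) * u i)
        = h x (restrict (\<lambda>i. restrict x {..<d} i + (- ?s) * u i) {..<d})"
        by (simp only: h_restrict)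
      also have "restrict (\<lambda>i. restrict x {..<d} i + (- ?s) * u i) {..<d} = restrict (\<lambda>i. x i + (- ?s) * u i) {..<d}"
        by auto
      finally show ?thesis by (simp only: h_restrict)
    qed
    have e: "(\<lambda>i. (u i / ?s + (1/?s) * v i) + (- ?s) * u i) = (\<lambda>i. - (u i / ?s) + (1/?s) * v i)" for v
    proof
      fix i
      have "?s * (u i / ?s) = u i" by simp
      then have "?s * u i = (?s * ?s) * (u i / ?s)" by (simp only: mult.assoc)
      then have "?s * u i = 2 * (u i / ?s)" by simp
      then show "(u i / ?s + (1/?s) * v i) + (- ?s) * u i = - (u i / ?s) + (1/?s) * v i" by simp
    qed
    show "(\<integral>\<^sup>+z. ennreal (h z (\<lambda>i. z i + (- ?s) * u i)) \<partial>?V)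
      = ennreal ((1/?s) ^ d) * (\<integral>\<^sup>+v. ennreal (h (\<lambda>i. u i / ?s + (1/?s) * v i) (\<lambda>i. - (u i / ?s) + (1/?s) * v i)) \<partial>?V)"
      by (subst nn_integral_vspace_affine[of _ _ "1 / ?s" "\<lambda>i. u i / ?s"])
         (use m in \<open>simp_all only: * e measurable_ennreal measurable_compose, simp_all\<close>)
  qed
  also have "\<dots> = (\<integral>\<^sup>+u. ennreal ((1/?s) ^ d) *
      (\<integral>\<^sup>+v. ennreal (?g u * ?g v * exp (bilin d (\<lambda>i j. A i j + A j i) u v)) \<partial>?V) \<partial>?V)"
  proof -
    have "h (\<lambda>i. u i / ?s + (1/?s) * v i) (\<lambda>i. - (u i / ?s) + (1/?s) * v i)
      = ?g u * ?g v * exp (bilin d (\<lambda>i j. A i j + A j i) u v)" for u v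
    proof -
      let ?p = "\<lambda>i. u i / ?s + (1/?s) * v i" and ?q = "\<lambda>i. - (u i / ?s) + (1/?s) * v i"
      have sq: "?s * ?s = 2" by simp
      have pp: "?p i * ?p j = (u i + v i) * (u j + v j) / 2" "?q i * ?q j = (v i - u i) * (v j - u j) / 2" for i j
      proof -
        have "?p i = (u i + v i) / ?s" "?p j = (u j + v j) / ?s" "?q i = (v i - u i) / ?s" "?q j = (v j - u j) / ?s"
          by (simp_all add: add_divide_distrib diff_divide_distrib)
        then show "?p i * ?p j = (u i + v i) * (u j + v j) / 2" "?q i * ?q j = (v i - u i) * (v j - u j) / 2"
          by (simp_all only: times_divide_times_eq sq)
      qed
      \<comment> \<open>The rotation preserves the sum of the two squared norms, hence the product
        of the two Gaussian densities.\<close>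
      have n: "inner_d d ?p ?p + inner_d d ?q ?q = inner_d d u u + inner_d d v v"
        unfolding inner_d_def pp sum.distrib[symmetric]
        by (intro sum.cong) (auto simp: field_simps)
      \<comment> \<open>The u-u and v-v products drop out of the difference and only cross terms
        remain: this is the decoupling.\<close>
      have "A i j * ?p i * ?p j - A i j * ?q i * ?q j = A i j * u i * v j + A i j * v i * u j" for i j
        unfolding mult.assoc pp by (simp add: field_simps)
      then have "bilin d A ?p ?p - bilin d A ?q ?q = bilin d A u v + bilin d A v u"
        unfolding bilin_altdef sum_subtractf[symmetric] sum.distrib[symmetric] by simp
      also have "\<dots> = bilin d A u v + bilin d (mat_transp A) u v"
        by (simp add: bilin_transp)
      also have "\<dots> = bilin d (\<lambda>i j. A i j + A j i) u v"
        by (simp add: bilin_altdef mat_transp_def sum.distrib algebra_simps)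
      finally have b: "bilin d A ?p ?p - bilin d A ?q ?q = bilin d (\<lambda>i j. A i j + A j i) u v" .
      have "?g ?p * ?g ?q = (1 / sqrt (2 * pi)) ^ d * (1 / sqrt (2 * pi)) ^ d * exp (- (inner_d d ?p ?p + inner_d d ?q ?q) / 2)"
        unfolding gauss_density_def by (simp add: exp_add[symmetric] add_divide_distrib)
      also have "\<dots> = ?g u * ?g v"
        unfolding n gauss_density_def by (simp add: exp_add[symmetric] add_divide_distrib)
      finally show ?thesis unfolding h_def b by simp
    qed
    then show ?thesis by simp
  qed
  also have "\<dots> = ennreal ((1/?s) ^ d) * (\<integral>\<^sup>+u. \<integral>\<^sup>+v. ennreal (?g u * ?g v * exp (bilin d (\<lambda>i j. A i j + A j i) u v)) \<partial>?V \<partial>?V)"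
    by (rule nn_integral_cmult) (use bil(1) in \<open>simp add: case_prod_unfold\<close>)
  also have "(\<integral>\<^sup>+u. \<integral>\<^sup>+v. ennreal (?g u * ?g v * exp (bilin d (\<lambda>i j. A i j + A j i) u v)) \<partial>?V \<partial>?V)
    = (\<integral>\<^sup>+u. \<integral>\<^sup>+v. ennreal (exp (bilin d (\<lambda>i j. A i j + A j i) u v)) \<partial>gauss d \<partial>gauss d)"
    by (rule to_V[symmetric]) (auto intro: bil)
  finally show ?thesis
    by (simp add: mult.assoc[symmetric] ennreal_mult[symmetric] power_mult_distrib[symmetric])
qed

section \<open>The mean of a Gaussian quadratic form and the Hanson-Wright bound\<close>

definition trace_d :: "nat \<Rightarrow> (nat \<Rightarrow> nat \<Rightarrow> real) \<Rightarrow> real" where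
  "trace_d d A = (\<Sum>i<d. A i i)"

lemma gauss_product_moment:
  assumes "i < d" "j < d"
  shows "integrable (gauss d) (\<lambda>z. z i * z j)"
    "(\<integral>z. z i * z j \<partial>gauss d) = (if i = j then 1 else 0)"
proof -
  let ?N = std_normal_distribution
  interpret product_prob_space "\<lambda>_::nat. ?N"
    by (rule product_prob_space_std_normal)
  \<comment> \<open>The exponent counts how often k occurs in the pair (i, j). This writes z i * z j
    as a product over all coordinates, to which the product formula for integrals applies whether or
    not i = j.\<close>
  define f :: "nat \<Rightarrow> real \<Rightarrow> real"
    where "f k x = x ^ ((if k = i then 1 else 0) + (if k = j then 1 else 0))" for k x
  have prod: "z i * z j = (\<Prod>k<d. f k (z k))" for z :: "nat \<Rightarrow> real"
  proof -
    have "(\<Prod>k<d. f k (z k)) = (\<Prod>k<d. if k = i then z k else 1) * (\<Prod>k<d. if k = j then z k else 1)"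
      unfolding prod.distrib[symmetric] f_def by (intro prod.cong) (auto simp: power2_eq_square)
    then show ?thesis using assms by (simp add: prod.delta)
  qed
  have f_int: "integrable ?N (f k)" for k
    unfolding f_def by (rule integrable_std_normal_distribution_moment)
  show "integrable (gauss d) (\<lambda>z. z i * z j)"
    unfolding prod gauss_def using f_int by (intro product_integrable_prod) auto
  have m1: "(\<integral>x. x \<partial>?N) = 0" using integral_std_normal_distribution_moment_odd[of 1] by simp
  have m2: "(\<integral>x. x\<^sup>2 \<partial>?N) = 1" using std_normal_distribution_even_moments(1)[of 1] by (simp add: fact_numeral)
  have m0: "(\<integral>x. 1 \<partial>?N) = (1::real)" using prob_space.prob_space[OF prob_space_std_normal] by simp
  have "(\<integral>z. z i * z j \<partial>gauss d) = (\<Prod>k<d. \<integral>x. f k x \<partial>?N)"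
    unfolding prod gauss_def using f_int by (intro product_integral_prod) auto
  also have "\<dots> = (if i = j then 1 else 0)"
  proof (cases "i = j")
    case True
    then have "(\<integral>x. f k x \<partial>?N) = 1" for k
      using m0 m2 by (cases "k = j") (simp_all add: f_def numeral_2_eq_2)
    then show ?thesis using True by simp
  next
    case False
    then have "(\<integral>x. f i x \<partial>?N) = 0" using m1 by (simp add: f_def)
    then show ?thesis using False assms by (auto intro!: prod_zero)
  qed
  finally show "(\<integral>z. z i * z j \<partial>gauss d) = (if i = j then 1 else 0)" .
qed

lemma gauss_quadratic_moment:
  "integrable (gauss d) (\<lambda>z. bilin d A z z)" "(\<integral>z. bilin d A z z \<partial>gauss d) = trace_d d A"
proof -
  have I: "integrable (gauss d) (\<lambda>z. A i j * z i * z j)" if "i < d" "j < d" for i j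
    using gauss_product_moment(1)[OF that] by (simp add: mult.assoc)
  show "integrable (gauss d) (\<lambda>z. bilin d A z z)"
    unfolding bilin_altdef using I by (intro Bochner_Integration.integrable_sum) auto
  have "(\<integral>z. bilin d A z z \<partial>gauss d) = (\<Sum>i<d. \<integral>z. (\<Sum>j<d. A i j * z i * z j) \<partial>gauss d)"
    unfolding bilin_altdef using I
    by (intro Bochner_Integration.integral_sum Bochner_Integration.integrable_sum) auto
  also have "\<dots> = (\<Sum>i<d. \<Sum>j<d. \<integral>z. A i j * z i * z j \<partial>gauss d)"
    using I by (intro sum.cong refl Bochner_Integration.integral_sum) auto
  also have "\<dots> = (\<Sum>i<d. \<Sum>j<d. A i j * (if i = j then 1 else 0))"
    using gauss_product_moment(2)[of _ d] by (intro sum.cong refl) (simp add: mult.assoc)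
  also have "\<dots> = trace_d d A" by (simp add: trace_d_def if_distrib cong: if_cong)
  finally show "(\<integral>z. bilin d A z z \<partial>gauss d) = trace_d d A" .
qed

text \<open>Jensen's inequality for a centred variable, from exp x \<ge> 1 + x. If exp X is not
  integrable the right-hand side is infinite, so integrability need not be known beforehand.\<close>

lemma one_le_nn_integral_exp:
  assumes "prob_space M" and X: "integrable M X" "(\<integral>x. X x \<partial>M) = 0"
  shows "1 \<le> (\<integral>\<^sup>+x. ennreal (exp (X x)) \<partial>M)"
proof (cases "integrable M (\<lambda>x. exp (X x))")
  case True
  interpret prob_space M by fact
  have "(\<integral>x. 1 + X x \<partial>M) \<le> (\<integral>x. exp (X x) \<partial>M)"
    using X True by (intro integral_mono) (auto intro: exp_ge_add_one_self)
  then have "1 \<le> (\<integral>x. exp (X x) \<partial>M)" using X by (simp add: prob_space)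
  then show ?thesis using True by (subst nn_integral_eq_integral) auto
next
  case False
  have "(\<lambda>x. exp (X x)) \<in> borel_measurable M" using X(1) by measurable
  then have "(\<integral>\<^sup>+x. ennreal (exp (X x)) \<partial>M) = \<infinity>"
    using False by (auto simp: integrable_iff_bounded less_top[symmetric])
  then show ?thesis by simp
qed

lemma frob_sq_symm_le: "frob_sq d (\<lambda>i j. A i j + A j i) \<le> 4 * frob_sq d A"
proof -
  have sq: "(x + y)\<^sup>2 \<le> 2 * x\<^sup>2 + 2 * y\<^sup>2" for x y :: real
    using zero_le_power2[of "x - y"] by (simp add: power2_sum power2_diff)
  have "frob_sq d (\<lambda>i j. A i j + A j i) \<le> (\<Sum>i<d. \<Sum>j<d. 2 * (A i j)\<^sup>2 + 2 * (A j i)\<^sup>2)"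
    unfolding frob_sq_def by (intro sum_mono sq)
  also have "\<dots> = 2 * frob_sq d A + 2 * frob_sq d (mat_transp A)"
    by (simp add: frob_sq_def mat_transp_def sum.distrib sum_distrib_left)
  finally show ?thesis by (simp add: frob_sq_transp)
qed

text \<open>Hanson-Wright: Jensen's inequality centres the form by subtracting an independent copy, and
  the difference of the two copies is a decoupled bilinear form after a rotation.\<close>
lemma gauss_exp_quadratic:
  assumes "frob_sq d A \<le> 1/16"
  shows "(\<integral>\<^sup>+z. ennreal (exp (bilin d A z z)) \<partial>gauss d) \<le> ennreal (2 * exp (trace_d d A))"
proof -
  interpret G: prob_space "gauss d" by (rule prob_space_gauss)
  let ?q = "\<lambda>z. bilin d A z z" and ?t = "trace_d d A"
  have qm [measurable]: "?q \<in> borel_measurable (gauss d)"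
    by (intro bilin_measurable measurable_gauss_component)
  have one: "1 \<le> (\<integral>\<^sup>+z. ennreal (exp (?t - ?q z)) \<partial>gauss d)"
    using gauss_quadratic_moment[of d A] G.prob_space
    by (intro one_le_nn_integral_exp G.prob_space_axioms) auto
  have "(\<integral>\<^sup>+z. ennreal (exp (?q z)) \<partial>gauss d) = (\<integral>\<^sup>+z. ennreal (exp ?t) * ennreal (exp (?q z - ?t)) \<partial>gauss d)"
    by (simp add: ennreal_mult[symmetric] exp_add[symmetric])
  also have "\<dots> = ennreal (exp ?t) * (\<integral>\<^sup>+z. ennreal (exp (?q z - ?t)) * 1 \<partial>gauss d)"
    by (subst nn_integral_cmult) auto
  \<comment> \<open>The factor 1 is enlarged to the exponential moment of the centred independent
    copy, which Jensen's inequality bounds below by 1.\<close>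
  also have "\<dots> \<le> ennreal (exp ?t) * (\<integral>\<^sup>+z. ennreal (exp (?q z - ?t)) * (\<integral>\<^sup>+z'. ennreal (exp (?t - ?q z')) \<partial>gauss d) \<partial>gauss d)"
    by (intro mult_left_mono nn_integral_mono one) auto
  also have "\<dots> = ennreal (exp ?t) * (\<integral>\<^sup>+z. \<integral>\<^sup>+z'. ennreal (exp (?q z - ?q z')) \<partial>gauss d \<partial>gauss d)"
    by (subst nn_integral_cmult[symmetric]) (auto simp: ennreal_mult[symmetric] exp_add[symmetric])
  \<comment> \<open>Symmetrising A multiplies its squared Frobenius norm by at most 4, which
    explains 1/16 here against the 1/4 of \<open>subgauss_exp_bilin\<close>.\<close>
  also have "\<dots> \<le> ennreal (exp ?t) * ennreal (2 * 1 * 1)"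
    unfolding gauss_exp_quadratic_difference
    using assms frob_sq_symm_le[of d A]
    by (intro mult_left_mono subgauss_exp_bilin[OF subgauss_gauss subgauss_gauss]) auto
  also have "\<dots> = ennreal (2 * exp ?t)"
    by (subst ennreal_mult[symmetric]) (auto simp: mult.commute)
  finally show ?thesis .
qed

section \<open>The uniform distribution on the sphere\<close>

definition scale_d :: "nat \<Rightarrow> real \<Rightarrow> (nat \<Rightarrow> real) \<Rightarrow> (nat \<Rightarrow> real)" where
  "scale_d d r x = restrict (\<lambda>i. r * x i) {..<d}"

lemma inner_d_scale_d: "inner_d d (scale_d d r x) (scale_d d r x) = r\<^sup>2 * inner_d d x x"
  unfolding scale_d_def inner_d_restrict
  by (subst inner_d_scale, subst inner_d_scale2) (simp add: power2_eq_square)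

text \<open>Integrate over x before t. Since g is constant along rays, the ball |x|^2 < 2 t
  contributes (sqrt (2 t))^d times the unit-ball integral of g, so the integral over t splits off as
  a factor that does not involve g.\<close>

lemma nn_integral_homogeneous_layer_cake:
  fixes g :: "(nat \<Rightarrow> real) \<Rightarrow> ennreal" and w :: "real \<Rightarrow> ennreal"
  assumes g [measurable]: "g \<in> borel_measurable (vspace d)" and w [measurable]: "w \<in> borel_measurable borel"
    and hom: "\<And>r x. r > 0 \<Longrightarrow> g (scale_d d r x) = g x"
  shows "(\<integral>\<^sup>+x. g x * (\<integral>\<^sup>+t. w t * (if inner_d d x x < 2 * t then 1 else 0) \<partial>lborel) \<partial>vspace d)
    = (\<integral>\<^sup>+t. w t * ennreal (if t > 0 then sqrt (2 * t) ^ d else 0) \<partial>lborel)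
       * (\<integral>\<^sup>+x. g x * (if inner_d d x x < 1 then 1 else 0) \<partial>vspace d)" (is "?L = _ * ?J")
proof -
  let ?V = "vspace d"
  interpret V: sigma_finite_measure ?V by (rule sigma_finite_vspace)
  interpret VL: pair_sigma_finite ?V "lborel :: real measure" ..
  have "?L = (\<integral>\<^sup>+x. \<integral>\<^sup>+t. g x * (w t * (if inner_d d x x < 2 * t then 1 else 0)) \<partial>lborel \<partial>?V)"
    by (intro nn_integral_cong nn_integral_cmult[symmetric]) measurable
  also have "\<dots> = (\<integral>\<^sup>+t. \<integral>\<^sup>+x. g x * (w t * (if inner_d d x x < 2 * t then 1 else 0)) \<partial>?V \<partial>lborel)"
    by (rule VL.Fubini'[symmetric]) measurable
  also have "\<dots> = (\<integral>\<^sup>+t. w t * (\<integral>\<^sup>+x. g x * (if inner_d d x x < 2 * t then 1 else 0) \<partial>?V) \<partial>lborel)"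
    by (intro nn_integral_cong, subst nn_integral_cmult[symmetric]) (auto simp: mult_ac)
  also have "\<dots> = (\<integral>\<^sup>+t. w t * (ennreal (if t > 0 then sqrt (2 * t) ^ d else 0) * ?J) \<partial>lborel)"
  proof (intro nn_integral_cong arg_cong2[where f = "(*)"] refl)
    fix t :: real
    show "(\<integral>\<^sup>+x. g x * (if inner_d d x x < 2 * t then 1 else 0) \<partial>?V)
        = ennreal (if t > 0 then sqrt (2 * t) ^ d else 0) * ?J"
    proof (cases "t > 0")
      case True
      let ?r = "sqrt (2 * t)"
      have r: "?r > 0" "?r \<noteq> 0" using True by auto
      have "(\<integral>\<^sup>+x. g x * (if inner_d d x x < 2 * t then 1 else 0) \<partial>?V)
        = ennreal (\<bar>?r\<bar> ^ d) * (\<integral>\<^sup>+x. g (scale_d d ?r x) *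
            (if inner_d d (scale_d d ?r x) (scale_d d ?r x) < 2 * t then 1 else 0) \<partial>?V)"
        by (subst nn_integral_vspace_affine[OF _ r(2), of _ _ "\<lambda>_. 0"]) (auto simp: scale_d_def)
      also have "\<dots> = ennreal (?r ^ d) * ?J"
      proof -
        have "(inner_d d (scale_d d ?r x) (scale_d d ?r x) < 2 * t) = (inner_d d x x < 1)" for x
          using True unfolding inner_d_scale_d by simp
        then show ?thesis using hom[OF r(1)] True by simp
      qed
      finally show ?thesis using True by simp
    next
      case False
      then have "\<not> inner_d d x x < 2 * t" for x using inner_d_nonneg[of d x] by simp
      then show ?thesis using False by simp
    qed
  qed
  also have "\<dots> = (\<integral>\<^sup>+t. w t * ennreal (if t > 0 then sqrt (2 * t) ^ d else 0) \<partial>lborel) * ?J"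
    unfolding mult.assoc[symmetric] by (rule nn_integral_multc) measurable
  finally show ?thesis .
qed

lemma nn_integral_tail:
  fixes F :: "real \<Rightarrow> real"
  assumes [measurable]: "f \<in> borel_measurable borel"
    and "\<And>x. a \<le> x \<Longrightarrow> (F has_real_derivative f x) (at x)" "\<And>x. a \<le> x \<Longrightarrow> 0 \<le> f x"
    and "(F \<longlongrightarrow> 0) at_top"
  shows "(\<integral>\<^sup>+t. ennreal (f t) * (if a < t then 1 else 0) \<partial>lborel) = ennreal (- F a)"
proof -
  have "(\<integral>\<^sup>+t. ennreal (f t) * (if a < t then 1 else 0) \<partial>lborel) = (\<integral>\<^sup>+t. ennreal (f t) * indicator {a..} t \<partial>lborel)"
    using AE_lborel_singleton[of a] by (intro nn_integral_cong_AE) (auto split: split_indicator)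
  also have "\<dots> = ennreal (0 - F a)"
    using assms by (intro nn_integral_FTC_atLeast) auto
  finally show ?thesis by simp
qed

text \<open>Both $e^{-a}$ and $(a+1)e^{-a}$ are tails $\int_a^\infty w$ of non-negative weights, so the layer
  cake formula applies to them with $a = |x|^2/2$; they give the zeroth and second radial moment.\<close>
lemma gauss_homogeneous:
  obtains K0 K1 :: ennreal where
    "\<And>g. g \<in> borel_measurable (vspace d) \<Longrightarrow> (\<And>r x. r > 0 \<Longrightarrow> g (scale_d d r x) = g x) \<Longrightarrow>
      (\<integral>\<^sup>+x. g x \<partial>gauss d) = K0 * (\<integral>\<^sup>+x. g x * (if inner_d d x x < 1 then 1 else 0) \<partial>vspace d)"
    "\<And>g. g \<in> borel_measurable (vspace d) \<Longrightarrow> (\<And>r x. r > 0 \<Longrightarrow> g (scale_d d r x) = g x) \<Longrightarrow>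
      (\<integral>\<^sup>+x. g x * ennreal (inner_d d x x / 2 + 1) \<partial>gauss d)
        = K1 * (\<integral>\<^sup>+x. g x * (if inner_d d x x < 1 then 1 else 0) \<partial>vspace d)"
proof -
  define c where "c = (1 / sqrt (2 * pi)) ^ d"
  have c: "c \<ge> 0" by (simp add: c_def)
  define w0 where "w0 t = c * exp (- t)" for t :: real
  define w1 where "w1 t = c * (t * exp (- t))" for t :: real
  have [measurable]: "w0 \<in> borel_measurable borel" "w1 \<in> borel_measurable borel"
    unfolding w0_def w1_def by measurable
  let ?N = "\<lambda>x. inner_d d x x"
  have lim0: "((\<lambda>t::real. exp (- t)) \<longlongrightarrow> 0) at_top"
    using tendsto_power_div_exp_0[of 0] by (simp add: exp_minus divide_inverse)
  have lim1: "((\<lambda>t::real. t * exp (- t)) \<longlongrightarrow> 0) at_top"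
    using tendsto_power_div_exp_0[of 1] by (simp add: exp_minus divide_inverse)
  have i0: "(\<integral>\<^sup>+t. ennreal (w0 t) * (if ?N x < 2 * t then 1 else 0) \<partial>lborel) = ennreal (gauss_density d x)" for x
  proof -
    have "(\<integral>\<^sup>+t. ennreal (w0 t) * (if ?N x / 2 < t then 1 else 0) \<partial>lborel) = ennreal (- (- c * exp (- (?N x / 2))))"
    proof (rule nn_integral_tail)
      show "((\<lambda>t. - c * exp (- t)) \<longlongrightarrow> 0) at_top"
        using tendsto_mult_left[OF lim0, of "- c"] by simp
      show "((\<lambda>t. - c * exp (- t)) has_real_derivative w0 t) (at t)" for t
        unfolding w0_def by (auto intro!: derivative_eq_intros)
    qed (auto simp: w0_def c)
    moreover have "?N x / 2 < t \<longleftrightarrow> ?N x < 2 * t" for t by auto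
    ultimately show ?thesis by (simp add: gauss_density_def c_def)
  qed
  have i1: "(\<integral>\<^sup>+t. ennreal (w1 t) * (if ?N x < 2 * t then 1 else 0) \<partial>lborel)
      = ennreal (gauss_density d x) * ennreal (?N x / 2 + 1)" for x
  proof -
    have "(\<integral>\<^sup>+t. ennreal (w1 t) * (if ?N x / 2 < t then 1 else 0) \<partial>lborel)
        = ennreal (- (- c * (?N x / 2 * exp (- (?N x / 2)) + exp (- (?N x / 2)))))"
    proof (rule nn_integral_tail)
      show "((\<lambda>t. - c * (t * exp (- t) + exp (- t))) \<longlongrightarrow> 0) at_top"
        using tendsto_mult_left[OF tendsto_add[OF lim1 lim0], of "- c"] by simp
      show "((\<lambda>t. - c * (t * exp (- t) + exp (- t))) has_real_derivative w1 t) (at t)" for t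
        unfolding w1_def by (auto intro!: derivative_eq_intros simp: algebra_simps)
      show "0 \<le> w1 t" if "?N x / 2 \<le> t" for t
      proof -
        have "t \<ge> 0" using that inner_d_nonneg[of d x] by linarith
        then show ?thesis by (simp add: w1_def c)
      qed
    qed simp
    also have "- (- c * (?N x / 2 * exp (- (?N x / 2)) + exp (- (?N x / 2)))) = gauss_density d x * (?N x / 2 + 1)"
      by (simp add: gauss_density_def c_def algebra_simps)
    finally have "(\<integral>\<^sup>+t. ennreal (w1 t) * (if ?N x / 2 < t then 1 else 0) \<partial>lborel)
        = ennreal (gauss_density d x) * ennreal (?N x / 2 + 1)"
      using inner_d_nonneg[of d x] by (simp add: ennreal_mult gauss_density_nonneg)
    moreover have "?N x / 2 < t \<longleftrightarrow> ?N x < 2 * t" for t by auto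
    ultimately show ?thesis by simp
  qed
  \<comment> \<open>K0 and K1 are the t-integrals of the layer cake formula, which depend on d but
    not on g.\<close>
  show thesis
  proof (rule that)
    fix g :: "(nat \<Rightarrow> real) \<Rightarrow> ennreal"
    assume g [measurable]: "g \<in> borel_measurable (vspace d)"
      and hom: "\<And>r x. r > 0 \<Longrightarrow> g (scale_d d r x) = g x"
    have "(\<integral>\<^sup>+x. g x \<partial>gauss d) = (\<integral>\<^sup>+x. g x * ennreal (gauss_density d x) \<partial>vspace d)"
      by (simp add: nn_integral_gauss[OF g] mult.commute)
    also have "\<dots> = (\<integral>\<^sup>+t. ennreal (w0 t) * ennreal (if t > 0 then sqrt (2 * t) ^ d else 0) \<partial>lborel)
        * (\<integral>\<^sup>+x. g x * (if ?N x < 1 then 1 else 0) \<partial>vspace d)"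
      unfolding i0[symmetric] by (rule nn_integral_homogeneous_layer_cake) (auto simp: hom)
    finally show "(\<integral>\<^sup>+x. g x \<partial>gauss d) = \<dots>" .
    have "(\<integral>\<^sup>+x. g x * ennreal (?N x / 2 + 1) \<partial>gauss d)
        = (\<integral>\<^sup>+x. ennreal (gauss_density d x) * (g x * ennreal (?N x / 2 + 1)) \<partial>vspace d)"
      by (rule nn_integral_gauss) measurable
    also have "\<dots> = (\<integral>\<^sup>+x. g x * (ennreal (gauss_density d x) * ennreal (?N x / 2 + 1)) \<partial>vspace d)"
      by (simp only: mult.left_commute)
    also have "\<dots> = (\<integral>\<^sup>+t. ennreal (w1 t) * ennreal (if t > 0 then sqrt (2 * t) ^ d else 0) \<partial>lborel)
        * (\<integral>\<^sup>+x. g x * (if ?N x < 1 then 1 else 0) \<partial>vspace d)"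
      unfolding i1[symmetric] by (rule nn_integral_homogeneous_layer_cake) (auto simp: hom)
    finally show "(\<integral>\<^sup>+x. g x * ennreal (?N x / 2 + 1) \<partial>gauss d) = \<dots>" .
  qed
qed

definition id_mat :: "nat \<Rightarrow> nat \<Rightarrow> real" where
  "id_mat i j = (if i = j then 1 else 0)"

lemma bilin_id_mat: "bilin d id_mat x y = inner_d d x y"
  by (simp add: bilin_altdef inner_d_def id_mat_def if_distrib if_distribR cong: if_cong)

lemma trace_id_mat: "trace_d d id_mat = d"
  by (simp add: trace_d_def id_mat_def)

lemma frob_sq_id_mat: "frob_sq d id_mat = d"
proof -
  have "(id_mat i j)\<^sup>2 = (if i = j then 1 else 0)" for i j by (simp add: id_mat_def)
  then show ?thesis by (simp add: frob_sq_def)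
qed

lemma gauss_norm_moment: "(\<integral>\<^sup>+x. ennreal (inner_d d x x / 2 + 1) \<partial>gauss d) = ennreal (real d / 2 + 1)"
proof -
  interpret G: prob_space "gauss d" by (rule prob_space_gauss)
  note q = gauss_quadratic_moment[of d id_mat, unfolded bilin_id_mat trace_id_mat]
  show ?thesis
    using q G.prob_space inner_d_nonneg[of d] by (subst nn_integral_eq_integral) auto
qed

lemma emeasure_unit_ball: "emeasure (vspace d) (unit_ball_d d) = (\<integral>\<^sup>+x. (if inner_d d x x < 1 then 1 else 0) \<partial>vspace d)"
proof -
  have "unit_ball_d d = {x \<in> space (vspace d). inner_d d x x < 1}"
    by (simp add: unit_ball_d_def inner_d_def power2_eq_square)
  then have "emeasure (vspace d) (unit_ball_d d) = (\<integral>\<^sup>+x. indicator {x \<in> space (vspace d). inner_d d x x < 1} x \<partial>vspace d)"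
    by simp
  also have "\<dots> = (\<integral>\<^sup>+x. (if inner_d d x x < 1 then 1 else 0) \<partial>vspace d)"
    by (intro nn_integral_cong) (auto split: split_indicator)
  finally show ?thesis .
qed

lemma unit_ball_sets: "unit_ball_d d \<in> sets (vspace d)"
proof -
  have "unit_ball_d d = {x \<in> space (vspace d). inner_d d x x < 1}"
    by (simp add: unit_ball_d_def inner_d_def power2_eq_square)
  then show ?thesis by simp
qed

text \<open>Both constants are found by testing with g = 1: the total Gaussian mass gives K0 = 1 /
  vol, and the mean of |z|^2 / 2 + 1, which is d / 2 + 1, gives K1 = (d / 2 + 1) K0. The equation K0
  * vol = 1 shows in passing that the ball has positive finite volume, without any volume
  formula.\<close>

lemma
  shows emeasure_unit_ball_nonzero: "emeasure (vspace d) (unit_ball_d d) \<noteq> 0"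
    and emeasure_unit_ball_finite: "emeasure (vspace d) (unit_ball_d d) \<noteq> \<infinity>"
    and gauss_homogeneous_eq_ball: "\<And>g. g \<in> borel_measurable (vspace d) \<Longrightarrow>
      (\<And>r x. r > 0 \<Longrightarrow> g (scale_d d r x) = g x) \<Longrightarrow>
      (\<integral>\<^sup>+x. g x \<partial>gauss d) = (\<integral>\<^sup>+x. g x * indicator (unit_ball_d d) x \<partial>vspace d) / emeasure (vspace d) (unit_ball_d d)"
    and gauss_homogeneous_moment: "\<And>g. g \<in> borel_measurable (vspace d) \<Longrightarrow>
      (\<And>r x. r > 0 \<Longrightarrow> g (scale_d d r x) = g x) \<Longrightarrow>
      (\<integral>\<^sup>+x. g x * ennreal (inner_d d x x / 2 + 1) \<partial>gauss d) = ennreal (real d / 2 + 1) * (\<integral>\<^sup>+x. g x \<partial>gauss d)"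
proof -
  let ?vol = "emeasure (vspace d) (unit_ball_d d)"
  obtain K0 K1 :: ennreal where K:
    "\<And>g. g \<in> borel_measurable (vspace d) \<Longrightarrow> (\<And>r x. r > 0 \<Longrightarrow> g (scale_d d r x) = g x) \<Longrightarrow>
      (\<integral>\<^sup>+x. g x \<partial>gauss d) = K0 * (\<integral>\<^sup>+x. g x * (if inner_d d x x < 1 then 1 else 0) \<partial>vspace d)"
    "\<And>g. g \<in> borel_measurable (vspace d) \<Longrightarrow> (\<And>r x. r > 0 \<Longrightarrow> g (scale_d d r x) = g x) \<Longrightarrow>
      (\<integral>\<^sup>+x. g x * ennreal (inner_d d x x / 2 + 1) \<partial>gauss d)
        = K1 * (\<integral>\<^sup>+x. g x * (if inner_d d x x < 1 then 1 else 0) \<partial>vspace d)"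
    using gauss_homogeneous by blast
  interpret G: prob_space "gauss d" by (rule prob_space_gauss)
  have k0: "K0 * ?vol = 1"
    using K(1)[of "\<lambda>_. 1"] by (simp add: emeasure_unit_ball G.emeasure_space_1)
  have k1: "K1 * ?vol = ennreal (real d / 2 + 1)"
    using K(2)[of "\<lambda>_. 1"] by (simp add: emeasure_unit_ball gauss_norm_moment)
  show nz: "?vol \<noteq> 0" using k0 by auto
  show fin: "?vol \<noteq> \<infinity>"
  proof
    assume "?vol = \<infinity>"
    then show False using k0 by (cases "K0 = 0") (auto simp: ennreal_mult_top)
  qed
  fix g :: "(nat \<Rightarrow> real) \<Rightarrow> ennreal"
  assume g: "g \<in> borel_measurable (vspace d)" and hom: "\<And>r x. r > 0 \<Longrightarrow> g (scale_d d r x) = g x"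
  have J: "(\<integral>\<^sup>+x. g x * indicator (unit_ball_d d) x \<partial>vspace d) = (\<integral>\<^sup>+x. g x * (if inner_d d x x < 1 then 1 else 0) \<partial>vspace d)"
    by (intro nn_integral_cong) (auto simp: unit_ball_d_def inner_d_def power2_eq_square split: split_indicator)
  have "K0 = K0 * (?vol / ?vol)" using nz fin by (simp add: ennreal_divide_self less_top)
  also have "\<dots> = 1 / ?vol" using k0 by (simp add: ennreal_times_divide)
  finally have K0: "K0 = 1 / ?vol" .
  have "K1 = K1 * (?vol / ?vol)" using nz fin by (simp add: ennreal_divide_self less_top)
  also have "\<dots> = ennreal (real d / 2 + 1) * K0" using k1 K0 by (simp add: ennreal_times_divide)
  finally have K1: "K1 = ennreal (real d / 2 + 1) * K0" .
  show "(\<integral>\<^sup>+x. g x \<partial>gauss d) = (\<integral>\<^sup>+x. g x * indicator (unit_ball_d d) x \<partial>vspace d) / ?vol"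
    using K(1)[OF g hom] K0 J by (simp add: divide_ennreal_def mult.commute)
  show "(\<integral>\<^sup>+x. g x * ennreal (inner_d d x x / 2 + 1) \<partial>gauss d) = ennreal (real d / 2 + 1) * (\<integral>\<^sup>+x. g x \<partial>gauss d)"
    using K(1)[OF g hom] K(2)[OF g hom] K1 by (simp add: mult.assoc)
qed

section \<open>From the Gaussian to the sphere\<close>

definition sphere_proj :: "nat \<Rightarrow> real \<Rightarrow> (nat \<Rightarrow> real) \<Rightarrow> (nat \<Rightarrow> real)" where
  "sphere_proj d R x = restrict (\<lambda>i. R * x i / norm_d d x) {..<d}"

lemma norm_d_eq: "norm_d d x = sqrt (inner_d d x x)"
  by (simp add: norm_d_def inner_d_def power2_eq_square)

lemma sphere_proj_measurable: "sphere_proj d R \<in> measurable (vspace d) (vspace d)"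
proof -
  have [measurable]: "(\<lambda>x. x i) \<in> borel_measurable (vspace d)" if "i < d" for i
    using that by (rule measurable_vspace_component)
  have "(\<lambda>x. R * x i / norm_d d x) \<in> borel_measurable (vspace d)" if "i < d" for i
    unfolding norm_d_eq using measurable_vspace_component[OF that]
    by (intro borel_measurable_divide borel_measurable_times borel_measurable_const
        measurable_compose[OF inner_d_measurable_vspace borel_measurable_sqrt]) auto
  then show ?thesis unfolding sphere_proj_def[abs_def] by (rule measurable_into_vspace)
qed

lemma sphere_proj_scale: "r > 0 \<Longrightarrow> sphere_proj d R (scale_d d r x) = sphere_proj d R x"
proof -
  assume r: "r > 0"
  have "norm_d d (scale_d d r x) = r * norm_d d x"
    using r by (simp add: norm_d_eq inner_d_scale_d real_sqrt_mult)
  then show ?thesis using r by (auto simp: sphere_proj_def scale_d_def)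
qed

lemma sets_unif_sphere [measurable_cong]: "sets (unif_sphere d R) = sets (vspace d)"
  by (simp add: unif_sphere_def)

lemma prob_space_unif_sphere: "prob_space (unif_sphere d R)"
proof -
  have *: "prob_space (uniform_measure (vspace d) (unit_ball_d d))"
    by (rule prob_space_uniform_measure[OF emeasure_unit_ball_nonzero emeasure_unit_ball_finite])
  show ?thesis
    unfolding unif_sphere_def sphere_proj_def[symmetric]
    by (rule prob_space.prob_space_distr[OF *]) (simp add: measurable_cong_sets[OF sets_uniform_measure refl] sphere_proj_measurable)
qed

text \<open>The projected integrand is constant along rays, and on such functions the uniform law of
  the ball and the Gaussian law agree.\<close>

lemma nn_integral_unif_sphere:
  assumes f: "f \<in> borel_measurable (vspace d)"
  shows "(\<integral>\<^sup>+x. f x \<partial>unif_sphere d R) = (\<integral>\<^sup>+z. f (sphere_proj d R z) \<partial>gauss d)"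
proof -
  note m = measurable_compose[OF sphere_proj_measurable f]
  have "(\<integral>\<^sup>+x. f x \<partial>unif_sphere d R)
      = (\<integral>\<^sup>+x. f (sphere_proj d R x) \<partial>uniform_measure (vspace d) (unit_ball_d d))"
    unfolding unif_sphere_def sphere_proj_def[symmetric]
    using f by (intro nn_integral_distr) (simp_all add: measurable_cong_sets[OF sets_uniform_measure refl] sphere_proj_measurable)
  also have "\<dots> = (\<integral>\<^sup>+x. f (sphere_proj d R x) * indicator (unit_ball_d d) x \<partial>vspace d)
      / emeasure (vspace d) (unit_ball_d d)"
    by (rule nn_integral_uniform_measure[OF m unit_ball_sets])
  also have "\<dots> = (\<integral>\<^sup>+z. f (sphere_proj d R z) \<partial>gauss d)"
    by (rule gauss_homogeneous_eq_ball[symmetric, OF m]) (simp add: sphere_proj_scale)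
  finally show ?thesis .
qed

lemma bilin_zero_left: "inner_d d x x = 0 \<Longrightarrow> bilin d A x y = 0"
proof -
  assume "inner_d d x x = 0"
  then have "\<forall>i\<in>{..<d}. x i * x i = 0"
    unfolding inner_d_def by (subst (asm) sum_nonneg_eq_0_iff) auto
  then show ?thesis by (simp add: bilin_altdef)
qed

text \<open>The origin is no exception: \<open>norm_d\<close> is 0 there, and both sides vanish
  because division by zero gives 0.\<close>

lemma bilin_sphere_proj:
  "bilin d A (sphere_proj d R x) (sphere_proj d R x) = R\<^sup>2 * bilin d A x x / inner_d d x x"
proof -
  have "bilin d A (sphere_proj d R x) (sphere_proj d R x)
     = bilin d A (\<lambda>i. (R / norm_d d x) * x i) (\<lambda>i. (R / norm_d d x) * x i)"
    unfolding sphere_proj_def bilin_restrict by simp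
  also have "\<dots> = (R / norm_d d x)\<^sup>2 * bilin d A x x"
    by (simp only: bilin_scale bilin_scale2) (simp add: power2_eq_square)
  also have "\<dots> = R\<^sup>2 * bilin d A x x / inner_d d x x"
    using inner_d_nonneg[of d x] by (simp add: power_divide norm_d_eq)
  finally show ?thesis .
qed

text \<open>A crude estimate; its purpose is to make the Rayleigh quotient of A bounded, whatever
  the bound.\<close>

lemma abs_bilin_le: "\<bar>bilin d A x x\<bar> \<le> (\<Sum>i<d. \<Sum>j<d. \<bar>A i j\<bar>) * inner_d d x x"
proof -
  have xi: "\<bar>x i * x j\<bar> \<le> inner_d d x x" if "i < d" "j < d" for i j
  proof -
    have sq: "(x k)\<^sup>2 \<le> inner_d d x x" if "k < d" for k
      unfolding inner_d_def using that member_le_sum[of k "{..<d}" "\<lambda>i. x i * x i"]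
      by (auto simp: power2_eq_square)
    have "0 \<le> (\<bar>x i\<bar> - \<bar>x j\<bar>)\<^sup>2" by simp
    then have "2 * \<bar>x i * x j\<bar> \<le> (x i)\<^sup>2 + (x j)\<^sup>2"
      by (simp add: power2_diff abs_mult)
    then show ?thesis using sq[OF that(1)] sq[OF that(2)] by linarith
  qed
  have "\<bar>bilin d A x x\<bar> \<le> (\<Sum>i<d. \<Sum>j<d. \<bar>A i j * x i * x j\<bar>)"
    unfolding bilin_altdef by (rule order_trans[OF sum_abs sum_mono[OF sum_abs]])
  also have "\<dots> \<le> (\<Sum>i<d. \<Sum>j<d. \<bar>A i j\<bar> * inner_d d x x)"
    using xi by (intro sum_mono) (simp add: abs_mult mult.assoc mult_left_mono)
  finally show ?thesis by (simp add: sum_distrib_right)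
qed

text \<open>$|z|^2$ has mean $d$ and is uncorrelated with functions of the direction of $z$, which is what
  Jensen's inequality in the radius needs; so the sphere inherits all exponential moments of
  quadratic forms from the Gaussian. The constant $\beta$ only keeps the integrands non-negative.\<close>
lemma unif_sphere_exp_quadratic_le:
  assumes d: "d > 0"
  shows "(\<integral>\<^sup>+x. ennreal (exp (bilin d A x x)) \<partial>unif_sphere d R)
    \<le> (\<integral>\<^sup>+z. ennreal (exp (R\<^sup>2 / d * bilin d A z z)) \<partial>gauss d)"
proof -
  interpret G: prob_space "gauss d" by (rule prob_space_gauss)
  let ?N = "\<lambda>x. inner_d d x x"
  \<comment> \<open>The value of the form at the projection of x to the sphere of radius R. In these
    terms exp (y z) has to be compared with exp (y z * |z|^2 / d).\<close>
  define y where "y x = R\<^sup>2 * bilin d A x x / ?N x" for x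
  define \<beta> where "\<beta> = R\<^sup>2 * (\<Sum>i<d. \<Sum>j<d. \<bar>A i j\<bar>)"
  have N: "?N x \<ge> 0" for x by (rule inner_d_nonneg)
  have \<beta>: "\<beta> \<ge> 0" by (auto simp: \<beta>_def intro!: sum_nonneg mult_nonneg_nonneg)
  have yb: "\<bar>y x\<bar> \<le> \<beta>" for x
  proof (cases "?N x = 0")
    case False
    then have "?N x > 0" using N[of x] by simp
    then show ?thesis
      using mult_left_mono[OF abs_bilin_le[of d A x], of "R\<^sup>2"]
      by (simp add: y_def \<beta>_def abs_mult field_simps)
  qed (use \<beta> in \<open>simp add: y_def\<close>)
  have [measurable]: "(\<lambda>x. bilin d A x x) \<in> borel_measurable (vspace d)"
    by (intro bilin_measurable measurable_vspace_component)
  have ym [measurable]: "y \<in> borel_measurable (vspace d)"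
    unfolding y_def by measurable
  have y_hom: "y (scale_d d r x) = y x" if "r > 0" for r x
  proof -
    have "bilin d A (scale_d d r x) (scale_d d r x) = r\<^sup>2 * bilin d A x x"
      unfolding scale_d_def bilin_restrict
      by (simp only: bilin_scale bilin_scale2) (simp add: power2_eq_square)
    then show ?thesis using that by (simp add: y_def inner_d_scale_d)
  qed
  define X where "X = (\<integral>\<^sup>+z. ennreal (exp (y z)) \<partial>gauss d)"
  define Y where "Y = (\<integral>\<^sup>+z. ennreal (exp (y z) * (\<beta> + y z)) \<partial>gauss d)"
  define E where "E = (\<integral>\<^sup>+z. ennreal (exp (R\<^sup>2 / d * bilin d A z z)) \<partial>gauss d)"
  have yn: "\<beta> + y x \<ge> 0" for x using yb[of x] by linarith
  have "X \<le> (\<integral>\<^sup>+z. ennreal (exp \<beta>) \<partial>gauss d)"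
    unfolding X_def using yb by (intro nn_integral_mono ennreal_leI) (auto simp: abs_le_iff)
  then have X_fin: "X < \<infinity>" using le_less_trans[of X "ennreal (exp \<beta>)" \<infinity>]
    by (simp add: G.emeasure_space_1)
  have "Y \<le> (\<integral>\<^sup>+z. ennreal (exp \<beta> * (2 * \<beta>)) \<partial>gauss d)"
    unfolding Y_def using yb yn
    by (intro nn_integral_mono ennreal_leI mult_mono) (auto simp: abs_le_iff algebra_simps)
  then have Y_fin: "Y < \<infinity>" using le_less_trans[of Y "ennreal (exp \<beta> * (2 * \<beta>))" \<infinity>]
    by (simp add: G.emeasure_space_1)
  have momX: "(\<integral>\<^sup>+z. ennreal (exp (y z)) * ennreal (?N z / 2 + 1) \<partial>gauss d) = ennreal (real d / 2 + 1) * X"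
    unfolding X_def by (rule gauss_homogeneous_moment) (auto simp: y_hom)
  have momY: "(\<integral>\<^sup>+z. ennreal (exp (y z) * (\<beta> + y z)) * ennreal (?N z / 2 + 1) \<partial>gauss d) = ennreal (real d / 2 + 1) * Y"
    unfolding Y_def by (rule gauss_homogeneous_moment) (auto simp: y_hom)
  define k where "k = real d / 2"
  have k: "k > 0" using d by (simp add: k_def)
  \<comment> \<open>This is k times the tangent inequality exp (y N / (2 k)) \<ge> exp y * (1 + y (N
    / 2 - k) / k), with terms moved across and \<beta>-terms added on both sides until every summand
    is non-negative.\<close>
  have pointwise: "k * exp (R\<^sup>2 / d * bilin d A x x) + (k + 1) * (exp (y x) * (\<beta> + y x)) + \<beta> * (exp (y x) * (?N x / 2 + 1))
      \<ge> k * exp (y x) + exp (y x) * (\<beta> + y x) * (?N x / 2 + 1) + \<beta> * (k + 1) * exp (y x)" for x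
  proof -
    have "R\<^sup>2 / d * bilin d A x x = y x * (?N x / 2) / k"
      using bilin_zero_left[of d x A x] by (cases "?N x = 0") (simp_all add: y_def k_def)
    also have "\<dots> = y x + y x * (?N x / 2 - k) / k" using k by (simp add: field_simps)
    finally have e: "exp (R\<^sup>2 / d * bilin d A x x) = exp (y x) * exp (y x * (?N x / 2 - k) / k)"
      by (simp add: exp_add)
    have "exp (y x) * (1 + y x * (?N x / 2 - k) / k) \<le> exp (R\<^sup>2 / d * bilin d A x x)"
      unfolding e by (intro mult_left_mono) auto
    then have "k * (exp (y x) * (1 + y x * (?N x / 2 - k) / k)) \<le> k * exp (R\<^sup>2 / d * bilin d A x x)"
      using k by (intro mult_left_mono) auto
    moreover have eq: "k * (exp (y x) * (1 + y x * (?N x / 2 - k) / k)) = exp (y x) * (k + y x * (?N x / 2 - k))"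
      using k by (simp add: field_simps)
    ultimately have "exp (y x) * (k + y x * (?N x / 2 - k)) \<le> k * exp (R\<^sup>2 / d * bilin d A x x)"
      by (simp only: eq)
    then show ?thesis by (simp add: algebra_simps)
  qed
  have "ennreal k * X + ennreal (k + 1) * Y + ennreal (\<beta> * (k + 1)) * X
     = (\<integral>\<^sup>+x. ennreal (k * exp (y x) + exp (y x) * (\<beta> + y x) * (?N x / 2 + 1) + \<beta> * (k + 1) * exp (y x)) \<partial>gauss d)"
    unfolding k_def momY[symmetric] unfolding X_def k_def[symmetric]
    using k \<beta> yn N
    by (simp add: nn_integral_add[symmetric] nn_integral_cmult[symmetric] ennreal_mult[symmetric] ennreal_plus[symmetric]
      mult.assoc del: ennreal_plus)
  also have "\<dots> \<le> (\<integral>\<^sup>+x. ennreal (k * exp (R\<^sup>2 / d * bilin d A x x) + (k + 1) * (exp (y x) * (\<beta> + y x)) + \<beta> * (exp (y x) * (?N x / 2 + 1))) \<partial>gauss d)"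
    by (intro nn_integral_mono ennreal_leI pointwise)
  also have "\<dots> = ennreal k * E + ennreal (k + 1) * Y + ennreal \<beta> * (ennreal (k + 1) * X)"
    unfolding k_def momX[symmetric] unfolding E_def Y_def k_def[symmetric]
    using k \<beta> yn N
    by (simp add: nn_integral_add[symmetric] nn_integral_cmult[symmetric] ennreal_mult[symmetric] ennreal_plus[symmetric]
      mult.assoc del: ennreal_plus)
  also have "\<dots> = ennreal k * E + (ennreal (k + 1) * Y + ennreal (\<beta> * (k + 1)) * X)"
    using \<beta> k by (simp add: ennreal_mult mult.assoc add.assoc)
  \<comment> \<open>The linear correction of the tangent inequality has turned, by
    \<open>gauss_homogeneous_moment\<close>, into the same terms on both sides; being finite, they
    cancel.\<close>
  finally have "(ennreal (k + 1) * Y + ennreal (\<beta> * (k + 1)) * X) + ennreal k * X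
      \<le> (ennreal (k + 1) * Y + ennreal (\<beta> * (k + 1)) * X) + ennreal k * E"
    by (simp add: add_ac)
  then have "ennreal k * X \<le> ennreal k * E"
    using X_fin Y_fin by (subst (asm) ennreal_add_left_cancel_le) (auto simp: ennreal_mult_eq_top_iff)
  then have "X \<le> E"
    using k by (subst (asm) ennreal_mult_le_mult_iff) auto
  moreover have "(\<integral>\<^sup>+x. ennreal (exp (bilin d A x x)) \<partial>unif_sphere d R) = X"
    unfolding X_def y_def
    by (subst nn_integral_unif_sphere) (simp_all add: bilin_sphere_proj)
  ultimately show ?thesis by (simp add: E_def)
qed

text \<open>Young's inequality bounds the linear form by lam / 2 plus a rank-one quadratic form, and
  the exponential moment of the latter is dominated by its Gaussian counterpart.\<close>

lemma subgauss_unif_sphere: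
  assumes d: "d > 0" and R: "R > 0"
  shows "subgauss d (unif_sphere d R) (\<lambda>x. x) 2 (2 * R\<^sup>2 / d)"
  unfolding subgauss_def
proof (intro conjI allI impI prob_space_unif_sphere)
  show "(\<lambda>x. x i) \<in> borel_measurable (unif_sphere d R)" if "i < d" for i
    using measurable_vspace_component[OF that] by simp
  fix a :: "nat \<Rightarrow> real"
  interpret U: prob_space "unif_sphere d R" by (rule prob_space_unif_sphere)
  define n where "n = inner_d d a a"
  have im: "(\<lambda>x. inner_d d a x) \<in> borel_measurable (vspace d)"
    by (intro inner_d_measurable measurable_vspace_component) auto
  show "(\<integral>\<^sup>+x. ennreal (exp (inner_d d a x)) \<partial>unif_sphere d R) \<le> ennreal (2 * exp (2 * R\<^sup>2 / d * inner_d d a a / 2))"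
  proof (cases "n = 0")
    case True
    then have "\<forall>i\<in>{..<d}. a i * a i = 0"
      unfolding inner_d_def n_def by (subst (asm) sum_nonneg_eq_0_iff) auto
    then have "inner_d d a x = 0" for x by (simp add: inner_d_def)
    then show ?thesis using True by (simp add: n_def U.emeasure_space_1)
  next
    case False
    then have n: "n > 0" using inner_d_nonneg[of d a] by (simp add: n_def)
    \<comment> \<open>With this value the Gaussian side is the moment of exp ((a, z)^2 / (4 |a|^2)),
      at most sqrt 2 \<le> 2, while exp (lam / 2) is exactly the sub-Gaussian factor for the proxy 2
      R^2 / d.\<close>
    define lam where "lam = 2 * R\<^sup>2 * n / d"
    have lam: "lam > 0" using n d R by (simp add: lam_def)
    let ?A = "\<lambda>i j. (1 / (2 * lam)) * (a i * a j)"
    have A: "bilin d ?A x x = (inner_d d a x)\<^sup>2 / (2 * lam)" for x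
    proof -
      have "bilin d ?A x x = (1 / (2 * lam)) * (\<Sum>i<d. \<Sum>j<d. (a i * x i) * (a j * x j))"
        unfolding bilin_altdef sum_distrib_left by (intro sum.cong refl) (simp add: mult_ac)
      also have "(\<Sum>i<d. \<Sum>j<d. (a i * x i) * (a j * x j)) = (inner_d d a x)\<^sup>2"
        by (simp add: inner_d_def power2_eq_square sum_product)
      finally show ?thesis by simp
    qed
    have young: "inner_d d a x \<le> lam / 2 + bilin d ?A x x" for x
    proof -
      have "0 \<le> (inner_d d a x - lam)\<^sup>2" by simp
      then have "2 * lam * inner_d d a x \<le> lam\<^sup>2 + (inner_d d a x)\<^sup>2"
        by (simp add: power2_diff mult_ac)
      then show ?thesis unfolding A using lam by (simp add: field_simps power2_eq_square)
    qed
    have "(\<integral>\<^sup>+x. ennreal (exp (inner_d d a x)) \<partial>unif_sphere d R)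
       \<le> (\<integral>\<^sup>+x. ennreal (exp (lam / 2)) * ennreal (exp (bilin d ?A x x)) \<partial>unif_sphere d R)"
      using young by (intro nn_integral_mono) (simp add: ennreal_mult[symmetric] exp_add[symmetric])
    also have "\<dots> = ennreal (exp (lam / 2)) * (\<integral>\<^sup>+x. ennreal (exp (bilin d ?A x x)) \<partial>unif_sphere d R)"
      unfolding A using im by (intro nn_integral_cmult) simp
    also have "\<dots> \<le> ennreal (exp (lam / 2)) * (\<integral>\<^sup>+z. ennreal (exp (R\<^sup>2 / d * bilin d ?A z z)) \<partial>gauss d)"
      by (intro mult_left_mono unif_sphere_exp_quadratic_le d) auto
    also have "(\<integral>\<^sup>+z. ennreal (exp (R\<^sup>2 / d * bilin d ?A z z)) \<partial>gauss d)
        = (\<integral>\<^sup>+z. ennreal (exp (1 / (4 * n) * (inner_d d a z)\<^sup>2)) \<partial>gauss d)"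
    proof -
      have "R\<^sup>2 / d * bilin d ?A z z = 1 / (4 * n) * (inner_d d a z)\<^sup>2" for z
        unfolding A using R d n by (simp add: lam_def)
      then show ?thesis by simp
    qed
    also have "\<dots> \<le> ennreal (1 / sqrt (1 - 2 * (1 / (4 * n)) * 1 * inner_d d a a))"
      using n by (intro subgauss_exp_inner_square[OF subgauss_gauss]) (auto simp: n_def[symmetric])
    also have "1 / sqrt (1 - 2 * (1 / (4 * n)) * 1 * inner_d d a a) = sqrt 2"
      using n by (simp add: n_def[symmetric] real_sqrt_divide)
    also have "ennreal (exp (lam / 2)) * ennreal (sqrt 2) \<le> ennreal (exp (lam / 2)) * ennreal 2"
      by (intro mult_left_mono ennreal_leI) (auto intro: real_le_lsqrt)
    also have "\<dots> = ennreal (2 * exp (2 * R\<^sup>2 / d * inner_d d a a / 2))"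
      by (subst ennreal_mult[symmetric]) (auto simp: lam_def n_def mult_ac)
    finally show ?thesis by (simp add: mult_left_mono)
  qed
qed

text \<open>Only a vanishing Gaussian vector can be projected off the sphere, and already its
  coordinate 0 is non-zero almost surely. The null event is carried over to the sphere through the
  integral of its indicator.\<close>

lemma AE_unif_sphere_norm:
  assumes d: "d > 0"
  shows "AE x in unif_sphere d R. inner_d d x x = R\<^sup>2"
proof -
  interpret N: product_prob_space "\<lambda>_::nat. std_normal_distribution"
    by (rule product_prob_space_std_normal)
  have "AE x in std_normal_distribution. x \<noteq> 0"
    by (subst AE_density) (auto intro!: AE_I[of _ _ "{0}"])
  then have "AE z in gauss d. z 0 \<noteq> 0"
    unfolding gauss_def using d by (intro AE_PiM_component prob_space_std_normal) auto
  then have ae: "AE z in gauss d. inner_d d (sphere_proj d R z) (sphere_proj d R z) = R\<^sup>2"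
  proof eventually_elim
    fix z :: "nat \<Rightarrow> real" assume "z 0 \<noteq> 0"
    then have "inner_d d z z \<noteq> 0"
      unfolding inner_d_def using d by (subst sum_nonneg_eq_0_iff) auto
    then show "inner_d d (sphere_proj d R z) (sphere_proj d R z) = R\<^sup>2"
      using bilin_sphere_proj[of d id_mat R z] by (simp add: bilin_id_mat)
  qed
  have "(\<integral>\<^sup>+x. (if inner_d d x x = R\<^sup>2 then 0 else 1) \<partial>unif_sphere d R)
     = (\<integral>\<^sup>+z. (if inner_d d (sphere_proj d R z) (sphere_proj d R z) = R\<^sup>2 then 0 else 1) \<partial>gauss d)"
    by (rule nn_integral_unif_sphere) measurable
  also have "\<dots> = (\<integral>\<^sup>+z. 0 \<partial>gauss d)"
    using ae by (intro nn_integral_cong_AE) auto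
  finally have "AE x in unif_sphere d R. (if inner_d d x x = R\<^sup>2 then 0 else 1 :: ennreal) = 0"
    by (subst nn_integral_0_iff_AE[symmetric]) auto
  then show ?thesis by eventually_elim (auto split: if_splits)
qed

section \<open>Product measures\<close>

lemma nn_integral_pair_iterated:
  assumes "prob_space N" "f \<in> borel_measurable (M \<Otimes>\<^sub>M N)"
  shows "(\<integral>\<^sup>+w. f w \<partial>(M \<Otimes>\<^sub>M N)) = (\<integral>\<^sup>+x. \<integral>\<^sup>+y. f (x, y) \<partial>N \<partial>M)"
  using sigma_finite_measure.nn_integral_fst[OF prob_space_imp_sigma_finite[OF assms(1)] assms(2)] by simp

lemma measure_pair_fst:
  assumes "prob_space N" "{x\<in>space M. \<phi> x} \<in> sets M"
  shows "measure (M \<Otimes>\<^sub>M N) {w\<in>space (M \<Otimes>\<^sub>M N). \<phi> (fst w)} = measure M {x\<in>space M. \<phi> x}"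
proof -
  interpret N: prob_space N by fact
  have "{w\<in>space (M \<Otimes>\<^sub>M N). \<phi> (fst w)} = {x\<in>space M. \<phi> x} \<times> space N"
    by (auto simp: space_pair_measure)
  then show ?thesis
    using assms(2) N.emeasure_space_1 by (simp add: measure_def N.emeasure_pair_measure_Times)
qed

lemma measure_pair_snd:
  assumes "prob_space M" "prob_space N" "{x\<in>space N. \<phi> x} \<in> sets N"
  shows "measure (M \<Otimes>\<^sub>M N) {w\<in>space (M \<Otimes>\<^sub>M N). \<phi> (snd w)} = measure N {x\<in>space N. \<phi> x}"
proof -
  interpret M: prob_space M by fact
  interpret N: prob_space N by fact
  have "{w\<in>space (M \<Otimes>\<^sub>M N). \<phi> (snd w)} = space M \<times> {x\<in>space N. \<phi> x}"
    by (auto simp: space_pair_measure)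
  then show ?thesis
    using assms(3) M.emeasure_space_1 by (simp add: measure_def N.emeasure_pair_measure_Times)
qed

lemma measurable_PiM_coord:
  "i \<in> I \<Longrightarrow> h \<in> borel_measurable Q \<Longrightarrow> (\<lambda>f. h (f i)) \<in> borel_measurable (PiM I (\<lambda>_. Q))"
  by (rule measurable_compose[OF measurable_component_singleton])

lemma measure_PiM_component:
  assumes Q: "prob_space Q" and "finite I" "k \<in> I" "{x\<in>space Q. \<phi> x} \<in> sets Q"
  shows "measure (PiM I (\<lambda>_. Q)) {f\<in>space (PiM I (\<lambda>_. Q)). \<phi> (f k)} = measure Q {x\<in>space Q. \<phi> x}"
proof -
  interpret product_prob_space "\<lambda>_. Q"
    by (intro product_prob_space.intro product_prob_space_axioms.intro product_sigma_finite.intro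
        Q prob_space_imp_sigma_finite)
  have "measure Q {x\<in>space Q. \<phi> x} = measure (distr (PiM I (\<lambda>_. Q)) Q (\<lambda>f. f k)) {x\<in>space Q. \<phi> x}"
    using assms by (subst PiM_component) auto
  also have "\<dots> = measure (PiM I (\<lambda>_. Q)) ((\<lambda>f. f k) -` {x\<in>space Q. \<phi> x} \<inter> space (PiM I (\<lambda>_. Q)))"
    using assms by (intro measure_distr) auto
  also have "(\<lambda>f. f k) -` {x\<in>space Q. \<phi> x} \<inter> space (PiM I (\<lambda>_. Q)) = {f\<in>space (PiM I (\<lambda>_. Q)). \<phi> (f k)}"
    using assms by (auto simp: space_PiM)
  finally show ?thesis by simp
qed

lemma nn_integral_PiM_component:
  assumes Q: "prob_space Q" and k: "finite I" "k \<in> I" "h \<in> borel_measurable Q"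
  shows "(\<integral>\<^sup>+f. h (f k) \<partial>PiM I (\<lambda>_. Q)) = (\<integral>\<^sup>+q. h q \<partial>Q)"
proof -
  interpret product_prob_space "\<lambda>_. Q"
    by (intro product_prob_space.intro product_prob_space_axioms.intro product_sigma_finite.intro
        Q prob_space_imp_sigma_finite)
  have "(\<integral>\<^sup>+q. h q \<partial>Q) = (\<integral>\<^sup>+q. h q \<partial>distr (PiM I (\<lambda>_. Q)) Q (\<lambda>f. f k))"
    using k by (subst PiM_component) auto
  also have "\<dots> = (\<integral>\<^sup>+f. h (f k) \<partial>PiM I (\<lambda>_. Q))"
    using k by (intro nn_integral_distr) auto
  finally show ?thesis by simp
qed

lemma nn_integral_PiM_insert:
  assumes Q: "prob_space Q" and I: "finite I" "k \<notin> I"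
    and f: "f \<in> borel_measurable (PiM (insert k I) (\<lambda>_. Q))"
  shows "(\<integral>\<^sup>+x. f x \<partial>PiM (insert k I) (\<lambda>_. Q)) = (\<integral>\<^sup>+x. \<integral>\<^sup>+y. f (x(k := y)) \<partial>Q \<partial>PiM I (\<lambda>_. Q))"
proof -
  interpret product_sigma_finite "\<lambda>_. Q"
    by (intro product_sigma_finite.intro prob_space_imp_sigma_finite Q)
  show ?thesis by (rule product_nn_integral_insert[OF I f])
qed

text \<open>Fixing the constant to $1$ (not merely $O(1)$) makes the class stable under sums of
  arbitrarily many independent copies.\<close>
lemma subgauss_PiM_sum:
  fixes c :: real
  assumes S: "subgauss d Q \<xi> 1 1" and I: "finite I" "J \<subseteq> I"
  shows "subgauss d (PiM I (\<lambda>_. Q)) (\<lambda>f j. c * (\<Sum>i\<in>J. \<xi> (f i) j)) 1 (c\<^sup>2 * card J)"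
  unfolding subgauss_def
proof (intro conjI allI impI)
  note Q = subgauss_prob_space[OF S] and m = subgauss_measurable[OF S]
  interpret product_sigma_finite "\<lambda>_. Q"
    by (intro product_sigma_finite.intro prob_space_imp_sigma_finite Q)
  show "prob_space (PiM I (\<lambda>_. Q))" by (intro prob_space_PiM Q)
  show "(\<lambda>f. c * (\<Sum>i\<in>J. \<xi> (f i) j)) \<in> borel_measurable (PiM I (\<lambda>_. Q))" if "j < d" for j
    using I by (intro borel_measurable_times borel_measurable_const borel_measurable_sum
        measurable_PiM_coord m[OF that]) auto
  fix a :: "nat \<Rightarrow> real"
  let ?h = "\<lambda>i q. if i \<in> J then ennreal (exp (inner_d d (\<lambda>j. c * a j) (\<xi> q))) else 1"
  have hm: "?h i \<in> borel_measurable Q" for i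
    using inner_d_measurable[of d "\<lambda>_ j. c * a j" Q \<xi>] m by (cases "i \<in> J") auto
  have fJ: "finite J" using I finite_subset by blast
  have "inner_d d a (\<lambda>j. c * (\<Sum>i\<in>J. \<xi> (f i) j)) = (\<Sum>i\<in>J. inner_d d (\<lambda>j. c * a j) (\<xi> (f i)))" for f
    unfolding inner_d_def by (subst sum.swap) (simp add: sum_distrib_left mult_ac)
  then have "(\<integral>\<^sup>+f. ennreal (exp (inner_d d a (\<lambda>j. c * (\<Sum>i\<in>J. \<xi> (f i) j)))) \<partial>PiM I (\<lambda>_. Q))
     = (\<integral>\<^sup>+f. (\<Prod>i\<in>I. ?h i (f i)) \<partial>PiM I (\<lambda>_. Q))"
    using I fJ by (simp add: exp_sum prod_ennreal[symmetric] prod.inter_restrict[symmetric] Int_absorb1)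
  also have "\<dots> = (\<Prod>i\<in>I. \<integral>\<^sup>+q. ?h i q \<partial>Q)"
    using I hm by (intro product_nn_integral_prod) auto
  also have "\<dots> \<le> (\<Prod>i\<in>I. if i \<in> J then ennreal (exp (c\<^sup>2 * inner_d d a a / 2)) else 1)"
  proof (intro prod_mono_ennreal)
    fix i assume "i \<in> I"
    have "inner_d d (\<lambda>j. c * a j) (\<lambda>j. c * a j) = c\<^sup>2 * inner_d d a a"
      by (subst inner_d_scale, subst inner_d_scale2) (simp add: power2_eq_square)
    then show "(\<integral>\<^sup>+q. ?h i q \<partial>Q) \<le> (if i \<in> J then ennreal (exp (c\<^sup>2 * inner_d d a a / 2)) else 1)"
      using subgaussD[OF S, of "\<lambda>j. c * a j"] prob_space.emeasure_space_1[OF Q] by simp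
  qed
  also have "\<dots> = ennreal (exp (c\<^sup>2 * inner_d d a a / 2)) ^ card J"
    using I fJ by (simp add: prod.inter_restrict[symmetric] Int_absorb1)
  also have "\<dots> = ennreal (1 * exp (c\<^sup>2 * card J * inner_d d a a / 2))"
    by (simp add: ennreal_power exp_of_nat_mult[symmetric] mult_ac)
  finally show "(\<integral>\<^sup>+f. ennreal (exp (inner_d d a (\<lambda>j. c * (\<Sum>i\<in>J. \<xi> (f i) j)))) \<partial>PiM I (\<lambda>_. Q))
     \<le> ennreal (1 * exp (c\<^sup>2 * card J * inner_d d a a / 2))" .
qed

lemma subgauss_pair_add:
  assumes S: "subgauss d P u K v" "subgauss d P' u' K' v'" and K: "K \<ge> 0" "K' \<ge> 0"
  shows "subgauss d (P \<Otimes>\<^sub>M P') (\<lambda>w j. u (fst w) j + u' (snd w) j) (K * K') (v + v')"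
  unfolding subgauss_def
proof (intro conjI allI impI)
  note P = subgauss_prob_space[OF S(1)] subgauss_prob_space[OF S(2)]
  note m = subgauss_measurable[OF S(1)] subgauss_measurable[OF S(2)]
  show "prob_space (P \<Otimes>\<^sub>M P')" by (intro prob_space_pair P)
  show m2: "(\<lambda>w. u (fst w) j + u' (snd w) j) \<in> borel_measurable (P \<Otimes>\<^sub>M P')" if "j < d" for j
    by (intro borel_measurable_add measurable_compose[OF measurable_fst m(1)]
        measurable_compose[OF measurable_snd m(2)] that)
  fix a :: "nat \<Rightarrow> real"
  have im [measurable]: "(\<lambda>w. inner_d d a (u w)) \<in> borel_measurable P"
    "(\<lambda>w. inner_d d a (u' w)) \<in> borel_measurable P'"
    using m by (auto intro!: inner_d_measurable)
  have "(\<integral>\<^sup>+w. ennreal (exp (inner_d d a (\<lambda>j. u (fst w) j + u' (snd w) j))) \<partial>(P \<Otimes>\<^sub>M P'))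
    = (\<integral>\<^sup>+x. \<integral>\<^sup>+y. ennreal (exp (inner_d d a (u x))) * ennreal (exp (inner_d d a (u' y))) \<partial>P' \<partial>P)"
    unfolding inner_d_add2 by (subst nn_integral_pair_iterated[OF P(2)]) (auto simp: exp_add ennreal_mult)
  also have "\<dots> = (\<integral>\<^sup>+x. ennreal (exp (inner_d d a (u x))) \<partial>P) * (\<integral>\<^sup>+y. ennreal (exp (inner_d d a (u' y))) \<partial>P')"
    by (simp add: nn_integral_cmult nn_integral_multc)
  also have "\<dots> \<le> ennreal (K * exp (v * inner_d d a a / 2)) * ennreal (K' * exp (v' * inner_d d a a / 2))"
    by (intro mult_mono subgaussD S) auto
  also have "\<dots> = ennreal (K * K' * exp ((v + v') * inner_d d a a / 2))"
    using K by (subst ennreal_mult[symmetric]) (auto simp: exp_add distrib_right add_divide_distrib mult_ac)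
  finally show "(\<integral>\<^sup>+w. ennreal (exp (inner_d d a (\<lambda>j. u (fst w) j + u' (snd w) j))) \<partial>(P \<Otimes>\<^sub>M P'))
    \<le> ennreal (K * K' * exp ((v + v') * inner_d d a a / 2))" .
qed

text \<open>s is the inverse scale of X. Both signs of r are requested in one assumption, and the
  common bound 8 is the 2 * K * K' of \<open>subgauss_exp_bilin\<close> for K = K' = 2.\<close>

lemma exp_abs_tail_bound_scaled:
  assumes P: "prob_space P" and X: "X \<in> borel_measurable P" and s: "s > 0"
    and le: "\<And>r. \<bar>r\<bar> = s \<Longrightarrow> (\<integral>\<^sup>+w. ennreal (exp (r * X w)) \<partial>P) \<le> ennreal 8"
  shows "measure P {w\<in>space P. t \<le> \<bar>X w\<bar>} \<le> 2 * exp (- (s * t / 4))"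
proof -
  have "measure P {w\<in>space P. s * t \<le> \<bar>s * X w\<bar>} \<le> 2 * exp (- (s * t) / 4)"
    using le[of s] le[of "- s"] s X by (intro exp_abs_tail_bound P) auto
  moreover have "s * t \<le> \<bar>s * X w\<bar> \<longleftrightarrow> t \<le> \<bar>X w\<bar>" for w
    using s by (simp add: abs_mult)
  ultimately show ?thesis by simp
qed

lemma bilin_tail_pair:
  assumes S: "subgauss d P u K v" "subgauss d P' u' K' v'"
    and K: "K \<ge> 1" "K' \<ge> 1" "K * K' \<le> 4" and v: "v \<ge> 0" "v' \<ge> 0"
    and s: "s > 0" "v * v' * (s\<^sup>2 * frob_sq d A) \<le> 1/4"
  shows "measure (P \<Otimes>\<^sub>M P') {w\<in>space (P \<Otimes>\<^sub>M P'). t \<le> \<bar>bilin d A (u (fst w)) (u' (snd w))\<bar>}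
    \<le> 2 * exp (- (s * t / 4))"
proof (rule exp_abs_tail_bound_scaled[OF _ _ s(1)])
  note P = subgauss_prob_space[OF S(1)] subgauss_prob_space[OF S(2)]
  note m = subgauss_measurable[OF S(1)] subgauss_measurable[OF S(2)]
  show "prob_space (P \<Otimes>\<^sub>M P')" by (intro prob_space_pair P)
  show bm: "(\<lambda>w. bilin d A (u (fst w)) (u' (snd w))) \<in> borel_measurable (P \<Otimes>\<^sub>M P')"
    by (intro bilin_measurable measurable_compose[OF measurable_fst m(1)]
        measurable_compose[OF measurable_snd m(2)])
  fix r :: real assume r: "\<bar>r\<bar> = s"
  then have r2: "r\<^sup>2 = s\<^sup>2" by (metis power2_abs)
  have "(\<integral>\<^sup>+w. ennreal (exp (r * bilin d A (u (fst w)) (u' (snd w)))) \<partial>(P \<Otimes>\<^sub>M P'))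
     = (\<integral>\<^sup>+x. \<integral>\<^sup>+y. ennreal (exp (bilin d (\<lambda>i j. r * A i j) (u x) (u' y))) \<partial>P' \<partial>P)"
    unfolding bilin_mat_scale using bm by (subst nn_integral_pair_iterated[OF P(2)]) auto
  also have "\<dots> \<le> ennreal (2 * K * K')"
    using s r2 by (intro subgauss_exp_bilin[OF S K(1,2) v]) (simp add: frob_sq_scale)
  also have "\<dots> \<le> ennreal 8" using K(3) by (intro ennreal_leI) simp
  finally show "(\<integral>\<^sup>+w. ennreal (exp (r * bilin d A (u (fst w)) (u' (snd w)))) \<partial>(P \<Otimes>\<^sub>M P')) \<le> ennreal 8" .
qed

text \<open>Coordinate k is split off the product. As J avoids k, the sum does not see an update at
  k, so the form is bilinear in two independent vectors although both live on the same product
  space.\<close>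

lemma bilin_tail_PiM:
  fixes c :: real
  assumes S: "subgauss d Q \<xi> 1 1" and I: "finite I" "J \<subseteq> I" "k \<in> I" "k \<notin> J"
    and s: "s > 0" "c\<^sup>2 * card J * (s\<^sup>2 * frob_sq d A) \<le> 1/4"
  shows "measure (PiM I (\<lambda>_. Q)) {f\<in>space (PiM I (\<lambda>_. Q)). t \<le> \<bar>bilin d A (\<lambda>j. c * (\<Sum>i\<in>J. \<xi> (f i) j)) (\<xi> (f k))\<bar>}
    \<le> 2 * exp (- (s * t / 4))"
proof (rule exp_abs_tail_bound_scaled[OF _ _ s(1)])
  note Q = subgauss_prob_space[OF S] and m = subgauss_measurable[OF S]
  define I' where "I' = I - {k}"
  have I': "I = insert k I'" "finite I'" "k \<notin> I'" "J \<subseteq> I'" using I by (auto simp: I'_def)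
  let ?u = "\<lambda>f j. c * (\<Sum>i\<in>J. \<xi> (f i) j)"
  note S' = subgauss_PiM_sum[OF S I'(2,4), of c]
  show "prob_space (PiM I (\<lambda>_. Q))" by (intro prob_space_PiM Q)
  show bm: "(\<lambda>f. bilin d A (?u f) (\<xi> (f k))) \<in> borel_measurable (PiM I (\<lambda>_. Q))"
    using I subgauss_measurable[OF subgauss_PiM_sum[OF S I(1,2)]]
    by (intro bilin_measurable measurable_PiM_coord m) auto
  fix r :: real assume r: "\<bar>r\<bar> = s"
  then have r2: "r\<^sup>2 = s\<^sup>2" by (metis power2_abs)
  have u_upd: "?u (x(k := y)) = ?u x" for x y
    using I(4) by (intro ext arg_cong2[where f = "(*)"] sum.cong refl) auto
  have "(\<integral>\<^sup>+f. ennreal (exp (r * bilin d A (?u f) (\<xi> (f k)))) \<partial>PiM I (\<lambda>_. Q))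
     = (\<integral>\<^sup>+x. \<integral>\<^sup>+y. ennreal (exp (r * bilin d A (?u (x(k := y))) (\<xi> ((x(k := y)) k)))) \<partial>Q \<partial>PiM I' (\<lambda>_. Q))"
    unfolding I'(1) using bm[unfolded I'(1)] by (intro nn_integral_PiM_insert Q I') auto
  also have "\<dots> = (\<integral>\<^sup>+x. \<integral>\<^sup>+y. ennreal (exp (bilin d (\<lambda>i j. r * A i j) (?u x) (\<xi> y))) \<partial>Q \<partial>PiM I' (\<lambda>_. Q))"
    unfolding u_upd bilin_mat_scale by simp
  also have "\<dots> \<le> ennreal (2 * 1 * 1)"
    using s r2 by (intro subgauss_exp_bilin[OF S' S]) (simp_all add: frob_sq_scale)
  also have "\<dots> \<le> ennreal 8" by (intro ennreal_leI) simp
  finally show "(\<integral>\<^sup>+f. ennreal (exp (r * bilin d A (?u f) (\<xi> (f k)))) \<partial>PiM I (\<lambda>_. Q)) \<le> ennreal 8" .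
qed

text \<open>The Hanson-Wright moment bound for a vector modelled on covariance r times the identity:
  r = 1 for noise, r = R^2 / d for the sphere. As a property of its own it covers the sphere, whose
  coordinates are not independent.\<close>

definition quad_conc :: "nat \<Rightarrow> 'a measure \<Rightarrow> ('a \<Rightarrow> nat \<Rightarrow> real) \<Rightarrow> real \<Rightarrow> bool" where
  "quad_conc d P u r \<longleftrightarrow> prob_space P \<and> (\<forall>i<d. (\<lambda>w. u w i) \<in> borel_measurable P) \<and>
     (\<forall>A. r\<^sup>2 * frob_sq d A \<le> 1/16 \<longrightarrow>
       (\<integral>\<^sup>+w. ennreal (exp (bilin d A (u w) (u w))) \<partial>P) \<le> ennreal (2 * exp (r * trace_d d A)))"

lemma quad_concD:
  "quad_conc d P u r \<Longrightarrow> r\<^sup>2 * frob_sq d A \<le> 1/16 \<Longrightarrow>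
    (\<integral>\<^sup>+w. ennreal (exp (bilin d A (u w) (u w))) \<partial>P) \<le> ennreal (2 * exp (r * trace_d d A))"
  by (simp add: quad_conc_def)

lemma trace_d_scale: "trace_d d (\<lambda>i j. c * A i j) = c * trace_d d A"
  by (simp add: trace_d_def sum_distrib_left)

lemma quad_conc_unif_sphere:
  assumes "d > 0"
  shows "quad_conc d (unif_sphere d R) (\<lambda>x. x) (R\<^sup>2 / d)"
  unfolding quad_conc_def
proof (intro conjI allI impI prob_space_unif_sphere)
  show "(\<lambda>x. x i) \<in> borel_measurable (unif_sphere d R)" if "i < d" for i
    using measurable_vspace_component[OF that] by simp
  fix A assume A: "(R\<^sup>2 / d)\<^sup>2 * frob_sq d A \<le> 1/16"
  have "(\<integral>\<^sup>+x. ennreal (exp (bilin d A x x)) \<partial>unif_sphere d R)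
    \<le> (\<integral>\<^sup>+z. ennreal (exp (bilin d (\<lambda>i j. R\<^sup>2 / d * A i j) z z)) \<partial>gauss d)"
    unfolding bilin_mat_scale by (rule unif_sphere_exp_quadratic_le[OF assms])
  also have "\<dots> \<le> ennreal (2 * exp (R\<^sup>2 / d * trace_d d A))"
    using gauss_exp_quadratic[of d "\<lambda>i j. R\<^sup>2 / d * A i j"] A
    unfolding trace_d_scale frob_sq_scale by simp
  finally show "(\<integral>\<^sup>+x. ennreal (exp (bilin d A x x)) \<partial>unif_sphere d R) \<le> ennreal (2 * exp (R\<^sup>2 / d * trace_d d A))" .
qed

lemma quad_conc_tail:
  assumes H: "quad_conc d P u r" and s: "s > 0" "r\<^sup>2 * (s\<^sup>2 * frob_sq d A) \<le> 1/16"
  shows "measure P {w\<in>space P. t \<le> \<bar>bilin d A (u w) (u w) - r * trace_d d A\<bar>} \<le> 2 * exp (- (s * t / 4))"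
proof (rule exp_abs_tail_bound_scaled[OF _ _ s(1)])
  show P: "prob_space P" using H by (simp add: quad_conc_def)
  have [measurable]: "(\<lambda>w. bilin d A (u w) (u w)) \<in> borel_measurable P"
    using H by (auto simp: quad_conc_def intro!: bilin_measurable)
  show "(\<lambda>w. bilin d A (u w) (u w) - r * trace_d d A) \<in> borel_measurable P" by measurable
  fix q :: real assume "\<bar>q\<bar> = s"
  then have "q\<^sup>2 = s\<^sup>2" by (metis power2_abs)
  then have *: "(\<integral>\<^sup>+w. ennreal (exp (q * bilin d A (u w) (u w))) \<partial>P) \<le> ennreal (2 * exp (r * (q * trace_d d A)))"
    using quad_concD[OF H, of "\<lambda>i j. q * A i j"] s by (simp add: bilin_mat_scale frob_sq_scale trace_d_scale)
  have "(\<integral>\<^sup>+w. ennreal (exp (q * (bilin d A (u w) (u w) - r * trace_d d A))) \<partial>P)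
     = (\<integral>\<^sup>+w. ennreal (exp (- (r * (q * trace_d d A)))) * ennreal (exp (q * bilin d A (u w) (u w))) \<partial>P)"
    by (simp add: ennreal_mult[symmetric] exp_add[symmetric] algebra_simps)
  also have "\<dots> = ennreal (exp (- (r * (q * trace_d d A)))) * (\<integral>\<^sup>+w. ennreal (exp (q * bilin d A (u w) (u w))) \<partial>P)"
    by (intro nn_integral_cmult) measurable
  also have "\<dots> \<le> ennreal (exp (- (r * (q * trace_d d A)))) * ennreal (2 * exp (r * (q * trace_d d A)))"
    by (intro mult_left_mono *) simp
  also have "\<dots> = ennreal 2"
    by (subst ennreal_mult[symmetric]) (auto simp: exp_minus field_simps)
  also have "\<dots> \<le> ennreal 8" by (intro ennreal_leI) simp
  finally show "(\<integral>\<^sup>+w. ennreal (exp (q * (bilin d A (u w) (u w) - r * trace_d d A))) \<partial>P) \<le> ennreal 8" .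
qed

text \<open>The mean r * tr A is left inside the form. At this scale its exponential is at most e
  \<le> 3, and 2 * 3 still lies below the 8 allowed by
  \<open>exp_abs_tail_bound_scaled\<close>.\<close>

lemma quad_conc_tail_uncentered:
  assumes H: "quad_conc d P u r" and s: "s > 0" "r\<^sup>2 * (s\<^sup>2 * frob_sq d A) \<le> 1/16"
    and small: "\<bar>r * s * trace_d d A\<bar> \<le> 1"
  shows "measure P {w\<in>space P. t \<le> \<bar>bilin d A (u w) (u w)\<bar>} \<le> 2 * exp (- (s * t / 4))"
proof (rule exp_abs_tail_bound_scaled[OF _ _ s(1)])
  show P: "prob_space P" using H by (simp add: quad_conc_def)
  show "(\<lambda>w. bilin d A (u w) (u w)) \<in> borel_measurable P"
    using H by (auto simp: quad_conc_def intro!: bilin_measurable)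
  fix q :: real assume q: "\<bar>q\<bar> = s"
  then have "q\<^sup>2 = s\<^sup>2" by (metis power2_abs)
  then have "(\<integral>\<^sup>+w. ennreal (exp (q * bilin d A (u w) (u w))) \<partial>P) \<le> ennreal (2 * exp (r * (q * trace_d d A)))"
    using quad_concD[OF H, of "\<lambda>i j. q * A i j"] s by (simp add: bilin_mat_scale frob_sq_scale trace_d_scale)
  also have "\<dots> \<le> ennreal 8"
  proof (rule ennreal_leI)
    have "r * (q * trace_d d A) \<le> \<bar>r\<bar> * (\<bar>q\<bar> * \<bar>trace_d d A\<bar>)"
      by (metis abs_ge_self abs_mult)
    also have "\<dots> \<le> 1" using small q s by (simp add: abs_mult mult.assoc)
    finally have "exp (r * (q * trace_d d A)) \<le> exp 1" by simp
    from order_trans[OF this exp_le] show "2 * exp (r * (q * trace_d d A)) \<le> 8" by simp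
  qed
  finally show "(\<integral>\<^sup>+w. ennreal (exp (q * bilin d A (u w) (u w))) \<partial>P) \<le> ennreal 8" .
qed

section \<open>Test error\<close>

lemma AE_pair_fst:
  assumes N: "prob_space N" and ae: "AE x in M. \<phi> x"
  shows "AE w in M \<Otimes>\<^sub>M N. \<phi> (fst w)"
proof -
  have "AE x in distr (M \<Otimes>\<^sub>M N) M fst. \<phi> x"
    unfolding prob_space.distr_pair_fst[OF N] by (rule ae)
  then show ?thesis by (intro AE_distrD[of fst _ M \<phi>]) simp_all
qed

lemma AE_pair_snd:
  assumes M: "prob_space M" and N: "prob_space N" and ae: "AE x in N. \<phi> x"
  shows "AE w in M \<Otimes>\<^sub>M N. \<phi> (snd w)"
proof -
  interpret N: prob_space N by fact
  obtain Z where Z: "{x\<in>space N. \<not> \<phi> x} \<subseteq> Z" "emeasure N Z = 0" "Z \<in> sets N"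
    using ae by (rule AE_E)
  have "emeasure (M \<Otimes>\<^sub>M N) (space M \<times> Z) = 0"
    using Z by (simp add: N.emeasure_pair_measure_Times)
  then show ?thesis
    using Z by (intro AE_I[of _ _ "space M \<times> Z"]) (auto simp: space_pair_measure)
qed

section \<open>Label, flip and noise of one test example\<close>

lemma prob_space_rad: "prob_space rad"
  by (simp add: rad_def measure_pmf.prob_space_axioms)

lemma AE_rad: "AE y in rad. y \<in> {-1, 1}"
  unfolding rad_def by (simp add: AE_measure_pmf_iff)

lemma rad_borel_measurable: "(\<lambda>y. y) \<in> borel_measurable rad"
  by (simp add: rad_def)

definition test_example :: "nat \<Rightarrow> real \<Rightarrow> (real \<times> bool \<times> (nat \<Rightarrow> real)) measure" where
  "test_example d p = rad \<Otimes>\<^sub>M (measure_pmf (bernoulli_pmf p) \<Otimes>\<^sub>M gauss d)"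

definition flip_sign :: "real \<times> bool \<times> (nat \<Rightarrow> real) \<Rightarrow> real" where
  "flip_sign q = (if fst (snd q) then - 1 else 1)"

text \<open>$\xi = y z$ is the noise of the sign-corrected example $y x = (y \tilde y) \mu + \xi$; it is
  again standard Gaussian, and independent of the flips.\<close>
definition test_noise :: "real \<times> bool \<times> (nat \<Rightarrow> real) \<Rightarrow> nat \<Rightarrow> real" where
  "test_noise q = (\<lambda>j. (flip_sign q * fst q) * snd (snd q) j)"

lemma prob_space_test_example: "prob_space (test_example d p)"
  unfolding test_example_def
  by (intro prob_space_pair prob_space_rad prob_space_gauss measure_pmf.prob_space_axioms)

lemma flip_sign_measurable: "flip_sign \<in> borel_measurable (test_example d p)"
proof -
  have "(\<lambda>b. if b then - 1 else 1 :: real) \<in> borel_measurable (measure_pmf (bernoulli_pmf p))" by simp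
  then show ?thesis
    unfolding flip_sign_def[abs_def] test_example_def
    by (rule measurable_compose[OF measurable_compose[OF measurable_snd measurable_fst]])
qed

lemma label_measurable: "fst \<in> borel_measurable (test_example d p)"
  unfolding test_example_def
  by (rule measurable_compose[OF measurable_fst rad_borel_measurable])

lemma test_gauss_measurable:
  "j < d \<Longrightarrow> (\<lambda>q. snd (snd q) j) \<in> borel_measurable (test_example d p)"
  unfolding test_example_def
  by (rule measurable_compose[OF measurable_compose[OF measurable_snd measurable_snd]
        measurable_gauss_component])

lemma test_noise_measurable:
  "j < d \<Longrightarrow> (\<lambda>q. test_noise q j) \<in> borel_measurable (test_example d p)"
  unfolding test_noise_def
  by (intro borel_measurable_times flip_sign_measurable label_measurable test_gauss_measurable)

text \<open>Given label and flip, the noise is s z with s = 1 or s = -1. What integrates to the same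
  value for both signs can thus be computed under \<open>gauss\<close>; the sub-Gaussian and the
  quadratic bound are both derived in this way.\<close>

lemma nn_integral_test_noise:
  fixes h :: "(nat \<Rightarrow> real) \<Rightarrow> ennreal"
  assumes m: "(\<lambda>q. h (test_noise q)) \<in> borel_measurable (test_example d p)"
    and h: "\<And>s. s\<^sup>2 = 1 \<Longrightarrow> (\<integral>\<^sup>+z. h (\<lambda>j. s * z j) \<partial>gauss d) = c"
  shows "(\<integral>\<^sup>+q. h (test_noise q) \<partial>test_example d p) = c"
proof -
  let ?B = "measure_pmf (bernoulli_pmf p)"
  interpret R: prob_space rad by (rule prob_space_rad)
  have P: "prob_space (?B \<Otimes>\<^sub>M gauss d)"
    by (intro prob_space_pair prob_space_gauss measure_pmf.prob_space_axioms)
  have "(\<integral>\<^sup>+q. h (test_noise q) \<partial>test_example d p)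
    = (\<integral>\<^sup>+y. \<integral>\<^sup>+r. h (test_noise (y, r)) \<partial>(?B \<Otimes>\<^sub>M gauss d) \<partial>rad)"
    using m unfolding test_example_def by (rule nn_integral_pair_iterated[OF P])
  also have "\<dots> = (\<integral>\<^sup>+y. c \<partial>rad)"
  proof (rule nn_integral_cong_AE)
    show "AE y in rad. (\<integral>\<^sup>+r. h (test_noise (y, r)) \<partial>(?B \<Otimes>\<^sub>M gauss d)) = c"
      using AE_rad
    proof eventually_elim
      fix y :: real assume y: "y \<in> {-1, 1}"
      have "(\<lambda>r. h (test_noise (y, r))) \<in> borel_measurable (?B \<Otimes>\<^sub>M gauss d)"
        using measurable_Pair2[OF m[unfolded test_example_def], of y] by (simp add: rad_def)
      then have "(\<integral>\<^sup>+r. h (test_noise (y, r)) \<partial>(?B \<Otimes>\<^sub>M gauss d))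
        = (\<integral>\<^sup>+b. \<integral>\<^sup>+z. h (test_noise (y, (b, z))) \<partial>gauss d \<partial>?B)"
        by (rule nn_integral_pair_iterated[OF prob_space_gauss])
      also have "\<dots> = (\<integral>\<^sup>+b. c \<partial>?B)"
      proof (rule nn_integral_cong)
        fix b :: bool
        have "((if b then -1 else 1) * y)\<^sup>2 = 1" using y by (auto simp: power_mult_distrib)
        then show "(\<integral>\<^sup>+z. h (test_noise (y, (b, z))) \<partial>gauss d) = c"
          unfolding test_noise_def flip_sign_def fst_conv snd_conv by (rule h)
      qed
      also have "\<dots> = c" by (simp add: measure_pmf.emeasure_space_1)
      finally show "(\<integral>\<^sup>+r. h (test_noise (y, r)) \<partial>(?B \<Otimes>\<^sub>M gauss d)) = c" .
    qed
  qed
  also have "\<dots> = c" by (simp add: R.emeasure_space_1)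
  finally show ?thesis .
qed

lemma subgauss_test_noise: "subgauss d (test_example d p) test_noise 1 1"
  unfolding subgauss_def
proof (intro conjI allI impI prob_space_test_example test_noise_measurable)
  fix a
  have "(\<integral>\<^sup>+q. ennreal (exp (inner_d d a (test_noise q))) \<partial>test_example d p) = ennreal (exp (inner_d d a a / 2))"
  proof (rule nn_integral_test_noise)
    have "(\<lambda>q. inner_d d a (test_noise q)) \<in> borel_measurable (test_example d p)"
      by (intro inner_d_measurable test_noise_measurable) auto
    then show "(\<lambda>q. ennreal (exp (inner_d d a (test_noise q)))) \<in> borel_measurable (test_example d p)"
      by measurable
    fix s :: real assume s: "s\<^sup>2 = 1"
    have "(\<integral>\<^sup>+z. ennreal (exp (inner_d d a (\<lambda>j. s * z j))) \<partial>gauss d)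
      = (\<integral>\<^sup>+z. ennreal (exp (inner_d d (\<lambda>j. s * a j) z)) \<partial>gauss d)"
      by (simp only: inner_d_scale inner_d_scale2)
    also have "\<dots> = ennreal (exp (s\<^sup>2 * inner_d d a a / 2))"
      unfolding gauss_mgf by (subst inner_d_scale, subst inner_d_scale2) (simp add: power2_eq_square)
    finally show "(\<integral>\<^sup>+z. ennreal (exp (inner_d d a (\<lambda>j. s * z j))) \<partial>gauss d) = ennreal (exp (inner_d d a a / 2))"
      using s by simp
  qed
  then show "(\<integral>\<^sup>+q. ennreal (exp (inner_d d a (test_noise q))) \<partial>test_example d p)
      \<le> ennreal (1 * exp (1 * inner_d d a a / 2))" by simp
qed

lemma quad_conc_test_noise: "quad_conc d (test_example d p) test_noise 1"
  unfolding quad_conc_def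
proof (intro conjI allI impI prob_space_test_example test_noise_measurable)
  fix A assume A: "1\<^sup>2 * frob_sq d A \<le> 1 / 16"
  have "(\<integral>\<^sup>+q. ennreal (exp (bilin d A (test_noise q) (test_noise q))) \<partial>test_example d p)
    = (\<integral>\<^sup>+z. ennreal (exp (bilin d A z z)) \<partial>gauss d)"
  proof (rule nn_integral_test_noise)
    have "(\<lambda>q. bilin d A (test_noise q) (test_noise q)) \<in> borel_measurable (test_example d p)"
      by (intro bilin_measurable test_noise_measurable) auto
    then show "(\<lambda>q. ennreal (exp (bilin d A (test_noise q) (test_noise q)))) \<in> borel_measurable (test_example d p)"
      by measurable
    fix s :: real assume "s\<^sup>2 = 1"
    then have "bilin d A (\<lambda>j. s * z j) (\<lambda>j. s * z j) = bilin d A z z" for z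
      by (simp only: bilin_scale bilin_scale2) (simp add: power2_eq_square)
    then show "(\<integral>\<^sup>+z. ennreal (exp (bilin d A (\<lambda>j. s * z j) (\<lambda>j. s * z j))) \<partial>gauss d)
      = (\<integral>\<^sup>+z. ennreal (exp (bilin d A z z)) \<partial>gauss d)" by simp
  qed
  then show "(\<integral>\<^sup>+q. ennreal (exp (bilin d A (test_noise q) (test_noise q))) \<partial>test_example d p)
     \<le> ennreal (2 * exp (1 * trace_d d A))"
    using gauss_exp_quadratic[of d A] A by simp
qed

lemma nn_integral_flip_sign:
  assumes p: "0 \<le> p" "p \<le> 1"
  shows "(\<integral>\<^sup>+q. ennreal (h (flip_sign q)) \<partial>test_example d p) = ennreal (h (-1)) * p + ennreal (h 1) * (1 - p)"
proof -
  let ?B = "measure_pmf (bernoulli_pmf p)"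
  interpret R: prob_space rad by (rule prob_space_rad)
  interpret G: prob_space "gauss d" by (rule prob_space_gauss)
  have P: "prob_space (?B \<Otimes>\<^sub>M gauss d)"
    by (intro prob_space_pair prob_space_gauss measure_pmf.prob_space_axioms)
  let ?g = "\<lambda>b. ennreal (h (if b then -1 else 1))"
  have g: "?g \<in> borel_measurable ?B" by simp
  have m2: "(\<lambda>r. ?g (fst r)) \<in> borel_measurable (?B \<Otimes>\<^sub>M gauss d)"
    by (rule measurable_compose[OF measurable_fst g])
  have "(\<integral>\<^sup>+q. ennreal (h (flip_sign q)) \<partial>test_example d p) = (\<integral>\<^sup>+y. \<integral>\<^sup>+r. ?g (fst r) \<partial>(?B \<Otimes>\<^sub>M gauss d) \<partial>rad)"
    unfolding test_example_def flip_sign_def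
    by (subst nn_integral_pair_iterated[OF P]) (simp_all add: measurable_compose[OF measurable_snd m2])
  also have "\<dots> = (\<integral>\<^sup>+r. ?g (fst r) \<partial>(?B \<Otimes>\<^sub>M gauss d))" by (simp add: R.emeasure_space_1)
  also have "\<dots> = (\<integral>\<^sup>+b. ?g b \<partial>?B)"
    by (subst nn_integral_pair_iterated[OF prob_space_gauss m2]) (simp add: G.emeasure_space_1)
  also have "\<dots> = ennreal (h (-1)) * p + ennreal (h 1) * (1 - p)"
    using p by simp
  finally show ?thesis .
qed

text \<open>Chernoff bound with parameter c. An example is unflipped with probability 1/2 + c, so
  the mean sign is 2 c, and the moment E exp (- c * sign) is at most exp (- c^2). Comparing with the
  quarter c / 2 of the mean leaves the exponent c^2 / 2 per example.\<close>

lemma flip_tail: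
  fixes c :: real and d :: nat
  assumes c: "0 < c" "c < 1/2" and J: "finite I" "J \<subseteq> I"
  defines "Q \<equiv> test_example d (1/2 - c)"
  shows "measure (PiM I (\<lambda>_. Q)) {f\<in>space (PiM I (\<lambda>_. Q)). (\<Sum>i\<in>J. flip_sign (f i)) \<le> card J * (c/2)}
     \<le> exp (- (c\<^sup>2 * card J / 2))"
proof -
  have Q: "prob_space Q" unfolding Q_def by (rule prob_space_test_example)
  interpret product_sigma_finite "\<lambda>_. Q"
    by (intro product_sigma_finite.intro prob_space_imp_sigma_finite Q)
  have fJ: "finite J" using J finite_subset by blast
  have fm: "flip_sign \<in> borel_measurable Q" unfolding Q_def by (rule flip_sign_measurable)
  have one: "(\<integral>\<^sup>+q. ennreal (exp (- c * flip_sign q)) \<partial>Q) \<le> ennreal (exp (- c\<^sup>2))"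
  proof -
    have e1: "exp c \<le> 1 + c + c\<^sup>2" using c by (intro exp_bound) auto
    have lower: "1 + c + c\<^sup>2 / 2 \<le> exp c" using c by (intro exp_lower_Taylor_quadratic) auto
    \<comment> \<open>Through the reciprocal: the product of 1 + c + c^2/2 and 1 - c + c^2/2 is 1 +
      c^4/4 \<ge> 1, which turns the lower Taylor bound for exp c into an upper bound for exp (-
      c).\<close>
    have upper: "exp (- c) \<le> 1 - c + c\<^sup>2 / 2"
    proof -
      have pos: "0 \<le> 1 - c + c\<^sup>2 / 2" using c by (simp add: add_nonneg_nonneg)
      have "(1 + c + c\<^sup>2 / 2) * (1 - c + c\<^sup>2 / 2) = 1 + (c\<^sup>2)\<^sup>2 / 4"
        by (simp add: power2_eq_square field_simps)
      then have "1 \<le> (1 + c + c\<^sup>2 / 2) * (1 - c + c\<^sup>2 / 2)" by simp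
      also have "\<dots> \<le> exp c * (1 - c + c\<^sup>2 / 2)" by (rule mult_right_mono[OF lower pos])
      finally show ?thesis by (simp add: exp_minus field_simps)
    qed
    have e2: "exp (- c) \<le> 1 - c + c\<^sup>2" using upper zero_le_power2[of c] by linarith
    have sinh: "2 * c \<le> exp c - exp (- c)" using lower upper by linarith
    have "(1/2 - c) * exp c + (1/2 + c) * exp (- c) = (exp c + exp (- c)) / 2 - c * (exp c - exp (- c))"
      by (simp add: field_simps)
    also have "\<dots> \<le> (1 + c + c\<^sup>2 + (1 - c + c\<^sup>2)) / 2 - c * (2 * c)"
      using e1 e2 sinh c by (intro diff_mono divide_right_mono add_mono mult_left_mono) auto
    also have "\<dots> = 1 + - c\<^sup>2" by (simp add: power2_eq_square)
    also have "\<dots> \<le> exp (- c\<^sup>2)" by (rule exp_ge_add_one_self)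
    finally have "(1/2 - c) * exp c + (1/2 + c) * exp (- c) \<le> exp (- c\<^sup>2)" .
    moreover have "(\<integral>\<^sup>+q. ennreal (exp (- c * flip_sign q)) \<partial>Q) = ennreal ((1/2 - c) * exp c + (1/2 + c) * exp (- c))"
      unfolding Q_def using c
      by (subst nn_integral_flip_sign[where h = "\<lambda>x. exp (- c * x)"])
         (auto simp: ennreal_mult[symmetric] ennreal_plus[symmetric] mult.commute simp del: ennreal_plus)
    ultimately show ?thesis by (simp add: ennreal_leI)
  qed
  let ?h = "\<lambda>i q. if i \<in> J then ennreal (exp (- c * flip_sign q)) else 1"
  have hm: "?h i \<in> borel_measurable Q" for i using fm by (cases "i \<in> J") auto
  have le: "(\<integral>\<^sup>+f. ennreal (exp (- c * (\<Sum>i\<in>J. flip_sign (f i)))) \<partial>PiM I (\<lambda>_. Q)) \<le> ennreal (exp (- c\<^sup>2 * card J))"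
  proof -
    have "(\<integral>\<^sup>+f. ennreal (exp (- c * (\<Sum>i\<in>J. flip_sign (f i)))) \<partial>PiM I (\<lambda>_. Q))
      = (\<integral>\<^sup>+f. (\<Prod>i\<in>I. ?h i (f i)) \<partial>PiM I (\<lambda>_. Q))"
      unfolding sum_distrib_left using J fJ
      by (simp add: exp_sum prod_ennreal[symmetric] prod.inter_restrict[symmetric] Int_absorb1 del: mult_minus_left)
    also have "\<dots> = (\<Prod>i\<in>I. \<integral>\<^sup>+q. ?h i q \<partial>Q)"
      using J hm by (intro product_nn_integral_prod) auto
    also have "\<dots> \<le> (\<Prod>i\<in>I. if i \<in> J then ennreal (exp (- c\<^sup>2)) else 1)"
      using one prob_space.emeasure_space_1[OF Q] by (intro prod_mono_ennreal) auto
    also have "\<dots> = ennreal (exp (- c\<^sup>2)) ^ card J"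
      using J fJ by (simp add: prod.inter_restrict[symmetric] Int_absorb1)
    also have "\<dots> = ennreal (exp (- c\<^sup>2 * card J))"
      by (simp add: ennreal_power exp_of_nat_mult[symmetric] mult_ac)
    finally show ?thesis .
  qed
  have "measure (PiM I (\<lambda>_. Q)) {f\<in>space (PiM I (\<lambda>_. Q)). - (c\<^sup>2 * card J / 2) \<le> - c * (\<Sum>i\<in>J. flip_sign (f i))}
    \<le> exp (- c\<^sup>2 * card J) * exp (- (- (c\<^sup>2 * card J / 2)))"
    using J by (intro exp_tail_bound prob_space_PiM Q le borel_measurable_times borel_measurable_const
        borel_measurable_sum measurable_PiM_coord fm) auto
  also have "\<dots> = exp (- (c\<^sup>2 * card J / 2))" by (simp add: exp_add[symmetric])
  also have "{f\<in>space (PiM I (\<lambda>_. Q)). - (c\<^sup>2 * card J / 2) \<le> - c * (\<Sum>i\<in>J. flip_sign (f i))}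
     = {f\<in>space (PiM I (\<lambda>_. Q)). (\<Sum>i\<in>J. flip_sign (f i)) \<le> card J * (c/2)}"
  proof -
    have "- (c\<^sup>2 * card J / 2) \<le> - c * s \<longleftrightarrow> s \<le> card J * (c/2)" for s
    proof -
      have "- (c\<^sup>2 * card J / 2) \<le> - c * s \<longleftrightarrow> c * s \<le> c * (card J * (c/2))"
        by (simp add: power2_eq_square mult_ac)
      also have "\<dots> \<longleftrightarrow> s \<le> card J * (c/2)" using c by simp
      finally show ?thesis .
    qed
    then show ?thesis by simp
  qed
  finally show ?thesis .
qed

lemma flip_prob:
  assumes "0 \<le> p" "p \<le> 1"
  shows "measure (test_example d p) {q\<in>space (test_example d p). flip_sign q = - 1} = p"
proof -
  interpret Q: prob_space "test_example d p" by (rule prob_space_test_example)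
  have m: "{q\<in>space (test_example d p). flip_sign q = - 1} \<in> sets (test_example d p)"
    using flip_sign_measurable[of d p] by measurable
  have "emeasure (test_example d p) {q\<in>space (test_example d p). flip_sign q = - 1}
     = (\<integral>\<^sup>+q. indicator {q\<in>space (test_example d p). flip_sign q = - 1} q \<partial>test_example d p)"
    using m by simp
  also have "\<dots> = (\<integral>\<^sup>+q. ennreal (if flip_sign q = - 1 then 1 else 0) \<partial>test_example d p)"
    by (intro nn_integral_cong) (auto split: split_indicator)
  also have "\<dots> = ennreal p"
    using assms by (subst nn_integral_flip_sign[where h = "\<lambda>x. if x = -1 then 1 else 0"]) auto
  finally show ?thesis using assms by (simp add: measure_def)
qed

section \<open>The test space and the signed prediction\<close>

lemma measurable_unif_sphere_component:
  "i < d \<Longrightarrow> (\<lambda>x. x i) \<in> borel_measurable (unif_sphere d R)"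
  using measurable_vspace_component[of i d] by simp

lemma test_space_eq:
  "test_space d M Rt p = unif_sphere d Rt \<Otimes>\<^sub>M PiM {1..M+1} (\<lambda>_. test_example d p)"
  by (simp add: test_space_def test_example_def)

lemma prob_space_test_PiM: "prob_space (PiM I (\<lambda>_. test_example d p))"
  by (intro prob_space_PiM prob_space_test_example)

lemma prob_space_test_space: "prob_space (test_space d M Rt p)"
  unfolding test_space_eq by (intro prob_space_pair prob_space_unif_sphere prob_space_test_PiM)

lemma test_mu_measurable: "j < d \<Longrightarrow> (\<lambda>\<theta>. fst \<theta> j) \<in> borel_measurable (test_space d M Rt p)"
  unfolding test_space_eq
  by (rule measurable_compose[OF measurable_fst measurable_unif_sphere_component])

lemma test_example_coord_measurable:
  "i \<in> {1..M+1} \<Longrightarrow> h \<in> borel_measurable (test_example d p) \<Longrightarrow>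
    (\<lambda>\<theta>. h (snd \<theta> i)) \<in> borel_measurable (test_space d M Rt p)"
  unfolding test_space_eq
  by (rule measurable_compose[OF measurable_snd measurable_PiM_coord])

text \<open>Labels range over all reals with law \<open>rad\<close>, so they are 1 or -1 only almost
  surely. Error events are therefore covered by bad events up to a null set.\<close>

lemma AE_test_labels: "AE \<theta> in test_space d M Rt p. \<forall>i\<in>{1..M+1}. fst (snd \<theta> i) \<in> {-1, 1}"
proof -
  have P: "prob_space (measure_pmf (bernoulli_pmf p) \<Otimes>\<^sub>M gauss d)"
    by (intro prob_space_pair prob_space_gauss measure_pmf.prob_space_axioms)
  have "AE q in test_example d p. fst q \<in> {-1, 1}"
    unfolding test_example_def by (rule AE_pair_fst[OF P AE_rad])
  then have "AE f in PiM {1..M+1} (\<lambda>_. test_example d p). fst (f i) \<in> {-1, 1}" if "i \<in> {1..M+1}" for i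
    using that by (intro AE_PiM_component prob_space_test_example)
  then have "AE f in PiM {1..M+1} (\<lambda>_. test_example d p). \<forall>i\<in>{1..M+1}. fst (f i) \<in> {-1, 1}"
    by (intro AE_finite_allI) auto
  then show ?thesis
    unfolding test_space_eq by (rule AE_pair_snd[OF prob_space_unif_sphere prob_space_test_PiM])
qed

text \<open>The divisor stays M for a proper subset J, so that the sum over all examples but one is
  literally a summand of the context average.\<close>

definition noise_sum :: "nat \<Rightarrow> nat set \<Rightarrow> (nat \<Rightarrow> real \<times> bool \<times> (nat \<Rightarrow> real)) \<Rightarrow> nat \<Rightarrow> real" where
  "noise_sum M J f = (\<lambda>j. (1 / real M) * (\<Sum>i\<in>J. test_noise (f i) j))"

lemma ts_y_eq: "ts_y \<theta> i = flip_sign (snd \<theta> i) * fst (snd \<theta> i)"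
  by (simp add: ts_y_def flip_sign_def)

text \<open>Multiplication by the label of example k moves into the query by bilinearity, and a
  squared label is 1, which turns every y x into flip * \<mu> + \<xi>. Raw labels disappear; flips
  and sign-corrected noise remain in both arguments of W.\<close>

lemma signed_prediction:
  assumes lab: "\<And>i. i \<in> {1..M+1} \<Longrightarrow> fst (snd \<theta> i) \<in> {-1, 1}" and k: "k \<in> {1..M+1}"
  shows "ts_y \<theta> k * yhat d M \<theta> W (ts_x \<theta> k) =
    bilin d W (\<lambda>j. (1 / real M * (\<Sum>i=1..M. flip_sign (snd \<theta> i))) * fst \<theta> j + noise_sum M {1..M} (snd \<theta>) j)
      (\<lambda>j. flip_sign (snd \<theta> k) * fst \<theta> j + test_noise (snd \<theta> k) j)"
proof -
  have yx: "ts_y \<theta> i * ts_x \<theta> i j = flip_sign (snd \<theta> i) * fst \<theta> j + test_noise (snd \<theta> i) j"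
    if "i \<in> {1..M+1}" for i j
  proof -
    have "fst (snd \<theta> i) * fst (snd \<theta> i) = 1" using lab[OF that] by auto
    then show ?thesis
      unfolding ts_y_eq ts_x_def test_noise_def by (simp add: algebra_simps)
  qed
  have mean: "(\<lambda>j. (1 / real M) * (\<Sum>i=1..M. ts_y \<theta> i * ts_x \<theta> i j))
    = (\<lambda>j. (1 / real M * (\<Sum>i=1..M. flip_sign (snd \<theta> i))) * fst \<theta> j + noise_sum M {1..M} (snd \<theta>) j)"
  proof
    fix j
    have "(\<Sum>i=1..M. ts_y \<theta> i * ts_x \<theta> i j)
      = (\<Sum>i=1..M. flip_sign (snd \<theta> i) * fst \<theta> j + test_noise (snd \<theta> i) j)"
      by (intro sum.cong) (auto simp: yx)
    then show "(1 / real M) * (\<Sum>i=1..M. ts_y \<theta> i * ts_x \<theta> i j)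
      = (1 / real M * (\<Sum>i=1..M. flip_sign (snd \<theta> i))) * fst \<theta> j + noise_sum M {1..M} (snd \<theta>) j"
      by (simp add: noise_sum_def sum.distrib sum_distrib_right distrib_left)
  qed
  have "ts_y \<theta> k * yhat d M \<theta> W (ts_x \<theta> k)
    = bilin d W (\<lambda>j. (1 / real M) * (\<Sum>i=1..M. ts_y \<theta> i * ts_x \<theta> i j)) (\<lambda>j. ts_y \<theta> k * ts_x \<theta> k j)"
    unfolding yhat_def bilin_def[symmetric] bilin_scale2 ..
  then show ?thesis using k unfolding mean by (simp add: yx)
qed

lemma sgn_prediction_eq:
  assumes "y \<in> {-1, 1::real}" "y * v > 0"
  shows "sgn v = y"
  using assms by (auto simp: sgn_real_def)

lemma bilin_mono_expand:
  "bilin d W (\<lambda>j. a * u j + b j) (\<lambda>j. c * u j + e j)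
    = a * c * bilin d W u u + a * bilin d W u e + c * bilin d W b u + bilin d W b e"
  by (simp add: bilin_add bilin_add2 bilin_scale bilin_scale2 algebra_simps)

lemma yhat_measurable:
  assumes k: "k \<in> {1..M+1}"
  shows "(\<lambda>\<theta>. yhat d M \<theta> W (ts_x \<theta> k)) \<in> borel_measurable (test_space d M Rt p)"
    and "(\<lambda>\<theta>. ts_y \<theta> k) \<in> borel_measurable (test_space d M Rt p)"
proof -
  have y: "(\<lambda>\<theta>. ts_y \<theta> i) \<in> borel_measurable (test_space d M Rt p)" if "i \<in> {1..M+1}" for i
    unfolding ts_y_eq using that
    by (intro borel_measurable_times test_example_coord_measurable flip_sign_measurable label_measurable)
  then show "(\<lambda>\<theta>. ts_y \<theta> k) \<in> borel_measurable (test_space d M Rt p)" using k .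
  have x: "(\<lambda>\<theta>. ts_x \<theta> i j) \<in> borel_measurable (test_space d M Rt p)" if "i \<in> {1..M+1}" "j < d" for i j
    unfolding ts_x_def using that
    by (intro borel_measurable_times borel_measurable_add test_mu_measurable
        test_example_coord_measurable[of i M "\<lambda>q. snd (snd q) j"] test_example_coord_measurable[of i M fst]
        label_measurable test_gauss_measurable)
  show "(\<lambda>\<theta>. yhat d M \<theta> W (ts_x \<theta> k)) \<in> borel_measurable (test_space d M Rt p)"
    unfolding yhat_def using k
    by (intro inner_d_measurable matvec_measurable borel_measurable_times borel_measurable_const
        borel_measurable_sum x y) auto
qed

lemma error_sets:
  assumes k: "k \<in> {1..M+1}"
  shows "{\<theta>\<in>space (test_space d M Rt p). sgn (yhat d M \<theta> W (ts_x \<theta> k)) \<noteq> ts_y \<theta> k} \<in> sets (test_space d M Rt p)"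
proof -
  note [measurable] = yhat_measurable(1)[OF k, of d W Rt p] yhat_measurable(2)[OF k, of d Rt p]
  show ?thesis by measurable
qed

lemma trace_d_le: "trace_d d W \<le> sqrt d * sqrt (frob_sq d W)"
proof -
  have "(\<Sum>i<d. 1 * W i i)\<^sup>2 \<le> (\<Sum>i<d. 1\<^sup>2) * (\<Sum>i<d. (W i i)\<^sup>2)"
    by (rule Cauchy_Schwarz_ineq_sum)
  also have "(\<Sum>i<d. (W i i)\<^sup>2) \<le> frob_sq d W"
    unfolding frob_sq_def
    by (intro sum_mono) (auto intro: member_le_sum[of _ "{..<d}" "\<lambda>j. (W _ j)\<^sup>2"])
  finally have "(trace_d d W)\<^sup>2 \<le> d * frob_sq d W" by (simp add: trace_d_def mult_left_mono)
  then have "\<bar>trace_d d W\<bar> \<le> sqrt (d * frob_sq d W)" by (simp add: real_le_rsqrt)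
  then show ?thesis by (simp add: real_sqrt_mult)
qed

section \<open>Tails of the individual terms, measured against F\<close>

context
  fixes d M :: nat and Rt p :: real and W :: "nat \<Rightarrow> nat \<Rightarrow> real" and F :: real
  assumes d: "d > 0" and M: "M \<ge> 1" and Rt: "Rt > 0"
    and F_def: "F = sqrt (frob_sq d W)" and F: "F > 0"
begin

private abbreviation "TS \<equiv> test_space d M Rt p"

lemma F_sq: "frob_sq d W = F\<^sup>2"
  using frob_sq_nonneg[of d W] by (simp add: F_def)

lemma noise_coord_subgauss:
  assumes "k \<in> {1..M+1}"
  shows "subgauss d (PiM {1..M+1} (\<lambda>_. test_example d p)) (\<lambda>f. test_noise (f k)) 1 1"
  using subgauss_PiM_sum[OF subgauss_test_noise, of "{1..M+1}" "{k}" d p 1] assms by simp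

text \<open>The proxy card J / M^2 is rounded up to 1, the proxy of a single noise vector, so that
  all terms pairing noise with \<mu> share one exponent.\<close>

lemma noise_sum_subgauss:
  assumes "J \<subseteq> {1..M}"
  shows "subgauss d (PiM {1..M+1} (\<lambda>_. test_example d p)) (noise_sum M J) 1 1"
proof -
  have "subgauss d (PiM {1..M+1} (\<lambda>_. test_example d p)) (noise_sum M J) 1 ((1 / real M)\<^sup>2 * card J)"
    unfolding noise_sum_def using assms by (intro subgauss_PiM_sum[OF subgauss_test_noise]) auto
  moreover have "(1 / real M)\<^sup>2 * card J \<le> 1"
  proof -
    have "real (card J) \<le> real M" using card_mono[OF _ assms] by simp
    also have "\<dots> \<le> (real M)\<^sup>2" using M by (simp add: power2_eq_square)
    finally show ?thesis using M by (simp add: power_divide)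
  qed
  ultimately show ?thesis by (rule subgauss_mono) simp
qed

text \<open>The sphere has proxy 2 Rt^2 / d, so the left-hand side is 2/9; the 3 in the scale is
  there to bring it below 1/4.\<close>

lemma mu_bilin_scale:
  "2 * Rt\<^sup>2 / d * 1 * ((sqrt d / (3 * Rt * F))\<^sup>2 * F\<^sup>2) \<le> 1/4"
  using d Rt F by (simp add: power_divide power_mult_distrib)

lemma tail_mu_noise:
  assumes "k \<in> {1..M+1}"
  shows "measure TS {\<theta>\<in>space TS. t \<le> \<bar>bilin d W (fst \<theta>) (test_noise (snd \<theta> k))\<bar>}
    \<le> 2 * exp (- (sqrt d / (3 * Rt * F) * t / 4))"
  unfolding test_space_eq using d Rt F mu_bilin_scale
  by (intro bilin_tail_pair[OF subgauss_unif_sphere[OF d Rt] noise_coord_subgauss[OF assms]])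
     (auto simp: F_sq)

lemma tail_noise_mu:
  assumes "k \<in> {1..M+1}"
  shows "measure TS {\<theta>\<in>space TS. t \<le> \<bar>bilin d W (test_noise (snd \<theta> k)) (fst \<theta>)\<bar>}
    \<le> 2 * exp (- (sqrt d / (3 * Rt * F) * t / 4))"
  unfolding test_space_eq bilin_transp[of d W, symmetric] using d Rt F mu_bilin_scale
  by (intro bilin_tail_pair[OF subgauss_unif_sphere[OF d Rt] noise_coord_subgauss[OF assms]])
     (auto simp: F_sq frob_sq_transp)

lemma tail_noise_sum_mu:
  assumes "J \<subseteq> {1..M}"
  shows "measure TS {\<theta>\<in>space TS. t \<le> \<bar>bilin d W (noise_sum M J (snd \<theta>)) (fst \<theta>)\<bar>}
    \<le> 2 * exp (- (sqrt d / (3 * Rt * F) * t / 4))"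
  unfolding test_space_eq bilin_transp[of d W, symmetric] using d Rt F mu_bilin_scale
  by (intro bilin_tail_pair[OF subgauss_unif_sphere[OF d Rt] noise_sum_subgauss[OF assms]])
     (auto simp: F_sq frob_sq_transp)

text \<open>Here the gain from averaging is kept: card J / M^2 \<le> 1 / M improves the exponent by
  sqrt M. Excluding k from J makes the two arguments independent.\<close>

lemma tail_noise_sum_noise:
  assumes J: "J \<subseteq> {1..M}" and k: "k \<in> {1..M+1}" "k \<notin> J"
  shows "measure TS {\<theta>\<in>space TS. t \<le> \<bar>bilin d W (noise_sum M J (snd \<theta>)) (test_noise (snd \<theta> k))\<bar>}
    \<le> 2 * exp (- (sqrt M / (2 * F) * t / 4))"
proof -
  let ?T = "PiM {1..M+1} (\<lambda>_. test_example d p)"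
  let ?X = "\<lambda>f. bilin d W (noise_sum M J f) (test_noise (f k))"
  have [measurable]: "?X \<in> borel_measurable ?T"
    by (intro bilin_measurable subgauss_measurable[OF noise_sum_subgauss[OF J]]
        subgauss_measurable[OF noise_coord_subgauss[OF k(1)]])
  have "measure TS {\<theta>\<in>space TS. t \<le> \<bar>?X (snd \<theta>)\<bar>} = measure ?T {f\<in>space ?T. t \<le> \<bar>?X f\<bar>}"
    unfolding test_space_eq by (intro measure_pair_snd prob_space_unif_sphere prob_space_test_PiM) measurable
  also have "\<dots> \<le> 2 * exp (- (sqrt M / (2 * F) * t / 4))"
    unfolding noise_sum_def
  proof (rule bilin_tail_PiM[OF subgauss_test_noise])
    have "(1 / real M)\<^sup>2 * card J * ((sqrt M / (2 * F))\<^sup>2 * frob_sq d W) = card J / M / 4"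
      using M F by (simp add: F_sq power_divide power_mult_distrib power2_eq_square field_simps)
    also have "\<dots> \<le> 1/4" using card_mono[OF _ J] M by simp
    finally show "(1 / real M)\<^sup>2 * card J * ((sqrt M / (2 * F))\<^sup>2 * frob_sq d W) \<le> 1/4" .
  qed (use J k M F in auto)
  finally show ?thesis .
qed

lemma tail_mu_mu:
  shows "measure TS {\<theta>\<in>space TS. t \<le> \<bar>bilin d W (fst \<theta>) (fst \<theta>) - Rt\<^sup>2 / d * trace_d d W\<bar>}
    \<le> 2 * exp (- (d / (4 * Rt\<^sup>2 * F) * t / 4))"
proof -
  have [measurable]: "(\<lambda>x. bilin d W x x) \<in> borel_measurable (unif_sphere d Rt)"
    by (intro bilin_measurable measurable_unif_sphere_component)
  have "measure TS {\<theta>\<in>space TS. t \<le> \<bar>bilin d W (fst \<theta>) (fst \<theta>) - Rt\<^sup>2 / d * trace_d d W\<bar>}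
    = measure (unif_sphere d Rt) {x\<in>space (unif_sphere d Rt). t \<le> \<bar>bilin d W x x - Rt\<^sup>2 / d * trace_d d W\<bar>}"
    unfolding test_space_eq by (intro measure_pair_fst[OF prob_space_test_PiM]) measurable
  also have "\<dots> \<le> 2 * exp (- (d / (4 * Rt\<^sup>2 * F) * t / 4))"
    using d Rt F by (intro quad_conc_tail[OF quad_conc_unif_sphere[OF d]])
      (auto simp: F_sq power_divide power_mult_distrib)
  finally show ?thesis .
qed

text \<open>In the memorisation bound this form counts as noise, mean included. As tr W \<le> sqrt d
  * F, the mean can reach Rt^2 F / sqrt d, so the exponent is smaller by a factor sqrt d than in
  \<open>tail_mu_mu\<close>.\<close>

lemma tail_mu_mu_uncentered:
  assumes "trace_d d W \<ge> 0"
  shows "measure TS {\<theta>\<in>space TS. t \<le> \<bar>bilin d W (fst \<theta>) (fst \<theta>)\<bar>}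
    \<le> 2 * exp (- (sqrt d / (4 * Rt\<^sup>2 * F) * t / 4))"
proof -
  have [measurable]: "(\<lambda>x. bilin d W x x) \<in> borel_measurable (unif_sphere d Rt)"
    by (intro bilin_measurable measurable_unif_sphere_component)
  have "measure TS {\<theta>\<in>space TS. t \<le> \<bar>bilin d W (fst \<theta>) (fst \<theta>)\<bar>}
    = measure (unif_sphere d Rt) {x\<in>space (unif_sphere d Rt). t \<le> \<bar>bilin d W x x\<bar>}"
    unfolding test_space_eq by (intro measure_pair_fst[OF prob_space_test_PiM]) measurable
  also have "\<dots> \<le> 2 * exp (- (sqrt d / (4 * Rt\<^sup>2 * F) * t / 4))"
  proof (rule quad_conc_tail_uncentered[OF quad_conc_unif_sphere[OF d]])
    show "(Rt\<^sup>2 / d)\<^sup>2 * ((sqrt d / (4 * Rt\<^sup>2 * F))\<^sup>2 * frob_sq d W) \<le> 1/16"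
      using d Rt F by (simp add: F_sq power_divide power_mult_distrib field_simps power2_eq_square)
    have "sqrt d * trace_d d W \<le> sqrt d * (sqrt d * F)"
      using trace_d_le[of d W] by (intro mult_left_mono) (auto simp: F_def)
    then have "sqrt d * trace_d d W \<le> d * F" by (simp add: mult.assoc[symmetric])
    also have "\<dots> \<le> 4 * d * F" using d F by simp
    finally show "\<bar>Rt\<^sup>2 / d * (sqrt d / (4 * Rt\<^sup>2 * F)) * trace_d d W\<bar> \<le> 1"
      using d Rt F assms by (simp add: abs_mult field_simps)
  qed (use d Rt F in auto)
  finally show ?thesis .
qed

lemma tail_noise_noise:
  assumes k: "k \<in> {1..M+1}"
  shows "measure TS {\<theta>\<in>space TS. t \<le> \<bar>bilin d W (test_noise (snd \<theta> k)) (test_noise (snd \<theta> k)) - trace_d d W\<bar>}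
    \<le> 2 * exp (- (1 / (4 * F) * t / 4))"
proof -
  let ?T = "PiM {1..M+1} (\<lambda>_. test_example d p)"
  let ?\<phi> = "\<lambda>q. t \<le> \<bar>bilin d W (test_noise q) (test_noise q) - 1 * trace_d d W\<bar>"
  have m [measurable]: "(\<lambda>q. bilin d W (test_noise q) (test_noise q)) \<in> borel_measurable (test_example d p)"
    by (intro bilin_measurable test_noise_measurable)
  have [measurable]: "(\<lambda>f. bilin d W (test_noise (f k)) (test_noise (f k))) \<in> borel_measurable ?T"
    using measurable_PiM_coord[OF k m] .
  have "measure TS {\<theta>\<in>space TS. ?\<phi> (snd \<theta> k)} = measure ?T {f\<in>space ?T. ?\<phi> (f k)}"
    unfolding test_space_eq
    by (rule measure_pair_snd[OF prob_space_unif_sphere prob_space_test_PiM, where \<phi> = "\<lambda>f. ?\<phi> (f k)"]) measurable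
  also have "\<dots> = measure (test_example d p) {q\<in>space (test_example d p). ?\<phi> q}"
    using k by (intro measure_PiM_component prob_space_test_example) auto
  also have "\<dots> \<le> 2 * exp (- (1 / (4 * F) * t / 4))"
    using F by (intro quad_conc_tail[OF quad_conc_test_noise]) (auto simp: F_sq power_divide power_mult_distrib)
  finally show ?thesis by simp
qed

end

lemma measure_Un_le_add:
  assumes "A \<in> sets P" "B \<in> sets P" "measure P A \<le> a" "measure P B \<le> b"
  shows "measure P (A \<union> B) \<le> a + b"
  using measure_Un_le[OF assms(1,2)] assms(3,4) by linarith

lemma test_bilin_measurable:
  assumes k: "k \<in> {1..M+1}" and J: "J \<subseteq> {1..M}"
  shows "(\<lambda>\<theta>. bilin d W (fst \<theta>) (fst \<theta>)) \<in> borel_measurable (test_space d M Rt p)" (is ?g1)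
    "(\<lambda>\<theta>. bilin d W (fst \<theta>) (test_noise (snd \<theta> k))) \<in> borel_measurable (test_space d M Rt p)" (is ?g2)
    "(\<lambda>\<theta>. bilin d W (test_noise (snd \<theta> k)) (fst \<theta>)) \<in> borel_measurable (test_space d M Rt p)" (is ?g3)
    "(\<lambda>\<theta>. bilin d W (test_noise (snd \<theta> k)) (test_noise (snd \<theta> k))) \<in> borel_measurable (test_space d M Rt p)" (is ?g4)
    "(\<lambda>\<theta>. bilin d W (noise_sum M J (snd \<theta>)) (fst \<theta>)) \<in> borel_measurable (test_space d M Rt p)" (is ?g5)
    "(\<lambda>\<theta>. bilin d W (noise_sum M J (snd \<theta>)) (test_noise (snd \<theta> k))) \<in> borel_measurable (test_space d M Rt p)" (is ?g6)
proof -
  have x: "(\<lambda>\<theta>. test_noise (snd \<theta> i) j) \<in> borel_measurable (test_space d M Rt p)"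
    if "i \<in> {1..M+1}" "j < d" for i j
    using that by (intro test_example_coord_measurable test_noise_measurable)
  have s: "(\<lambda>\<theta>. noise_sum M J (snd \<theta>) j) \<in> borel_measurable (test_space d M Rt p)" if "j < d" for j
    unfolding noise_sum_def using J that
    by (intro borel_measurable_times borel_measurable_const borel_measurable_sum x) auto
  show ?g1 ?g2 ?g3 ?g4 ?g5 ?g6
    by (intro bilin_measurable test_mu_measurable x[OF k] s; assumption)+
qed

lemma flip_sign_abs: "\<bar>flip_sign q\<bar> = 1" "flip_sign q \<noteq> - 1 \<Longrightarrow> flip_sign q = 1"
  by (auto simp: flip_sign_def split: if_splits)

lemma abs_flip_mean_le: "M \<ge> 1 \<Longrightarrow> \<bar>1 / real M * (\<Sum>i=1..M. flip_sign (f i))\<bar> \<le> 1"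
proof -
  assume M: "M \<ge> 1"
  have "\<bar>\<Sum>i=1..M. flip_sign (f i)\<bar> \<le> (\<Sum>i=1..M. \<bar>flip_sign (f i)\<bar>)" by (rule sum_abs)
  then show ?thesis using M by (simp add: flip_sign_abs abs_mult field_simps)
qed

text \<open>With $T = \tilde R^2\,\mathrm{tr} W / d$ the signal is at least $cT/4$ off the bad events, and
  each of the three noise terms is below $cT/16$.\<close>
lemma test_error_bound:
  fixes c Rt :: real
  assumes d: "d > 0" and M: "M \<ge> 1" and Rt: "Rt > 0" and c: "0 < c" "c < 1/2"
    and F_def: "F = sqrt (frob_sq d W)" and F: "F > 0" and \<kappa>: "\<kappa> = trace_d d W / F" "\<kappa> > 0"
  shows "measure (test_space d M Rt (1/2 - c)) (test_err_event d M Rt (1/2 - c) W) \<le>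
    (1/2 - c) + (exp (- (c\<^sup>2 * M / 2)) + (2 * exp (- (\<kappa> / 32)) + (2 * exp (- (c * Rt * \<kappa> / (192 * sqrt d)))
      + (2 * exp (- (c * Rt * \<kappa> / (192 * sqrt d))) + 2 * exp (- (c * sqrt M * Rt\<^sup>2 * \<kappa> / (128 * d)))))))"
proof -
  let ?p = "1/2 - c"
  let ?P = "test_space d M Rt ?p"
  let ?Q = "test_example d ?p"
  let ?J = "{1..M}"
  have K: "M + 1 \<in> {1..M+1}" by simp
  interpret P: prob_space ?P by (rule prob_space_test_space)
  define T where "T = Rt\<^sup>2 / d * trace_d d W"
  have tr: "trace_d d W = \<kappa> * F" using \<kappa> F by simp
  have "trace_d d W > 0" unfolding tr using \<kappa>(2) F by (rule mult_pos_pos)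
  then have T: "T > 0" unfolding T_def using Rt d by (intro mult_pos_pos divide_pos_pos) auto
  define \<tau> where "\<tau> = c * T / 16"
  \<comment> \<open>\<open>A0\<close> is the flip of the query label and carries the irreducible
    error p; \<open>A1\<close> is a context without a clear majority of unflipped labels; the other
    four are deviations of the terms of the expanded form.\<close>
  define A0 where "A0 = {\<theta>\<in>space ?P. flip_sign (snd \<theta> (M+1)) = - 1}"
  define A1 where "A1 = {\<theta>\<in>space ?P. (\<Sum>i\<in>?J. flip_sign (snd \<theta> i)) \<le> card ?J * (c/2)}"
  define A2 where "A2 = {\<theta>\<in>space ?P. T / 2 \<le> \<bar>bilin d W (fst \<theta>) (fst \<theta>) - Rt\<^sup>2 / d * trace_d d W\<bar>}"
  define A3 where "A3 = {\<theta>\<in>space ?P. \<tau> \<le> \<bar>bilin d W (fst \<theta>) (test_noise (snd \<theta> (M+1)))\<bar>}"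
  define A4 where "A4 = {\<theta>\<in>space ?P. \<tau> \<le> \<bar>bilin d W (noise_sum M ?J (snd \<theta>)) (fst \<theta>)\<bar>}"
  define A5 where "A5 = {\<theta>\<in>space ?P. \<tau> \<le> \<bar>bilin d W (noise_sum M ?J (snd \<theta>)) (test_noise (snd \<theta> (M+1)))\<bar>}"
  note bm [measurable] = test_bilin_measurable[OF K order_refl, of d W Rt ?p]
  have fs [measurable]: "(\<lambda>\<theta>. flip_sign (snd \<theta> i)) \<in> borel_measurable ?P" if "i \<in> {1..M+1}" for i
    using that by (intro test_example_coord_measurable flip_sign_measurable)
  have fsK [measurable]: "(\<lambda>\<theta>. flip_sign (snd \<theta> (M+1))) \<in> borel_measurable ?P" by (rule fs[OF K])
  have ssum [measurable]: "(\<lambda>\<theta>. \<Sum>i\<in>?J. flip_sign (snd \<theta> i)) \<in> borel_measurable ?P"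
    by (intro borel_measurable_sum fs) auto
  have sets: "A0 \<in> sets ?P" "A1 \<in> sets ?P" "A2 \<in> sets ?P" "A3 \<in> sets ?P" "A4 \<in> sets ?P" "A5 \<in> sets ?P"
    unfolding A0_def A1_def A2_def A3_def A4_def A5_def by measurable
  have m0: "measure ?P A0 \<le> ?p"
  proof -
    let ?T = "PiM {1..M+1} (\<lambda>_. ?Q)"
    have fm [measurable]: "flip_sign \<in> borel_measurable ?Q" by (rule flip_sign_measurable)
    have [measurable]: "(\<lambda>f. flip_sign (f (M+1))) \<in> borel_measurable ?T"
      by (rule measurable_PiM_coord[OF K fm])
    have "measure ?P A0 = measure ?T {f\<in>space ?T. flip_sign (f (M+1)) = - 1}"
      unfolding A0_def test_space_eq
      by (intro measure_pair_snd prob_space_unif_sphere prob_space_test_PiM) measurable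
    also have "\<dots> = measure ?Q {q\<in>space ?Q. flip_sign q = - 1}"
      by (intro measure_PiM_component prob_space_test_example K) (auto intro!: measurable_sets_Collect)
    also have "\<dots> = ?p" using c by (intro flip_prob) auto
    finally show ?thesis by simp
  qed
  have m1: "measure ?P A1 \<le> exp (- (c\<^sup>2 * M / 2))"
  proof -
    let ?T = "PiM {1..M+1} (\<lambda>_. ?Q)"
    have [measurable]: "(\<lambda>f. \<Sum>i\<in>?J. flip_sign (f i)) \<in> borel_measurable ?T"
      by (intro borel_measurable_sum measurable_PiM_coord flip_sign_measurable) auto
    have "measure ?P A1 = measure ?T {f\<in>space ?T. (\<Sum>i\<in>?J. flip_sign (f i)) \<le> card ?J * (c/2)}"
      unfolding A1_def test_space_eq
      by (intro measure_pair_snd prob_space_unif_sphere prob_space_test_PiM) measurable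
    also have "\<dots> \<le> exp (- (c\<^sup>2 * card ?J / 2))" by (rule flip_tail[OF c]) auto
    finally show ?thesis by simp
  qed
  have m2: "measure ?P A2 \<le> 2 * exp (- (\<kappa> / 32))"
  proof -
    \<comment> \<open>Since T = Rt^2 \<kappa> F / d, both Rt and F cancel: the relative fluctuation
      of the signal does not depend on the test radius.\<close>
    have eq: "d / (4 * Rt\<^sup>2 * F) * (T / 2) / 4 = \<kappa> / 32"
      using d Rt F by (simp add: T_def tr)
    then show ?thesis
      unfolding A2_def using tail_mu_mu[OF d M Rt F_def F, of ?p "T / 2"] by (simp only: eq)
  qed
  have e: "sqrt d / (3 * Rt * F) * \<tau> / 4 = c * Rt * \<kappa> / (192 * sqrt d)"
  proof -
    have "sqrt d * sqrt d = d" by simp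
    then show ?thesis
      using d Rt F unfolding \<tau>_def T_def tr by (simp add: field_simps power2_eq_square)
  qed
  have m3: "measure ?P A3 \<le> 2 * exp (- (c * Rt * \<kappa> / (192 * sqrt d)))"
    unfolding A3_def using tail_mu_noise[OF d M Rt F_def F K, of ?p \<tau>] by (simp only: e)
  have m4: "measure ?P A4 \<le> 2 * exp (- (c * Rt * \<kappa> / (192 * sqrt d)))"
    unfolding A4_def using tail_noise_sum_mu[OF d M Rt F_def F order_refl, of ?p \<tau>] by (simp only: e)
  have m5: "measure ?P A5 \<le> 2 * exp (- (c * sqrt M * Rt\<^sup>2 * \<kappa> / (128 * d)))"
  proof -
    have "sqrt M / (2 * F) * \<tau> / 4 = c * sqrt M * Rt\<^sup>2 * \<kappa> / (128 * d)"
      using d F by (simp add: \<tau>_def T_def tr)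
    then show ?thesis
      unfolding A5_def using tail_noise_sum_noise[OF d M Rt F_def F order_refl K, of ?p \<tau>] by simp
  qed
  have err: "test_err_event d M Rt ?p W \<in> sets ?P"
    unfolding test_err_event_def by (rule error_sets[OF K])
  have "AE \<theta> in ?P. \<theta> \<in> test_err_event d M Rt ?p W \<longrightarrow> \<theta> \<in> A0 \<union> (A1 \<union> (A2 \<union> (A3 \<union> (A4 \<union> A5))))"
    using AE_test_labels
  proof eventually_elim
    fix \<theta> :: "(nat \<Rightarrow> real) \<times> (nat \<Rightarrow> real \<times> bool \<times> (nat \<Rightarrow> real))"
    assume lab: "\<forall>i\<in>{1..M+1}. fst (snd \<theta> i) \<in> {-1, 1}"
    show "\<theta> \<in> test_err_event d M Rt ?p W \<longrightarrow> \<theta> \<in> A0 \<union> (A1 \<union> (A2 \<union> (A3 \<union> (A4 \<union> A5))))"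
    proof (rule impI, rule ccontr)
      assume err: "\<theta> \<in> test_err_event d M Rt ?p W" and "\<theta> \<notin> A0 \<union> (A1 \<union> (A2 \<union> (A3 \<union> (A4 \<union> A5))))"
      then have sp: "\<theta> \<in> space ?P" and
        n: "\<theta> \<notin> A0" "\<theta> \<notin> A1" "\<theta> \<notin> A2" "\<theta> \<notin> A3" "\<theta> \<notin> A4" "\<theta> \<notin> A5"
        by (auto simp: test_err_event_def)
      define m where "m = 1 / real M * (\<Sum>i=1..M. flip_sign (snd \<theta> i))"
      define a where "a = bilin d W (fst \<theta>) (fst \<theta>)"
      define b where "b = bilin d W (fst \<theta>) (test_noise (snd \<theta> (M+1)))"
      define u where "u = bilin d W (noise_sum M ?J (snd \<theta>)) (fst \<theta>)"
      define v where "v = bilin d W (noise_sum M ?J (snd \<theta>)) (test_noise (snd \<theta> (M+1)))"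
      have s1: "flip_sign (snd \<theta> (M+1)) = 1" using n(1) sp flip_sign_abs(2) by (auto simp: A0_def)
      have "M * (c/2) < (\<Sum>i=1..M. flip_sign (snd \<theta> i))" using n(2) sp by (auto simp: A1_def)
      then have m: "c / 2 < m" using M by (simp add: m_def field_simps)
      have m1: "\<bar>m\<bar> \<le> 1" unfolding m_def by (rule abs_flip_mean_le[OF M])
      have "\<bar>a - T\<bar> < T / 2" using n(3) sp by (auto simp: A2_def a_def T_def)
      then have a: "a > T / 2" by linarith
      have b: "\<bar>b\<bar> < \<tau>" using n(4) sp by (auto simp: A3_def b_def)
      have u: "\<bar>u\<bar> < \<tau>" using n(5) sp by (auto simp: A4_def u_def)
      have v: "\<bar>v\<bar> < \<tau>" using n(6) sp by (auto simp: A5_def v_def)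
      have "c / 2 * (T / 2) \<le> m * a" using m a c T by (intro mult_mono) auto
      moreover have "\<bar>m * b\<bar> \<le> 1 * \<tau>"
        unfolding abs_mult using m1 b by (intro mult_mono) auto
      ultimately have "0 < m * 1 * a + m * b + 1 * u + v"
        using u v T c mult_pos_pos[OF c(1) T] unfolding \<tau>_def by linarith
      moreover have "ts_y \<theta> (M+1) * yhat d M \<theta> W (ts_x \<theta> (M+1)) = m * 1 * a + m * b + 1 * u + v"
        using signed_prediction[OF lab[rule_format] K, of d W]
        by (simp only: m_def[symmetric] a_def b_def u_def v_def s1 bilin_mono_expand)
      moreover have "ts_y \<theta> (M+1) \<in> {-1, 1}" unfolding ts_y_eq s1 using lab K by simp
      ultimately have "sgn (yhat d M \<theta> W (ts_x \<theta> (M+1))) = ts_y \<theta> (M+1)"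
        by (intro sgn_prediction_eq) auto
      then show False using err by (simp add: test_err_event_def)
    qed
  qed
  then have "measure ?P (test_err_event d M Rt ?p W) \<le> measure ?P (A0 \<union> (A1 \<union> (A2 \<union> (A3 \<union> (A4 \<union> A5)))))"
    using sets by (intro P.finite_measure_mono_AE) auto
  also have "\<dots> \<le> ?p + (exp (- (c\<^sup>2 * M / 2)) + (2 * exp (- (\<kappa> / 32)) + (2 * exp (- (c * Rt * \<kappa> / (192 * sqrt d)))
      + (2 * exp (- (c * Rt * \<kappa> / (192 * sqrt d))) + 2 * exp (- (c * sqrt M * Rt\<^sup>2 * \<kappa> / (128 * d)))))))"
    using sets by (intro measure_Un_le_add m0 m1 m2 m3 m4 m5 sets.Un)
  finally show ?thesis .
qed

text \<open>The memorised term $\xi_k^\top W \xi_k / M \approx \mathrm{tr} W / M$ must beat five other terms,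
  each below $\mathrm{tr} W / (12 M)$.\<close>
lemma memo_error_bound:
  fixes Rt p :: real
  assumes d: "d > 0" and M: "M \<ge> 1" and Rt: "Rt > 0"
    and F_def: "F = sqrt (frob_sq d W)" and F: "F > 0" and \<kappa>: "\<kappa> = trace_d d W / F" "\<kappa> > 0"
  shows "memo_err_event d M Rt p W \<in> sets (test_space d M Rt p)"
    and "measure (test_space d M Rt p) (memo_err_event d M Rt p W) \<le>
    real M * (2 * exp (- (\<kappa> / 32)) + (2 * exp (- (\<kappa> / (96 * sqrt M)))
      + (2 * exp (- (sqrt d * \<kappa> / (192 * real M * Rt\<^sup>2))) + (2 * exp (- (sqrt d * \<kappa> / (144 * real M * Rt)))
      + (2 * exp (- (sqrt d * \<kappa> / (144 * real M * Rt))) + 2 * exp (- (sqrt d * \<kappa> / (144 * real M * Rt))))))))"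
    (is "_ \<le> real M * ?bound")
proof -
  let ?P = "test_space d M Rt p"
  interpret P: prob_space ?P by (rule prob_space_test_space)
  have tr: "trace_d d W = \<kappa> * F" using \<kappa> F by simp
  have tr_pos: "trace_d d W > 0" unfolding tr using \<kappa>(2) F by (rule mult_pos_pos)
  define \<tau> where "\<tau> = trace_d d W / (12 * M)"
  define E where "E k = {\<theta>\<in>space ?P. sgn (yhat d M \<theta> W (ts_x \<theta> k)) \<noteq> ts_y \<theta> k}" for k
  have E_sets: "E k \<in> sets ?P" if "k \<in> {1..M}" for k
    unfolding E_def using that by (intro error_sets) auto
  have event: "memo_err_event d M Rt p W = (\<Union>k\<in>{1..M}. E k)"
    by (auto simp: memo_err_event_def E_def)
  show "memo_err_event d M Rt p W \<in> sets ?P" unfolding event using E_sets by auto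
  have Ek: "measure ?P (E k) \<le> ?bound" if k: "k \<in> {1..M}" for k
  proof -
    \<comment> \<open>With example k left out, the remaining context noise is independent of the
      noise of k; the part left out produces the signal.\<close>
    let ?J = "{1..M} - {k}"
    have K: "k \<in> {1..M+1}" and J: "?J \<subseteq> {1..M}" "k \<notin> ?J" using k by auto
    define A1 where "A1 = {\<theta>\<in>space ?P. trace_d d W / 2 \<le> \<bar>bilin d W (test_noise (snd \<theta> k)) (test_noise (snd \<theta> k)) - trace_d d W\<bar>}"
    define A2 where "A2 = {\<theta>\<in>space ?P. \<tau> \<le> \<bar>bilin d W (noise_sum M ?J (snd \<theta>)) (test_noise (snd \<theta> k))\<bar>}"
    define A3 where "A3 = {\<theta>\<in>space ?P. \<tau> \<le> \<bar>bilin d W (fst \<theta>) (fst \<theta>)\<bar>}"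
    define A4 where "A4 = {\<theta>\<in>space ?P. \<tau> \<le> \<bar>bilin d W (fst \<theta>) (test_noise (snd \<theta> k))\<bar>}"
    define A5 where "A5 = {\<theta>\<in>space ?P. \<tau> \<le> \<bar>bilin d W (test_noise (snd \<theta> k)) (fst \<theta>)\<bar>}"
    define A6 where "A6 = {\<theta>\<in>space ?P. \<tau> \<le> \<bar>bilin d W (noise_sum M ?J (snd \<theta>)) (fst \<theta>)\<bar>}"
    note bm [measurable] = test_bilin_measurable[OF K J(1), of d W Rt p]
    have sets: "A1 \<in> sets ?P" "A2 \<in> sets ?P" "A3 \<in> sets ?P" "A4 \<in> sets ?P" "A5 \<in> sets ?P" "A6 \<in> sets ?P"
      unfolding A1_def A2_def A3_def A4_def A5_def A6_def by measurable
    have m1: "measure ?P A1 \<le> 2 * exp (- (\<kappa> / 32))"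
    proof -
      have eq: "1 / (4 * F) * (trace_d d W / 2) / 4 = \<kappa> / 32" using F by (simp add: tr)
      then show ?thesis
        unfolding A1_def using tail_noise_noise[OF d M Rt F_def F K, of p "trace_d d W / 2"] by (simp only: eq)
    qed
    have m2: "measure ?P A2 \<le> 2 * exp (- (\<kappa> / (96 * sqrt M)))"
    proof -
      have "sqrt M * sqrt M = M" by simp
      then have "sqrt M / (2 * F) * \<tau> / 4 = \<kappa> / (96 * sqrt M)"
        using F M by (simp add: \<tau>_def tr field_simps)
      then show ?thesis
        unfolding A2_def using tail_noise_sum_noise[OF d M Rt F_def F J(1) K J(2), of p \<tau>] by simp
    qed
    have m3: "measure ?P A3 \<le> 2 * exp (- (sqrt d * \<kappa> / (192 * real M * Rt\<^sup>2)))"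
    proof -
      have "sqrt d / (4 * Rt\<^sup>2 * F) * \<tau> / 4 = sqrt d * \<kappa> / (192 * real M * Rt\<^sup>2)"
        using F M Rt by (simp add: \<tau>_def tr)
      then show ?thesis
        unfolding A3_def using tail_mu_mu_uncentered[OF d M Rt F_def F, of p \<tau>] tr_pos by simp
    qed
    have e: "sqrt d / (3 * Rt * F) * \<tau> / 4 = sqrt d * \<kappa> / (144 * real M * Rt)"
      using F M Rt by (simp add: \<tau>_def tr)
    have m4: "measure ?P A4 \<le> 2 * exp (- (sqrt d * \<kappa> / (144 * real M * Rt)))"
      unfolding A4_def using tail_mu_noise[OF d M Rt F_def F K, of p \<tau>] by (simp only: e)
    have m5: "measure ?P A5 \<le> 2 * exp (- (sqrt d * \<kappa> / (144 * real M * Rt)))"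
      unfolding A5_def using tail_noise_mu[OF d M Rt F_def F K, of p \<tau>] by (simp only: e)
    have m6: "measure ?P A6 \<le> 2 * exp (- (sqrt d * \<kappa> / (144 * real M * Rt)))"
      unfolding A6_def using tail_noise_sum_mu[OF d M Rt F_def F J(1), of p \<tau>] by (simp only: e)
    have "AE \<theta> in ?P. \<theta> \<in> E k \<longrightarrow> \<theta> \<in> A1 \<union> (A2 \<union> (A3 \<union> (A4 \<union> (A5 \<union> A6))))"
      using AE_test_labels
    proof eventually_elim
      fix \<theta> :: "(nat \<Rightarrow> real) \<times> (nat \<Rightarrow> real \<times> bool \<times> (nat \<Rightarrow> real))"
    assume lab: "\<forall>i\<in>{1..M+1}. fst (snd \<theta> i) \<in> {-1, 1}"
      show "\<theta> \<in> E k \<longrightarrow> \<theta> \<in> A1 \<union> (A2 \<union> (A3 \<union> (A4 \<union> (A5 \<union> A6))))"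
      proof (rule impI, rule ccontr)
        assume err: "\<theta> \<in> E k" and "\<theta> \<notin> A1 \<union> (A2 \<union> (A3 \<union> (A4 \<union> (A5 \<union> A6))))"
        then have sp: "\<theta> \<in> space ?P" and
          n: "\<theta> \<notin> A1" "\<theta> \<notin> A2" "\<theta> \<notin> A3" "\<theta> \<notin> A4" "\<theta> \<notin> A5" "\<theta> \<notin> A6"
          by (auto simp: E_def)
        define m where "m = 1 / real M * (\<Sum>i=1..M. flip_sign (snd \<theta> i))"
        \<comment> \<open>Example k may be flipped, in which case s = -1. The sign multiplies only
          terms that are treated as noise, so wrong labels are memorised just like correct
          ones.\<close>
        define s where "s = flip_sign (snd \<theta> k)"
        define q where "q = bilin d W (test_noise (snd \<theta> k)) (test_noise (snd \<theta> k))"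
        define v where "v = bilin d W (noise_sum M ?J (snd \<theta>)) (test_noise (snd \<theta> k))"
        define a where "a = bilin d W (fst \<theta>) (fst \<theta>)"
        define b where "b = bilin d W (fst \<theta>) (test_noise (snd \<theta> k))"
        define e where "e = bilin d W (test_noise (snd \<theta> k)) (fst \<theta>)"
        define u where "u = bilin d W (noise_sum M ?J (snd \<theta>)) (fst \<theta>)"
        have m1: "\<bar>m\<bar> \<le> 1" unfolding m_def by (rule abs_flip_mean_le[OF M])
        have s1: "\<bar>s\<bar> = 1" by (simp add: s_def flip_sign_abs)
        have "\<bar>q - trace_d d W\<bar> < trace_d d W / 2" using n(1) sp by (auto simp: A1_def q_def)
        then have "q > trace_d d W / 2" by linarith
        then have "q / M > trace_d d W / 2 / M" using M by (intro divide_strict_right_mono) auto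
        then have q: "q / M > 6 * \<tau>" by (simp add: \<tau>_def)
        have v: "\<bar>v\<bar> < \<tau>" using n(2) sp by (auto simp: A2_def v_def)
        have a: "\<bar>a\<bar> < \<tau>" using n(3) sp by (auto simp: A3_def a_def)
        have b: "\<bar>b\<bar> < \<tau>" using n(4) sp by (auto simp: A4_def b_def)
        have e: "\<bar>e\<bar> < \<tau>" using n(5) sp by (auto simp: A5_def e_def)
        have u: "\<bar>u\<bar> < \<tau>" using n(6) sp by (auto simp: A6_def u_def)
        have \<tau>: "\<tau> > 0" using tr_pos M by (simp add: \<tau>_def)
        have damp: "\<bar>x * y\<bar> \<le> \<tau>" if "\<bar>x\<bar> \<le> 1" "\<bar>y\<bar> < \<tau>" for x y
        proof -
          have "\<bar>x\<bar> * \<bar>y\<bar> \<le> 1 * \<tau>" using that by (intro mult_mono) auto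
          then show ?thesis by (simp add: abs_mult)
        qed
        have t: "\<bar>m * s * a\<bar> \<le> \<tau>" "\<bar>m * b\<bar> \<le> \<tau>" "\<bar>s * u\<bar> \<le> \<tau>" "\<bar>s / M * e\<bar> \<le> \<tau>"
        proof -
          have "\<bar>m * s\<bar> \<le> 1" using m1 s1 by (simp add: abs_mult)
          then show "\<bar>m * s * a\<bar> \<le> \<tau>" using a by (rule damp)
          show "\<bar>m * b\<bar> \<le> \<tau>" using m1 b by (rule damp)
          show "\<bar>s * u\<bar> \<le> \<tau>" using s1 u by (intro damp) auto
          have "\<bar>s / M\<bar> \<le> 1" using s1 M by (simp add: abs_divide)
          then show "\<bar>s / M * e\<bar> \<le> \<tau>" using e by (rule damp)
        qed
        have "0 < m * s * a + m * b + (s / M * e + s * u) + (q / M + v)"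
          using t v q \<tau> by linarith
        moreover have "ts_y \<theta> k * yhat d M \<theta> W (ts_x \<theta> k) = m * s * a + m * b + (s / M * e + s * u) + (q / M + v)"
        proof -
          \<comment> \<open>The noise of example k occurs both in the query and, with weight 1 / M,
            in the average; pairing these two copies gives q / M.\<close>
          have sum: "noise_sum M {1..M} (snd \<theta>) = (\<lambda>j. (1 / real M) * test_noise (snd \<theta> k) j + noise_sum M ?J (snd \<theta>) j)"
          proof
            fix j
            have "(\<Sum>i=1..M. test_noise (snd \<theta> i) j) = test_noise (snd \<theta> k) j + (\<Sum>i\<in>?J. test_noise (snd \<theta> i) j)"
              using k by (intro sum.remove) auto
            then show "noise_sum M {1..M} (snd \<theta>) j = (1 / real M) * test_noise (snd \<theta> k) j + noise_sum M ?J (snd \<theta>) j"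
              unfolding noise_sum_def by (simp only: distrib_left)
          qed
          have "ts_y \<theta> k * yhat d M \<theta> W (ts_x \<theta> k) = m * s * a + m * b + s * ((1 / real M) * e + u) + ((1 / real M) * q + v)"
            using signed_prediction[OF lab[rule_format] K, of d W]
            by (simp only: m_def[symmetric] s_def[symmetric] a_def b_def e_def u_def v_def q_def bilin_mono_expand
                sum bilin_add bilin_scale)
          then show ?thesis by (simp add: distrib_left)
        qed
        moreover have "ts_y \<theta> k \<in> {-1, 1}" unfolding ts_y_eq using lab K by (auto simp: flip_sign_def)
        ultimately have "sgn (yhat d M \<theta> W (ts_x \<theta> k)) = ts_y \<theta> k"
          by (intro sgn_prediction_eq) auto
        then show False using err by (simp add: E_def)
      qed
    qed
    then have "measure ?P (E k) \<le> measure ?P (A1 \<union> (A2 \<union> (A3 \<union> (A4 \<union> (A5 \<union> A6)))))"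
      using sets by (intro P.finite_measure_mono_AE) auto
    also have "\<dots> \<le> ?bound"
      using sets by (intro measure_Un_le_add m1 m2 m3 m4 m5 m6 sets.Un)
    finally show ?thesis .
  qed
  \<comment> \<open>Union bound over the context, the origin of the factor M.\<close>
  have "measure ?P (memo_err_event d M Rt p W) \<le> (\<Sum>k\<in>{1..M}. measure ?P (E k))"
    unfolding event using E_sets by (intro P.finite_measure_subadditive_finite) auto
  also have "\<dots> \<le> (\<Sum>k\<in>{1..M}. ?bound)" by (intro sum_mono Ek)
  also have "\<dots> = M * ?bound" by simp
  finally show "measure ?P (memo_err_event d M Rt p W) \<le> M * ?bound" .
qed

section \<open>The max-margin solution\<close>

definition frob_inner :: "nat \<Rightarrow> (nat \<Rightarrow> nat \<Rightarrow> real) \<Rightarrow> (nat \<Rightarrow> nat \<Rightarrow> real) \<Rightarrow> real" where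
  "frob_inner d A B = (\<Sum>i<d. \<Sum>j<d. A i j * B i j)"

lemma frob_sq_add_scaled:
  "frob_sq d (\<lambda>i j. A i j + t * D i j) = frob_sq d A + 2 * t * frob_inner d A D + t\<^sup>2 * frob_sq d D"
  unfolding frob_sq_def frob_inner_def sum_distrib_left sum.distrib[symmetric]
  by (intro sum.cong refl) (simp add: power2_eq_square algebra_simps)

lemma frob_inner_Cauchy_Schwarz: "(frob_inner d A B)\<^sup>2 \<le> frob_sq d A * frob_sq d B"
  unfolding frob_inner_def frob_sq_def sum.cartesian_product
  using Cauchy_Schwarz_ineq_sum[of "\<lambda>(i, j). A i j" "\<lambda>(i, j). B i j" "{..<d} \<times> {..<d}"]
  by (simp add: case_prod_unfold)

lemma frob_sq_entry_le: "i < d \<Longrightarrow> j < d \<Longrightarrow> (A i j)\<^sup>2 \<le> frob_sq d A"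
proof -
  assume ij: "i < d" "j < d"
  have "(A i j)\<^sup>2 \<le> (\<Sum>j<d. (A i j)\<^sup>2)"
    using ij by (intro member_le_sum[of j "{..<d}" "\<lambda>j. (A i j)\<^sup>2"]) auto
  also have "\<dots> \<le> frob_sq d A"
    unfolding frob_sq_def using ij
    by (intro member_le_sum[of i "{..<d}" "\<lambda>i. \<Sum>j<d. (A i j)\<^sup>2"]) (auto intro: sum_nonneg)
  finally show ?thesis .
qed

lemma bilin_mat_add: "bilin d (\<lambda>i j. A i j + B i j) u v = bilin d A u v + bilin d B u v"
  by (simp add: bilin_altdef sum.distrib algebra_simps)

lemma mm_feasible_iff:
  "mm_feasible d B N \<omega> U \<longleftrightarrow> (\<forall>\<tau>\<in>{1..B}.
     bilin d U (muhat N \<omega> \<tau>) (\<lambda>j. pt_y \<omega> \<tau> (N+1) * pt_x \<omega> \<tau> (N+1) j) \<ge> 1)"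
  by (simp add: mm_feasible_def bilin_def)

lemma mm_feasible_convex:
  assumes "mm_feasible d B N \<omega> U" "mm_feasible d B N \<omega> V" "0 \<le> t" "t \<le> 1"
  shows "mm_feasible d B N \<omega> (\<lambda>i j. U i j + t * (V i j - U i j))"
  unfolding mm_feasible_iff
proof
  fix \<tau> assume \<tau>: "\<tau> \<in> {1..B}"
  let ?b = "\<lambda>U. bilin d U (muhat N \<omega> \<tau>) (\<lambda>j. pt_y \<omega> \<tau> (N+1) * pt_x \<omega> \<tau> (N+1) j)"
  have "?b (\<lambda>i j. U i j + t * (V i j - U i j)) = ?b (\<lambda>i j. (1 - t) * U i j + t * V i j)"
    by (simp add: algebra_simps)
  also have "\<dots> = (1 - t) * ?b U + t * ?b V" unfolding bilin_mat_add bilin_mat_scale ..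
  also have "\<dots> \<ge> (1 - t) * 1 + t * 1"
    using assms \<tau> unfolding mm_feasible_iff by (intro add_mono mult_left_mono) auto
  finally show "?b (\<lambda>i j. U i j + t * (V i j - U i j)) \<ge> 1" by simp
qed

text \<open>A minimising sequence is Cauchy by the parallelogram law.\<close>
lemma max_margin_exists:
  assumes ne: "mm_feasible d B N \<omega> U0"
  shows "\<exists>W. is_max_margin d B N \<omega> W"
proof -
  let ?S = "frob_sq d ` {U. mm_feasible d B N \<omega> U}"
  define m where "m = Inf ?S"
  have bdd: "bdd_below ?S" using frob_sq_nonneg by (intro bdd_belowI[of _ 0]) auto
  have m_le: "m \<le> frob_sq d U" if "mm_feasible d B N \<omega> U" for U
    unfolding m_def using that by (intro cInf_lower bdd) auto
  have "\<exists>U. mm_feasible d B N \<omega> U \<and> frob_sq d U < m + 1 / real (Suc n)" for n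
    using cInf_lessD[of ?S "m + 1 / real (Suc n)"] ne unfolding m_def by auto
  then obtain U where U: "\<And>n. mm_feasible d B N \<omega> (U n)" "\<And>n. frob_sq d (U n) < m + 1 / real (Suc n)"
    by metis
  have dist: "frob_sq d (\<lambda>i j. U n i j - U k i j) \<le> 2 / real (Suc n) + 2 / real (Suc k)" for n k
  proof -
    define D where "D i j = U k i j - U n i j" for i j
    \<comment> \<open>The midpoint of two feasible matrices is feasible, so its squared norm is at
      least m; when both endpoints are close to m this leaves little room for D.\<close>
    have "m \<le> frob_sq d (\<lambda>i j. U n i j + 1/2 * D i j)"
      unfolding D_def by (intro m_le mm_feasible_convex U) auto
    also have "\<dots> = frob_sq d (U n) + frob_inner d (U n) D + frob_sq d D / 4"
      unfolding frob_sq_add_scaled by (simp add: power2_eq_square)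
    finally have 1: "m \<le> frob_sq d (U n) + frob_inner d (U n) D + frob_sq d D / 4" .
    have "frob_sq d (U k) = frob_sq d (\<lambda>i j. U n i j + 1 * D i j)" by (simp add: D_def)
    also have "\<dots> = frob_sq d (U n) + 2 * frob_inner d (U n) D + frob_sq d D"
      unfolding frob_sq_add_scaled by simp
    finally have keq: "frob_sq d (U k) = frob_sq d (U n) + 2 * frob_inner d (U n) D + frob_sq d D" .
    have parallelogram: "D \<le> 2 * (n - m) + 2 * (k - m)"
      if "k = n + 2 * I + D" "m \<le> n + I + D / 4" for D n k I :: real
      using that by (simp add: field_simps)
    have "frob_sq d D \<le> 2 * (frob_sq d (U n) - m) + 2 * (frob_sq d (U k) - m)"
      by (rule parallelogram[OF keq 1])
    also have "\<dots> \<le> 2 / real (Suc n) + 2 / real (Suc k)" using U(2)[of n] U(2)[of k] by simp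
    finally show ?thesis by (simp add: frob_sq_def D_def power2_commute)
  qed
  have "Cauchy (\<lambda>n. U n i j)" if ij: "i < d" "j < d" for i j
  proof (rule CauchyI)
    fix e :: real assume e: "e > 0"
    obtain n0 where n0: "inverse (real (Suc n0)) < e\<^sup>2 / 4"
      using reals_Archimedean[of "e\<^sup>2 / 4"] e by auto
    show "\<exists>M. \<forall>k\<ge>M. \<forall>n\<ge>M. norm (U k i j - U n i j) < e"
    proof (intro exI[of _ n0] allI impI)
      fix k n assume kn: "k \<ge> n0" "n \<ge> n0"
      have "(U k i j - U n i j)\<^sup>2 \<le> 2 / real (Suc k) + 2 / real (Suc n)"
        using order_trans[OF frob_sq_entry_le[OF ij, of "\<lambda>i j. U k i j - U n i j"] dist] .
      also have "\<dots> \<le> 2 / real (Suc n0) + 2 / real (Suc n0)"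
        using kn by (intro add_mono divide_left_mono) auto
      also have "\<dots> < e\<^sup>2" using n0 by (simp add: inverse_eq_divide)
      finally show "norm (U k i j - U n i j) < e"
        using e by (metis abs_le_square_iff abs_of_pos not_less power2_abs real_norm_def)
    qed
  qed
  then have lim: "(\<lambda>n. U n i j) \<longlonglongrightarrow> lim (\<lambda>n. U n i j)" if "i < d" "j < d" for i j
    using that by (simp add: Cauchy_convergent_iff convergent_LIMSEQ_iff)
  \<comment> \<open>Outside the d x d block the sequence need not converge; those entries enter
    neither the constraints nor the norm.\<close>
  define W where "W i j = lim (\<lambda>n. U n i j)" for i j
  have feas: "mm_feasible d B N \<omega> W"
    unfolding mm_feasible_iff
  proof
    fix \<tau> assume \<tau>: "\<tau> \<in> {1..B}"
    let ?b = "\<lambda>U. bilin d U (muhat N \<omega> \<tau>) (\<lambda>j. pt_y \<omega> \<tau> (N+1) * pt_x \<omega> \<tau> (N+1) j)"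
    have "(\<lambda>n. ?b (U n)) \<longlonglongrightarrow> ?b W"
      unfolding bilin_altdef W_def by (intro tendsto_sum tendsto_mult tendsto_const lim) auto
    then show "?b W \<ge> 1"
      using U(1) \<tau> unfolding mm_feasible_iff by (intro LIMSEQ_le_const) auto
  qed
  have "(\<lambda>n. frob_sq d (U n)) \<longlonglongrightarrow> frob_sq d W"
    unfolding frob_sq_def W_def by (intro tendsto_sum tendsto_power lim) auto
  moreover have "(\<lambda>n. m + 1 / real (Suc n)) \<longlonglongrightarrow> m + 0"
    using LIMSEQ_inverse_real_of_nat by (intro tendsto_add tendsto_const) (simp add: inverse_eq_divide)
  ultimately have "frob_sq d W \<le> m"
    using U(2) by (intro LIMSEQ_le[of _ _ _ m]) (auto intro: less_imp_le)
  then show ?thesis unfolding is_max_margin_def using feas m_le by (meson order_trans)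
qed

text \<open>The squared norm cannot decrease along the feasible segment from W to U, so its
  derivative at W, twice the inner product of W with U - W, is non-negative.\<close>

lemma max_margin_variational:
  assumes W: "is_max_margin d B N \<omega> W" and U: "mm_feasible d B N \<omega> U"
  shows "frob_sq d W \<le> frob_inner d W U"
proof -
  define D where "D i j = U i j - W i j" for i j
  have ge: "0 \<le> 2 * frob_inner d W D + t * frob_sq d D" if t: "0 < t" "t \<le> 1" for t
  proof -
    have "frob_sq d W \<le> frob_sq d (\<lambda>i j. W i j + t * D i j)"
      using W U t mm_feasible_convex[of d B N \<omega> W U t] by (auto simp: is_max_margin_def D_def)
    also have "\<dots> = frob_sq d W + t * (2 * frob_inner d W D + t * frob_sq d D)"
      unfolding frob_sq_add_scaled by (simp add: power2_eq_square algebra_simps)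
    finally show ?thesis using t by (simp add: zero_le_mult_iff)
  qed
  have "0 \<le> frob_inner d W D"
  proof (rule ccontr)
    assume "\<not> 0 \<le> frob_inner d W D"
    define a where "a = - frob_inner d W D"
    have a: "0 < a" using \<open>\<not> 0 \<le> frob_inner d W D\<close> by (simp add: a_def)
    \<comment> \<open>Small enough for t * |D|^2 \<le> a, so that the linear term - 2 a prevails;
      the added 1 avoids a zero denominator when D vanishes.\<close>
    define t where "t = min 1 (a / (frob_sq d D + 1))"
    have D: "frob_sq d D \<ge> 0" by (rule frob_sq_nonneg)
    then have t: "0 < t" "t \<le> 1" using a by (auto simp: t_def)
    have "t * frob_sq d D \<le> a / (frob_sq d D + 1) * (frob_sq d D + 1)"
      using D a by (intro mult_mono) (auto simp: t_def)
    also have "\<dots> = a" using D by simp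
    finally show False using ge[OF t] a by (simp add: a_def)
  qed
  moreover have "frob_inner d W D = frob_inner d W U - frob_sq d W"
    by (simp add: frob_inner_def frob_sq_def D_def power2_eq_square algebra_simps sum_subtractf)
  ultimately show ?thesis by simp
qed

section \<open>Deterministic consequences of good training data\<close>

definition train_x :: "nat \<Rightarrow> (nat \<Rightarrow> (nat \<Rightarrow> real) \<times> (nat \<Rightarrow> (nat \<Rightarrow> real) \<times> real)) \<Rightarrow> nat \<Rightarrow> nat \<Rightarrow> real" where
  "train_x N \<omega> \<tau> = (\<lambda>j. pt_y \<omega> \<tau> (N+1) * pt_x \<omega> \<tau> (N+1) j)"

text \<open>Independent directions in dimension d have inner products smaller than their squared
  lengths by a factor of order sqrt d; K is the common scale of the squared lengths.\<close>

definition gram_bound :: "nat \<Rightarrow> real \<Rightarrow> nat \<Rightarrow> nat \<Rightarrow> real" where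
  "gram_bound d K \<tau> \<sigma> = (if \<tau> = \<sigma> then K else K / sqrt d)"

text \<open>The interface between probability and optimisation: what is derived about W from here on
  is deterministic. The margins make a multiple of the identity feasible, and the Gram entries limit
  the overlap of the rank-one constraint matrices.\<close>

definition good_data :: "nat \<Rightarrow> nat \<Rightarrow> nat \<Rightarrow> real \<Rightarrow> real
    \<Rightarrow> (nat \<Rightarrow> (nat \<Rightarrow> real) \<times> (nat \<Rightarrow> (nat \<Rightarrow> real) \<times> real)) \<Rightarrow> bool" where
  "good_data d B N R K \<omega> \<longleftrightarrow>
     (\<forall>\<tau>\<in>{1..B}. R\<^sup>2 / 2 \<le> inner_d d (muhat N \<omega> \<tau>) (train_x N \<omega> \<tau>)) \<and>
     (\<forall>\<tau>\<in>{1..B}. \<forall>\<sigma>\<in>{1..B}.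
        \<bar>inner_d d (muhat N \<omega> \<tau>) (muhat N \<omega> \<sigma>)\<bar> \<le> gram_bound d K \<tau> \<sigma> \<and>
        \<bar>inner_d d (train_x N \<omega> \<tau>) (train_x N \<omega> \<sigma>)\<bar> \<le> gram_bound d K \<tau> \<sigma>)"

lemma good_data_identity_feasible:
  assumes "good_data d B N R K \<omega>" "R > 0"
  shows "mm_feasible d B N \<omega> (\<lambda>i j. 2 / R\<^sup>2 * id_mat i j)"
  unfolding mm_feasible_iff bilin_mat_scale bilin_id_mat train_x_def[symmetric]
proof
  fix \<tau> assume "\<tau> \<in> {1..B}"
  then have "2 / R\<^sup>2 * (R\<^sup>2 / 2) \<le> 2 / R\<^sup>2 * inner_d d (muhat N \<omega> \<tau>) (train_x N \<omega> \<tau>)"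
    using assms by (intro mult_left_mono) (auto simp: good_data_def)
  then show "1 \<le> 2 / R\<^sup>2 * inner_d d (muhat N \<omega> \<tau>) (train_x N \<omega> \<tau>)" using assms(2) by simp
qed

text \<open>$W$ correlates with $S = \sum_\tau \hat\mu_\tau (y_\tau x_\tau)^\top$ by at least $B$, whereas near
  orthogonality of the tasks keeps $\|S\|_F^2$ of order $K^2 (B + B^2/d)$; so $\|W\|_F$ is large.\<close>
lemma good_data_frob_lower:
  assumes g: "good_data d B N R K \<omega>" and feas: "mm_feasible d B N \<omega> W"
    and d: "d > 0" and B: "B \<ge> 1" and K: "K > 0" and \<beta>: "0 < \<beta>" "\<beta> \<le> 1" "\<beta> * d \<le> B"
  shows "\<beta> * d / (2 * K\<^sup>2) \<le> frob_sq d W"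
proof -
  let ?u = "muhat N \<omega>" and ?x = "train_x N \<omega>"
  define S where "S i j = (\<Sum>\<tau>=1..B. ?u \<tau> i * ?x \<tau> j)" for i j
  have WS: "frob_inner d W S = (\<Sum>\<tau>=1..B. bilin d W (?u \<tau>) (?x \<tau>))"
  proof -
    have "frob_inner d W S = (\<Sum>i<d. \<Sum>j<d. \<Sum>\<tau>=1..B. W i j * ?u \<tau> i * ?x \<tau> j)"
      by (simp add: frob_inner_def S_def sum_distrib_left mult.assoc)
    also have "\<dots> = (\<Sum>i<d. \<Sum>\<tau>=1..B. \<Sum>j<d. W i j * ?u \<tau> i * ?x \<tau> j)"
      by (intro sum.cong refl sum.swap)
    also have "\<dots> = (\<Sum>\<tau>=1..B. \<Sum>i<d. \<Sum>j<d. W i j * ?u \<tau> i * ?x \<tau> j)" by (rule sum.swap)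
    finally show ?thesis by (simp add: bilin_altdef)
  qed
  have "(\<Sum>\<tau>=1..B. 1) \<le> (\<Sum>\<tau>=1..B. bilin d W (?u \<tau>) (?x \<tau>))"
    using feas unfolding mm_feasible_iff train_x_def[symmetric] by (intro sum_mono) auto
  then have BWS: "real B \<le> frob_inner d W S" by (simp add: WS)
  \<comment> \<open>The squared norm of a sum of rank-one matrices is the sum of the entrywise
    products of two Gram matrices, hence small when both are nearly diagonal.\<close>
  have S: "frob_sq d S = (\<Sum>\<tau>=1..B. \<Sum>\<sigma>=1..B. inner_d d (?u \<tau>) (?u \<sigma>) * inner_d d (?x \<tau>) (?x \<sigma>))"
  proof -
    have "frob_sq d S = (\<Sum>i<d. \<Sum>j<d. \<Sum>\<tau>=1..B. \<Sum>\<sigma>=1..B. (?u \<tau> i * ?u \<sigma> i) * (?x \<tau> j * ?x \<sigma> j))"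
      by (simp add: frob_sq_def S_def power2_eq_square sum_product mult_ac)
    also have "\<dots> = (\<Sum>i<d. \<Sum>\<tau>=1..B. \<Sum>j<d. \<Sum>\<sigma>=1..B. (?u \<tau> i * ?u \<sigma> i) * (?x \<tau> j * ?x \<sigma> j))"
      by (intro sum.cong refl sum.swap)
    also have "\<dots> = (\<Sum>\<tau>=1..B. \<Sum>i<d. \<Sum>j<d. \<Sum>\<sigma>=1..B. (?u \<tau> i * ?u \<sigma> i) * (?x \<tau> j * ?x \<sigma> j))"
      by (rule sum.swap)
    also have "\<dots> = (\<Sum>\<tau>=1..B. \<Sum>i<d. \<Sum>\<sigma>=1..B. \<Sum>j<d. (?u \<tau> i * ?u \<sigma> i) * (?x \<tau> j * ?x \<sigma> j))"
      by (intro sum.cong refl sum.swap)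
    also have "\<dots> = (\<Sum>\<tau>=1..B. \<Sum>\<sigma>=1..B. \<Sum>i<d. \<Sum>j<d. (?u \<tau> i * ?u \<sigma> i) * (?x \<tau> j * ?x \<sigma> j))"
      by (intro sum.cong refl sum.swap)
    finally show ?thesis by (simp add: inner_d_def sum_product)
  qed
  have gb: "gram_bound d K \<tau> \<sigma> \<ge> 0" for \<tau> \<sigma> using K by (simp add: gram_bound_def)
  have "frob_sq d S \<le> (\<Sum>\<tau>=1..B. \<Sum>\<sigma>=1..B. (gram_bound d K \<tau> \<sigma>)\<^sup>2)"
    unfolding S
  proof (intro sum_mono)
    fix \<tau> \<sigma> assume ts: "\<tau> \<in> {1..B}" "\<sigma> \<in> {1..B}"
    have "inner_d d (?u \<tau>) (?u \<sigma>) * inner_d d (?x \<tau>) (?x \<sigma>)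
      \<le> \<bar>inner_d d (?u \<tau>) (?u \<sigma>)\<bar> * \<bar>inner_d d (?x \<tau>) (?x \<sigma>)\<bar>"
      by (metis abs_ge_self abs_mult)
    also have "\<dots> \<le> gram_bound d K \<tau> \<sigma> * gram_bound d K \<tau> \<sigma>"
      using g ts gb unfolding good_data_def by (intro mult_mono) auto
    finally show "inner_d d (?u \<tau>) (?u \<sigma>) * inner_d d (?x \<tau>) (?x \<sigma>) \<le> (gram_bound d K \<tau> \<sigma>)\<^sup>2"
      by (simp add: power2_eq_square)
  qed
  also have "\<dots> \<le> (\<Sum>\<tau>=1..B. \<Sum>\<sigma>=1..B. (if \<tau> = \<sigma> then K\<^sup>2 else 0) + K\<^sup>2 / d)"
    using d by (intro sum_mono) (auto simp: gram_bound_def power_divide)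
  also have "\<dots> = B * K\<^sup>2 + (real B)\<^sup>2 * (K\<^sup>2 / d)"
    by (simp add: sum.distrib power2_eq_square distrib_left)
  finally have S_le: "frob_sq d S \<le> B * K\<^sup>2 + (real B)\<^sup>2 * (K\<^sup>2 / d)" .
  have "(real B)\<^sup>2 \<le> (frob_inner d W S)\<^sup>2" using BWS by (intro power_mono) auto
  also have "\<dots> \<le> frob_sq d W * frob_sq d S" by (rule frob_inner_Cauchy_Schwarz)
  also have "\<dots> \<le> frob_sq d W * (B * K\<^sup>2 + (real B)\<^sup>2 * (K\<^sup>2 / d))"
    by (intro mult_left_mono S_le frob_sq_nonneg)
  also have "\<dots> \<le> frob_sq d W * ((real B)\<^sup>2 * (2 * K\<^sup>2 / (\<beta> * d)))"
  proof (intro mult_left_mono frob_sq_nonneg)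
    \<comment> \<open>Both contributions are at most B^2 K^2 / (\<beta> d): the diagonal one by
      \<beta> d \<le> B, the other by \<beta> \<le> 1.\<close>
    have "real B * (\<beta> * d) \<le> real B * B" using \<beta>(3) by (intro mult_left_mono) auto
    then have "real B \<le> (real B)\<^sup>2 / (\<beta> * d)"
      using \<beta>(1) d by (simp add: pos_le_divide_eq power2_eq_square)
    then have 1: "real B * K\<^sup>2 \<le> (real B)\<^sup>2 / (\<beta> * d) * K\<^sup>2" by (intro mult_right_mono) auto
    have "K\<^sup>2 / d \<le> K\<^sup>2 / (\<beta> * d)" using \<beta> d by (intro divide_left_mono) auto
    then have 2: "(real B)\<^sup>2 * (K\<^sup>2 / d) \<le> (real B)\<^sup>2 * (K\<^sup>2 / (\<beta> * d))" by (intro mult_left_mono) auto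
    have "(real B)\<^sup>2 * (2 * K\<^sup>2 / (\<beta> * d)) = (real B)\<^sup>2 / (\<beta> * d) * K\<^sup>2 + (real B)\<^sup>2 * (K\<^sup>2 / (\<beta> * d))"
      by simp
    then show "B * K\<^sup>2 + (real B)\<^sup>2 * (K\<^sup>2 / d) \<le> (real B)\<^sup>2 * (2 * K\<^sup>2 / (\<beta> * d))"
      using 1 2 by linarith
  qed
  finally have "(real B)\<^sup>2 * 1 \<le> (real B)\<^sup>2 * (frob_sq d W * (2 * K\<^sup>2 / (\<beta> * d)))"
    by (simp add: mult_ac)
  then have "1 \<le> frob_sq d W * (2 * K\<^sup>2 / (\<beta> * d))"
    using B by (subst (asm) mult_le_cancel_left_pos) auto
  then have "1 \<le> (frob_sq d W * (2 * K\<^sup>2)) / (\<beta> * d)" by (simp only: times_divide_eq_right)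
  moreover have "0 < \<beta> * d" using \<beta>(1) d by simp
  ultimately have "1 * (\<beta> * d) \<le> frob_sq d W * (2 * K\<^sup>2)" by (simp only: pos_le_divide_eq)
  moreover have "0 < 2 * K\<^sup>2" using K by simp
  ultimately show ?thesis by (metis pos_divide_le_eq mult_1)
qed

text \<open>Optimality of $W$ against the feasible multiple $2R^{-2} I$ of the identity bounds
  $\mathrm{tr} W$ from below by $\|W\|_F^2$, without any Lagrange multipliers.\<close>
lemma good_data_max_margin:
  assumes g: "good_data d B N R (K * R\<^sup>2 * L) \<omega>" and W: "is_max_margin d B N \<omega> W"
    and d: "d > 0" and B: "B \<ge> 1" and R: "R > 0" and K: "K > 0" and L: "L \<ge> 1/2"
    and \<beta>: "0 < \<beta>" "\<beta> \<le> 1" "\<beta> * d \<le> B"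
  shows "sqrt (frob_sq d W) > 0"
    and "\<beta> / L\<^sup>2 * sqrt d / (6 * K) \<le> trace_d d W / sqrt (frob_sq d W)"
proof -
  define F where "F = sqrt (frob_sq d W)"
  define \<rho> where "\<rho> = \<beta> / L\<^sup>2"
  have L2: "L\<^sup>2 \<ge> 1/4" using power_mono[OF L, of 2] by (simp add: power2_eq_square)
  have L0: "L > 0" using L by simp
  have \<rho>: "\<rho> > 0" using \<beta> L0 by (simp add: \<rho>_def)
  have "\<beta> * 1 \<le> 1 * (4 * L\<^sup>2)" using \<beta> L2 by (intro mult_mono) auto
  \<comment> \<open>A consequence of L \<ge> 1/2; it serves to pass from sqrt \<rho> to \<rho> / 2
    at the end.\<close>
  then have \<rho>4: "\<rho> \<le> 4" using L0 by (simp add: \<rho>_def pos_divide_le_eq)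
  have feas: "mm_feasible d B N \<omega> W" using W by (simp add: is_max_margin_def)
  have KL: "K * R\<^sup>2 * L > 0" using K R L0 by simp
  have F_sq: "F\<^sup>2 = frob_sq d W" using frob_sq_nonneg[of d W] by (simp add: F_def)
  have "\<rho> * d / (2 * (K * R\<^sup>2)\<^sup>2) = (\<beta> * d) / (L\<^sup>2 * (2 * (K * R\<^sup>2)\<^sup>2))"
    by (simp only: \<rho>_def times_divide_eq_left divide_divide_eq_left)
  also have "L\<^sup>2 * (2 * (K * R\<^sup>2)\<^sup>2) = 2 * (K * R\<^sup>2 * L)\<^sup>2"
    by (simp only: power_mult_distrib mult_ac)
  also have "\<beta> * d / \<dots> \<le> F\<^sup>2"
    unfolding F_sq by (rule good_data_frob_lower[OF g feas d B KL \<beta>])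
  finally have lower: "\<rho> * d / (2 * (K * R\<^sup>2)\<^sup>2) \<le> F\<^sup>2" .
  have "0 < \<rho> * d / (2 * (K * R\<^sup>2)\<^sup>2)" using \<rho> d K R by simp
  then have "0 < F\<^sup>2" using lower by linarith
  moreover have "F \<ge> 0" by (simp add: F_def frob_sq_nonneg)
  ultimately have F: "F > 0" by (simp add: zero_less_power2 less_le)
  then show "sqrt (frob_sq d W) > 0" by (simp add: F_def)
  have "frob_inner d W (\<lambda>i j. 2 / R\<^sup>2 * id_mat i j) = 2 / R\<^sup>2 * trace_d d W"
  proof -
    have "frob_inner d W (\<lambda>i j. 2 / R\<^sup>2 * id_mat i j) = (\<Sum>i<d. \<Sum>j<d. if i = j then 2 / R\<^sup>2 * W i j else 0)"
      unfolding frob_inner_def by (intro sum.cong refl) (simp add: id_mat_def)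
    then show ?thesis by (simp add: trace_d_def sum_distrib_left)
  qed
  then have "F\<^sup>2 \<le> 2 / R\<^sup>2 * trace_d d W"
    using max_margin_variational[OF W good_data_identity_feasible[OF g R]] by (simp only: F_sq)
  then have "R\<^sup>2 / 2 * F\<^sup>2 \<le> R\<^sup>2 / 2 * (2 / R\<^sup>2 * trace_d d W)" by (intro mult_left_mono) auto
  also have "\<dots> = trace_d d W" using R by simp
  finally have "R\<^sup>2 / 2 * F * F \<le> trace_d d W" by (simp only: power2_eq_square mult.assoc)
  then have tr: "R\<^sup>2 / 2 * F \<le> trace_d d W / F" using F by (simp only: pos_le_divide_eq)
  have sq: "(sqrt \<rho> * sqrt d / (sqrt 2 * (K * R\<^sup>2)))\<^sup>2 = \<rho> * d / (2 * (K * R\<^sup>2)\<^sup>2)"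
    using \<rho> by (simp add: power_divide power_mult_distrib)
  have "sqrt \<rho> * sqrt d / (sqrt 2 * (K * R\<^sup>2)) \<le> F"
  proof (rule power2_le_imp_le)
    show "(sqrt \<rho> * sqrt d / (sqrt 2 * (K * R\<^sup>2)))\<^sup>2 \<le> F\<^sup>2" unfolding sq by (rule lower)
  qed (use F in simp)
  then have "R\<^sup>2 / 2 * (sqrt \<rho> * sqrt d / (sqrt 2 * (K * R\<^sup>2))) \<le> R\<^sup>2 / 2 * F"
    by (intro mult_left_mono) auto
  \<comment> \<open>R cancels: the lower bound for F decays like 1 / R^2 and the trace inequality
    regains R^2, so the ratio does not depend on the signal strength in training.\<close>
  also have "R\<^sup>2 / 2 * (sqrt \<rho> * sqrt d / (sqrt 2 * (K * R\<^sup>2))) = sqrt \<rho> * sqrt d / (2 * sqrt 2 * K)"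
  proof -
    have "r / 2 * (a / (s * (K * r))) = a / (2 * s * K)" if "r \<noteq> 0" for a r s :: real
      using that by simp
    from this[of "R\<^sup>2"] show ?thesis using R by simp
  qed
  finally have 1: "sqrt \<rho> * sqrt d / (2 * sqrt 2 * K) \<le> trace_d d W / F" using tr by linarith
  have "sqrt \<rho> \<le> 2" using \<rho>4 by (intro real_le_lsqrt) auto
  then have "sqrt \<rho> * sqrt \<rho> \<le> 2 * sqrt \<rho>" using \<rho> by (intro mult_right_mono) auto
  then have r: "\<rho> / 2 \<le> sqrt \<rho>" using \<rho> by simp
  \<comment> \<open>Together with \<rho> / 2 \<le> sqrt \<rho> this turns the denominator 2 sqrt 2 K
    into 6 K.\<close>
  have "sqrt 2 \<le> 3/2" by (intro real_le_lsqrt) (auto simp: power2_eq_square)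
  then have "2 * sqrt 2 * K \<le> 3 * K" using K by simp
  then have "\<rho> / 2 * sqrt d / (3 * K) \<le> sqrt \<rho> * sqrt d / (2 * sqrt 2 * K)"
    using r K \<rho> by (intro frac_le mult_right_mono) auto
  also note 1
  finally show "\<beta> / L\<^sup>2 * sqrt d / (6 * K) \<le> trace_d d W / sqrt (frob_sq d W)"
    by (simp add: \<rho>_def F_def)
qed

section \<open>Training data\<close>

definition train_example :: "nat \<Rightarrow> ((nat \<Rightarrow> real) \<times> real) measure" where
  "train_example d = gauss d \<Otimes>\<^sub>M rad"

definition train_noise :: "(nat \<Rightarrow> real) \<times> real \<Rightarrow> nat \<Rightarrow> real" where
  "train_noise q = (\<lambda>j. snd q * fst q j)"

definition task :: "nat \<Rightarrow> nat \<Rightarrow> real \<Rightarrow> ((nat \<Rightarrow> real) \<times> (nat \<Rightarrow> (nat \<Rightarrow> real) \<times> real)) measure" where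
  "task d N R = unif_sphere d R \<Otimes>\<^sub>M PiM {1..N+1} (\<lambda>_. train_example d)"

text \<open>The estimate as a function of one task alone, so that tasks become the coordinates of a
  product measure and distinct tasks are visibly independent.\<close>

definition task_muhat :: "nat \<Rightarrow> (nat \<Rightarrow> real) \<times> (nat \<Rightarrow> (nat \<Rightarrow> real) \<times> real) \<Rightarrow> nat \<Rightarrow> real" where
  "task_muhat N t = (\<lambda>j. (1 / real N) * (\<Sum>i=1..N. snd (snd t i) * (snd (snd t i) * fst t j + fst (snd t i) j)))"

definition task_x :: "nat \<Rightarrow> (nat \<Rightarrow> real) \<times> (nat \<Rightarrow> (nat \<Rightarrow> real) \<times> real) \<Rightarrow> nat \<Rightarrow> real" where
  "task_x N t = (\<lambda>j. snd (snd t (N+1)) * (snd (snd t (N+1)) * fst t j + fst (snd t (N+1)) j))"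

lemma pretrain_eq: "pretrain d B N R = PiM {1..B} (\<lambda>_. task d N R)"
  by (simp add: pretrain_def task_def train_example_def)

lemma muhat_eq: "muhat N \<omega> \<tau> = task_muhat N (\<omega> \<tau>)"
  by (simp add: muhat_def task_muhat_def pt_x_def pt_y_def pt_mu_def)

lemma train_x_eq: "train_x N \<omega> \<tau> = task_x N (\<omega> \<tau>)"
  by (simp add: train_x_def task_x_def pt_x_def pt_y_def pt_mu_def)

lemma prob_space_train_example: "prob_space (train_example d)"
  unfolding train_example_def by (intro prob_space_pair prob_space_gauss prob_space_rad)

lemma prob_space_train_PiM: "prob_space (PiM I (\<lambda>_. train_example d))"
  by (intro prob_space_PiM prob_space_train_example)

lemma prob_space_task: "prob_space (task d N R)"
  unfolding task_def by (intro prob_space_pair prob_space_unif_sphere prob_space_train_PiM)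

lemma train_label_measurable: "snd \<in> borel_measurable (train_example d)"
  unfolding train_example_def by (rule measurable_compose[OF measurable_snd rad_borel_measurable])

lemma train_gauss_measurable: "j < d \<Longrightarrow> (\<lambda>q. fst q j) \<in> borel_measurable (train_example d)"
  unfolding train_example_def
  by (rule measurable_compose[OF measurable_fst measurable_gauss_component])

lemma train_noise_measurable: "j < d \<Longrightarrow> (\<lambda>q. train_noise q j) \<in> borel_measurable (train_example d)"
  unfolding train_noise_def by (intro borel_measurable_times train_label_measurable train_gauss_measurable)

text \<open>Given its label, the noise is z or -z, and both have the Gaussian moment generating
  function.\<close>

lemma subgauss_train_noise: "subgauss d (train_example d) train_noise 1 1"
  unfolding subgauss_def
proof (intro conjI allI impI prob_space_train_example train_noise_measurable)
  fix a
  interpret G: prob_space "gauss d" by (rule prob_space_gauss)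
  interpret R: prob_space rad by (rule prob_space_rad)
  interpret GR: pair_sigma_finite "gauss d" rad ..
  have "(\<lambda>q. inner_d d a (train_noise q)) \<in> borel_measurable (train_example d)"
    by (intro inner_d_measurable train_noise_measurable) auto
  then have m: "(\<lambda>q. ennreal (exp (inner_d d a (train_noise q)))) \<in> borel_measurable (gauss d \<Otimes>\<^sub>M rad)"
    unfolding train_example_def by measurable
  have "(\<integral>\<^sup>+q. ennreal (exp (inner_d d a (train_noise q))) \<partial>train_example d)
    = (\<integral>\<^sup>+y. \<integral>\<^sup>+z. ennreal (exp (inner_d d a (train_noise (z, y)))) \<partial>gauss d \<partial>rad)"
    unfolding train_example_def by (rule GR.nn_integral_snd[OF m, symmetric])
  also have "\<dots> = (\<integral>\<^sup>+y. ennreal (exp (inner_d d a a / 2)) \<partial>rad)"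
  proof (rule nn_integral_cong_AE)
    show "AE y in rad. (\<integral>\<^sup>+z. ennreal (exp (inner_d d a (train_noise (z, y)))) \<partial>gauss d) = ennreal (exp (inner_d d a a / 2))"
      using AE_rad
    proof eventually_elim
      fix y :: real assume y: "y \<in> {-1, 1}"
      have "(\<integral>\<^sup>+z. ennreal (exp (inner_d d a (train_noise (z, y)))) \<partial>gauss d)
        = (\<integral>\<^sup>+z. ennreal (exp (inner_d d (\<lambda>j. y * a j) z)) \<partial>gauss d)"
        by (simp only: train_noise_def fst_conv snd_conv inner_d_scale inner_d_scale2)
      also have "\<dots> = ennreal (exp (y\<^sup>2 * inner_d d a a / 2))"
        unfolding gauss_mgf by (subst inner_d_scale, subst inner_d_scale2) (simp add: power2_eq_square)
      finally show "(\<integral>\<^sup>+z. ennreal (exp (inner_d d a (train_noise (z, y)))) \<partial>gauss d) = ennreal (exp (inner_d d a a / 2))"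
        using y by auto
    qed
  qed
  finally show "(\<integral>\<^sup>+q. ennreal (exp (inner_d d a (train_noise q))) \<partial>train_example d)
      \<le> ennreal (1 * exp (1 * inner_d d a a / 2))" by (simp add: R.emeasure_space_1)
qed

lemma AE_task:
  assumes "d > 0"
  shows "AE t in task d N R. (\<forall>i\<in>{1..N+1}. snd (snd t i) \<in> {-1, 1}) \<and> inner_d d (fst t) (fst t) = R\<^sup>2"
proof -
  have "AE q in train_example d. snd q \<in> {-1, 1}"
    unfolding train_example_def by (rule AE_pair_snd[OF prob_space_gauss prob_space_rad AE_rad])
  then have "AE f in PiM {1..N+1} (\<lambda>_. train_example d). snd (f i) \<in> {-1, 1}" if "i \<in> {1..N+1}" for i
    using that by (intro AE_PiM_component prob_space_train_example)
  then have "AE f in PiM {1..N+1} (\<lambda>_. train_example d). \<forall>i\<in>{1..N+1}. snd (f i) \<in> {-1, 1}"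
    by (intro AE_finite_allI) auto
  then have 1: "AE t in task d N R. \<forall>i\<in>{1..N+1}. snd (snd t i) \<in> {-1, 1}"
    unfolding task_def by (rule AE_pair_snd[OF prob_space_unif_sphere prob_space_train_PiM])
  have 2: "AE t in task d N R. inner_d d (fst t) (fst t) = R\<^sup>2"
    unfolding task_def by (rule AE_pair_fst[OF prob_space_train_PiM AE_unif_sphere_norm[OF assms]])
  from 1 2 show ?thesis by eventually_elim simp
qed

definition mean_noise :: "nat \<Rightarrow> (nat \<Rightarrow> (nat \<Rightarrow> real) \<times> real) \<Rightarrow> nat \<Rightarrow> real" where
  "mean_noise N f = (\<lambda>j. (1 / real N) * (\<Sum>i\<in>{1..N}. train_noise (f i) j))"

lemma task_decomposition:
  fixes t :: "(nat \<Rightarrow> real) \<times> (nat \<Rightarrow> (nat \<Rightarrow> real) \<times> real)"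
  assumes lab: "\<And>i. i \<in> {1..N+1} \<Longrightarrow> snd (snd t i) \<in> {-1, 1}" and N: "N \<ge> 1"
  shows "task_muhat N t = (\<lambda>j. fst t j + mean_noise N (snd t) j)"
    "task_x N t = (\<lambda>j. fst t j + train_noise (snd t (N+1)) j)"
proof -
  have yx: "snd (snd t i) * (snd (snd t i) * fst t j + fst (snd t i) j) = fst t j + train_noise (snd t i) j"
    if "i \<in> {1..N+1}" for i j
  proof -
    have "snd (snd t i) * snd (snd t i) = 1" using lab[OF that] by auto
    then show ?thesis
      unfolding train_noise_def distrib_left mult.assoc[symmetric] by simp
  qed
  show "task_x N t = (\<lambda>j. fst t j + train_noise (snd t (N+1)) j)"
    unfolding task_x_def by (intro ext yx) auto
  show "task_muhat N t = (\<lambda>j. fst t j + mean_noise N (snd t) j)"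
  proof
    fix j
    have "(\<Sum>i=1..N. snd (snd t i) * (snd (snd t i) * fst t j + fst (snd t i) j))
      = (\<Sum>i=1..N. fst t j + train_noise (snd t i) j)"
      by (intro sum.cong refl yx) auto
    also have "\<dots> = N * fst t j + (\<Sum>i=1..N. train_noise (snd t i) j)" by (simp add: sum.distrib)
    finally show "task_muhat N t j = fst t j + mean_noise N (snd t) j"
      using N unfolding task_muhat_def mean_noise_def by (simp add: add_divide_distrib)
  qed
qed

text \<open>The splitting of task statistics into centre plus noise is valid where the labels are 1
  or -1, that is, almost everywhere; moment bounds do not see the difference.\<close>

lemma subgauss_cong_AE:
  assumes S: "subgauss d P u K v" and m: "\<And>i. i < d \<Longrightarrow> (\<lambda>w. u' w i) \<in> borel_measurable P"
    and ae: "AE w in P. u' w = u w"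
  shows "subgauss d P u' K v"
  unfolding subgauss_def
proof (intro conjI allI impI m)
  show "prob_space P" by (rule subgauss_prob_space[OF S])
  fix a
  have "(\<integral>\<^sup>+w. ennreal (exp (inner_d d a (u' w))) \<partial>P) = (\<integral>\<^sup>+w. ennreal (exp (inner_d d a (u w))) \<partial>P)"
    using ae by (intro nn_integral_cong_AE) auto
  then show "(\<integral>\<^sup>+w. ennreal (exp (inner_d d a (u' w))) \<partial>P) \<le> ennreal (K * exp (v * inner_d d a a / 2))"
    using subgaussD[OF S] by simp
qed

lemma task_coord_measurable:
  "j < d \<Longrightarrow> (\<lambda>t. fst t j) \<in> borel_measurable (task d N R)"
  "i \<in> {1..N+1} \<Longrightarrow> h \<in> borel_measurable (train_example d) \<Longrightarrow> (\<lambda>t. h (snd t i)) \<in> borel_measurable (task d N R)"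
proof -
  show "(\<lambda>t. fst t j) \<in> borel_measurable (task d N R)" if "j < d"
    unfolding task_def by (rule measurable_compose[OF measurable_fst measurable_unif_sphere_component[OF that]])
  show "(\<lambda>t. h (snd t i)) \<in> borel_measurable (task d N R)"
    if "i \<in> {1..N+1}" "h \<in> borel_measurable (train_example d)"
    unfolding task_def by (rule measurable_compose[OF measurable_snd measurable_PiM_coord[OF that]])
qed

lemma task_measurable:
  assumes "j < d"
  shows "(\<lambda>t. task_muhat N t j) \<in> borel_measurable (task d N R)"
    "(\<lambda>t. task_x N t j) \<in> borel_measurable (task d N R)"
proof -
  have yx: "(\<lambda>t. snd (snd t i) * (snd (snd t i) * fst t j + fst (snd t i) j)) \<in> borel_measurable (task d N R)"
    if "i \<in> {1..N+1}" for i
    using that assms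
    by (intro borel_measurable_times borel_measurable_add task_coord_measurable(1)
        task_coord_measurable(2)[of i N snd] task_coord_measurable(2)[of i N "\<lambda>q. fst q j"]
        train_label_measurable train_gauss_measurable)
  show "(\<lambda>t. task_x N t j) \<in> borel_measurable (task d N R)"
    unfolding task_x_def by (rule yx) auto
  show "(\<lambda>t. task_muhat N t j) \<in> borel_measurable (task d N R)"
    unfolding task_muhat_def by (intro borel_measurable_times borel_measurable_const borel_measurable_sum yx) auto
qed

lemma subgauss_train_coord:
  fixes k N :: nat
  assumes "k \<in> {1..N+1}"
  shows "subgauss d (PiM {1..N+1} (\<lambda>_. train_example d)) (\<lambda>f. train_noise (f k)) 1 1"
  using subgauss_PiM_sum[OF subgauss_train_noise, of "{1..N+1}" "{k}" d 1] assms by simp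

lemma subgauss_mean_noise:
  assumes N: "N \<ge> 1"
  shows "subgauss d (PiM {1..N+1} (\<lambda>_. train_example d)) (mean_noise N) 1 1"
proof -
  have "subgauss d (PiM {1..N+1} (\<lambda>_. train_example d)) (mean_noise N) 1 ((1 / real N)\<^sup>2 * card {1..N})"
    unfolding mean_noise_def by (intro subgauss_PiM_sum[OF subgauss_train_noise]) auto
  moreover have "(1 / real N)\<^sup>2 * card {1..N} \<le> 1"
    using N by (simp add: power2_eq_square)
  ultimately show ?thesis by (rule subgauss_mono) simp
qed

text \<open>R^2 \<ge> d makes the noise proxy 1 at most R^2 / d, so it adds to the 2 R^2 / d of the
  sphere without exceeding 3 R^2 / d. The prefactor 2 is that of the sphere.\<close>

lemma subgauss_task:
  assumes d: "d > 0" and N: "N \<ge> 1" and R: "R > 0" "R\<^sup>2 \<ge> d"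
  shows "subgauss d (task d N R) (task_muhat N) 2 (3 * R\<^sup>2 / d)"
    "subgauss d (task d N R) (task_x N) 2 (3 * R\<^sup>2 / d)"
proof -
  have "1 \<le> R\<^sup>2 / d" using R(2) d by simp
  then have v: "2 * R\<^sup>2 / d + 1 \<le> 3 * R\<^sup>2 / d" by (simp add: add_divide_distrib[symmetric])
  have K: "subgauss d (task d N R) (\<lambda>t j. fst t j + mean_noise N (snd t) j) 2 (3 * R\<^sup>2 / d)"
    "subgauss d (task d N R) (\<lambda>t j. fst t j + train_noise (snd t (N+1)) j) 2 (3 * R\<^sup>2 / d)"
    using subgauss_mono[OF subgauss_pair_add[OF subgauss_unif_sphere[OF d R(1)] subgauss_mean_noise[OF N]] v]
      subgauss_mono[OF subgauss_pair_add[OF subgauss_unif_sphere[OF d R(1)] subgauss_train_coord[of "N+1"]] v]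
    unfolding task_def by simp_all
  have ae: "AE t in task d N R. task_muhat N t = (\<lambda>j. fst t j + mean_noise N (snd t) j)"
    "AE t in task d N R. task_x N t = (\<lambda>j. fst t j + train_noise (snd t (N+1)) j)"
    using AE_task[OF d, of N R] task_decomposition[OF _ N] by (auto elim!: eventually_mono)
  show "subgauss d (task d N R) (task_muhat N) 2 (3 * R\<^sup>2 / d)"
    by (rule subgauss_cong_AE[OF K(1) task_measurable(1) ae(1)])
  show "subgauss d (task d N R) (task_x N) 2 (3 * R\<^sup>2 / d)"
    by (rule subgauss_cong_AE[OF K(2) task_measurable(2) ae(2)])
qed

text \<open>Given the centre, the inner product has proxy |\<mu>|^2 = R^2, and 1/8 is the optimal
  Chernoff parameter for the level R^2 / 8, with exponent R^2 / 128 - R^2 / 64. One side suffices,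
  for only a low margin does harm.\<close>

lemma sphere_inner_tail:
  assumes S: "subgauss d P u 1 1" and d: "d > 0"
  shows "measure (unif_sphere d R \<Otimes>\<^sub>M P) {w\<in>space (unif_sphere d R \<Otimes>\<^sub>M P). R\<^sup>2 / 8 \<le> - inner_d d (fst w) (u (snd w))}
    \<le> exp (- (R\<^sup>2 / 128))"
proof -
  let ?U = "unif_sphere d R"
  note P = subgauss_prob_space[OF S] and m = subgauss_measurable[OF S]
  interpret U: prob_space ?U by (rule prob_space_unif_sphere)
  have im [measurable]: "(\<lambda>w. inner_d d (fst w) (u (snd w))) \<in> borel_measurable (?U \<Otimes>\<^sub>M P)"
    by (intro inner_d_measurable measurable_compose[OF measurable_fst measurable_unif_sphere_component]
        measurable_compose[OF measurable_snd m])
  have "(\<integral>\<^sup>+w. ennreal (exp (- (1/8) * inner_d d (fst w) (u (snd w)))) \<partial>(?U \<Otimes>\<^sub>M P))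
    = (\<integral>\<^sup>+x. \<integral>\<^sup>+y. ennreal (exp (inner_d d (\<lambda>i. - (1/8) * x i) (u y))) \<partial>P \<partial>?U)"
    unfolding inner_d_scale by (subst nn_integral_pair_iterated[OF P]) auto
  also have "\<dots> \<le> (\<integral>\<^sup>+x. ennreal (1 * exp (1 * inner_d d (\<lambda>i. - (1/8) * x i) (\<lambda>i. - (1/8) * x i) / 2)) \<partial>?U)"
    by (intro nn_integral_mono subgaussD[OF S])
  also have "\<dots> = (\<integral>\<^sup>+x. ennreal (exp (R\<^sup>2 / 128)) \<partial>?U)"
    unfolding inner_d_scale inner_d_scale2
    using AE_unif_sphere_norm[OF d, of R] by (intro nn_integral_cong_AE) auto
  also have "\<dots> = ennreal (exp (R\<^sup>2 / 128))" by (simp add: U.emeasure_space_1)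
  finally have "(\<integral>\<^sup>+w. ennreal (exp (- (1/8) * inner_d d (fst w) (u (snd w)))) \<partial>(?U \<Otimes>\<^sub>M P)) \<le> ennreal (exp (R\<^sup>2 / 128))" .
  then have "measure (?U \<Otimes>\<^sub>M P) {w\<in>space (?U \<Otimes>\<^sub>M P). R\<^sup>2 / 64 \<le> - (1/8) * inner_d d (fst w) (u (snd w))}
    \<le> exp (R\<^sup>2 / 128) * exp (- (R\<^sup>2 / 64))"
    by (intro exp_tail_bound prob_space_pair prob_space_unif_sphere P) auto
  also have "exp (R\<^sup>2 / 128) * exp (- (R\<^sup>2 / 64)) = exp (- (R\<^sup>2 / 128))"
    by (simp add: exp_add[symmetric])
  also have "{w\<in>space (?U \<Otimes>\<^sub>M P). R\<^sup>2 / 64 \<le> - (1/8) * inner_d d (fst w) (u (snd w))}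
    = {w\<in>space (?U \<Otimes>\<^sub>M P). R\<^sup>2 / 8 \<le> - inner_d d (fst w) (u (snd w))}" by auto
  finally show ?thesis .
qed

text \<open>The margin is R^2 plus three cross terms; if none falls below - R^2 / 8, at least 5 R^2
  / 8 is left. The two noise vectors are independent because the query has index N + 1, and sqrt d
  in their exponent is the Frobenius norm of the identity.\<close>

lemma task_margin_tail:
  assumes d: "d > 0" and N: "N \<ge> 1"
  shows "measure (task d N R) {t\<in>space (task d N R). inner_d d (task_muhat N t) (task_x N t) < R\<^sup>2 / 2}
    \<le> exp (- (R\<^sup>2 / 128)) + (exp (- (R\<^sup>2 / 128)) + 2 * exp (- (sqrt N / (2 * sqrt d) * (R\<^sup>2 / 8) / 4)))"
proof -
  let ?T = "PiM {1..N+1} (\<lambda>_. train_example d)"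
  let ?P = "task d N R"
  have K: "N + 1 \<in> {1..N+1}" by simp
  interpret P: prob_space ?P by (rule prob_space_task)
  let ?\<xi> = "\<lambda>t. train_noise (snd t (N+1))" and ?\<zeta> = "\<lambda>t. mean_noise N (snd t)"
  define A1 where "A1 = {t\<in>space ?P. R\<^sup>2 / 8 \<le> - inner_d d (fst t) (?\<xi> t)}"
  define A2 where "A2 = {t\<in>space ?P. R\<^sup>2 / 8 \<le> - inner_d d (fst t) (?\<zeta> t)}"
  define A3 where "A3 = {t\<in>space ?P. R\<^sup>2 / 8 \<le> \<bar>bilin d id_mat (?\<zeta> t) (?\<xi> t)\<bar>}"
  have xm: "(\<lambda>t. ?\<xi> t j) \<in> borel_measurable ?P" if "j < d" for j
    using that by (intro task_coord_measurable(2) K train_noise_measurable)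
  have zm: "(\<lambda>t. ?\<zeta> t j) \<in> borel_measurable ?P" if "j < d" for j
    unfolding mean_noise_def using that
    by (intro borel_measurable_times borel_measurable_const borel_measurable_sum task_coord_measurable(2)
        train_noise_measurable) auto
  have [measurable]: "(\<lambda>t. inner_d d (fst t) (?\<xi> t)) \<in> borel_measurable ?P"
    "(\<lambda>t. inner_d d (fst t) (?\<zeta> t)) \<in> borel_measurable ?P"
    "(\<lambda>t. bilin d id_mat (?\<zeta> t) (?\<xi> t)) \<in> borel_measurable ?P"
    by (intro inner_d_measurable bilin_measurable xm zm task_coord_measurable(1); assumption)+
  have sets: "A1 \<in> sets ?P" "A2 \<in> sets ?P" "A3 \<in> sets ?P"
    unfolding A1_def A2_def A3_def by measurable
  have m1: "measure ?P A1 \<le> exp (- (R\<^sup>2 / 128))"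
    unfolding A1_def task_def by (rule sphere_inner_tail[OF subgauss_train_coord[OF K] d])
  have m2: "measure ?P A2 \<le> exp (- (R\<^sup>2 / 128))"
    unfolding A2_def task_def by (rule sphere_inner_tail[OF subgauss_mean_noise[OF N] d])
  have m3: "measure ?P A3 \<le> 2 * exp (- (sqrt N / (2 * sqrt d) * (R\<^sup>2 / 8) / 4))"
  proof -
    let ?X = "\<lambda>f. bilin d id_mat (mean_noise N f) (train_noise (f (N+1)))"
    have [measurable]: "?X \<in> borel_measurable ?T"
      by (intro bilin_measurable subgauss_measurable[OF subgauss_mean_noise[OF N]]
          subgauss_measurable[OF subgauss_train_coord[OF K]])
    have "measure ?P A3 = measure ?T {f\<in>space ?T. R\<^sup>2 / 8 \<le> \<bar>?X f\<bar>}"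
      unfolding A3_def task_def by (intro measure_pair_snd prob_space_unif_sphere prob_space_train_PiM) measurable
    also have "\<dots> \<le> 2 * exp (- (sqrt N / (2 * sqrt d) * (R\<^sup>2 / 8) / 4))"
      unfolding mean_noise_def
    proof (rule bilin_tail_PiM[OF subgauss_train_noise])
      show "(1 / real N)\<^sup>2 * card {1..N} * ((sqrt N / (2 * sqrt d))\<^sup>2 * frob_sq d id_mat) \<le> 1/4"
        using N d by (simp add: frob_sq_id_mat power_divide power_mult_distrib power2_eq_square)
    qed (use N d in auto)
    finally show ?thesis .
  qed
  have "AE t in ?P. t \<in> {t\<in>space ?P. inner_d d (task_muhat N t) (task_x N t) < R\<^sup>2 / 2} \<longrightarrow> t \<in> A1 \<union> (A2 \<union> A3)"
    using AE_task[OF d, of N R]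
  proof eventually_elim
    fix t :: "(nat \<Rightarrow> real) \<times> (nat \<Rightarrow> (nat \<Rightarrow> real) \<times> real)"
    assume ae: "(\<forall>i\<in>{1..N+1}. snd (snd t i) \<in> {-1, 1}) \<and> inner_d d (fst t) (fst t) = R\<^sup>2"
    then have lab: "\<And>i. i \<in> {1..N+1} \<Longrightarrow> snd (snd t i) \<in> {-1, 1}" by blast
    have dec: "task_muhat N t = (\<lambda>j. fst t j + ?\<zeta> t j)" "task_x N t = (\<lambda>j. fst t j + ?\<xi> t j)"
      by (rule task_decomposition[OF _ N], rule lab, assumption)+
    have eq: "inner_d d (task_muhat N t) (task_x N t)
      = R\<^sup>2 + inner_d d (fst t) (?\<xi> t) + inner_d d (fst t) (?\<zeta> t) + bilin d id_mat (?\<zeta> t) (?\<xi> t)"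
      unfolding dec bilin_id_mat inner_d_add inner_d_add2
      using ae inner_d_commute[of d "?\<zeta> t" "fst t"] by simp
    show "t \<in> {t\<in>space ?P. inner_d d (task_muhat N t) (task_x N t) < R\<^sup>2 / 2} \<longrightarrow> t \<in> A1 \<union> (A2 \<union> A3)"
    proof (intro impI, rule ccontr)
      assume t: "t \<in> {t\<in>space ?P. inner_d d (task_muhat N t) (task_x N t) < R\<^sup>2 / 2}" and n: "t \<notin> A1 \<union> (A2 \<union> A3)"
      then have "- inner_d d (fst t) (?\<xi> t) < R\<^sup>2 / 8" "- inner_d d (fst t) (?\<zeta> t) < R\<^sup>2 / 8"
        "\<bar>bilin d id_mat (?\<zeta> t) (?\<xi> t)\<bar> < R\<^sup>2 / 8"
        by (simp_all add: A1_def A2_def A3_def)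
      moreover have "inner_d d (task_muhat N t) (task_x N t) < R\<^sup>2 / 2" using t by simp
      ultimately show False using eq zero_le_power2[of R] by linarith
    qed
  qed
  then have "measure ?P {t\<in>space ?P. inner_d d (task_muhat N t) (task_x N t) < R\<^sup>2 / 2} \<le> measure ?P (A1 \<union> (A2 \<union> A3))"
    using sets by (intro P.finite_measure_mono_AE) auto
  also have "\<dots> \<le> exp (- (R\<^sup>2 / 128)) + (exp (- (R\<^sup>2 / 128)) + 2 * exp (- (sqrt N / (2 * sqrt d) * (R\<^sup>2 / 8) / 4)))"
    using sets by (intro measure_Un_le_add m1 m2 m3 sets.Un)
  finally show ?thesis .
qed

text \<open>For A equal to sqrt (2 s) times the identity, |A u|^2 / 2 is s |u|^2 and the squared
  Frobenius norm is 2 s d. A negative r is covered too, because |u|^2 \<ge> 0 allows r to be raised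
  to s.\<close>

lemma norm_tail:
  assumes S: "subgauss d Q u K v" and K: "0 \<le> K" "K \<le> 4" and s: "s > 0" "v * (2 * s * d) \<le> 1/4"
  shows "measure Q {q\<in>space Q. t \<le> \<bar>inner_d d (u q) (u q)\<bar>} \<le> 2 * exp (- (s * t / 4))"
proof (rule exp_abs_tail_bound_scaled[OF _ _ s(1)])
  interpret Q: prob_space Q by (rule subgauss_prob_space[OF S])
  show "prob_space Q" by (rule Q.prob_space_axioms)
  show "(\<lambda>q. inner_d d (u q) (u q)) \<in> borel_measurable Q"
    by (intro inner_d_measurable subgauss_measurable[OF S])
  let ?A = "\<lambda>i j. sqrt (2 * s) * id_mat i j"
  have A: "inner_d d (matvec d ?A x) (matvec d ?A x) / 2 = s * inner_d d x x" for x
  proof -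
    have b: "bilin d ?A y z = sqrt (2 * s) * inner_d d y z" for y z
      by (simp only: bilin_mat_scale bilin_id_mat)
    have "inner_d d (matvec d ?A x) (matvec d ?A x) = sqrt (2 * s) * inner_d d (matvec d ?A x) x"
      using b[of "matvec d ?A x" x] by (simp only: bilin_def)
    also have "inner_d d (matvec d ?A x) x = sqrt (2 * s) * inner_d d x x"
      using b[of x x] by (simp only: bilin_def inner_d_commute[of d "matvec d ?A x" x])
    also have "sqrt (2 * s) * (sqrt (2 * s) * inner_d d x x) = 2 * s * inner_d d x x"
      using s by (simp add: mult.assoc[symmetric])
    finally show ?thesis by simp
  qed
  fix r :: real assume "\<bar>r\<bar> = s"
  then have r: "r \<le> s" by simp
  have "(\<integral>\<^sup>+q. ennreal (exp (r * inner_d d (u q) (u q))) \<partial>Q)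
      \<le> (\<integral>\<^sup>+q. ennreal (exp (inner_d d (matvec d ?A (u q)) (matvec d ?A (u q)) / 2)) \<partial>Q)"
    unfolding A using r by (intro nn_integral_mono ennreal_leI) (auto intro: mult_right_mono inner_d_nonneg)
  also have "\<dots> \<le> ennreal (max 1 (2 * K))"
    using s K by (intro subgauss_exp_matvec_square[OF S]) (simp_all add: frob_sq_scale frob_sq_id_mat)
  also have "\<dots> \<le> ennreal 8" using K by (intro ennreal_leI) simp
  finally show "(\<integral>\<^sup>+q. ennreal (exp (r * inner_d d (u q) (u q))) \<partial>Q) \<le> ennreal 8" .
qed

text \<open>Coordinate k is integrated on its own, after which the integrand depends on coordinate l
  alone; what remains is a bilinear form in two independent copies.\<close>

lemma inner_tail_PiM:
  fixes k l :: nat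
  assumes S: "subgauss d Q u K v" and K: "K \<ge> 1" "K * K \<le> 4" and v: "v \<ge> 0"
    and I: "finite I" "k \<in> I" "l \<in> I" "k \<noteq> l" and s: "s > 0" "v * v * (s\<^sup>2 * d) \<le> 1/4"
  shows "measure (PiM I (\<lambda>_. Q)) {f\<in>space (PiM I (\<lambda>_. Q)). t \<le> \<bar>inner_d d (u (f k)) (u (f l))\<bar>}
    \<le> 2 * exp (- (s * t / 4))"
proof (rule exp_abs_tail_bound_scaled[OF _ _ s(1)])
  note Q = subgauss_prob_space[OF S] and m = subgauss_measurable[OF S]
  interpret Q: prob_space Q by (rule Q)
  interpret QQ: pair_sigma_finite Q Q ..
  define I' where "I' = I - {k}"
  have I': "I = insert k I'" "finite I'" "k \<notin> I'" "l \<in> I'" using I by (auto simp: I'_def)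
  show "prob_space (PiM I (\<lambda>_. Q))" by (intro prob_space_PiM Q)
  show bm: "(\<lambda>f. inner_d d (u (f k)) (u (f l))) \<in> borel_measurable (PiM I (\<lambda>_. Q))"
    using I by (intro inner_d_measurable measurable_PiM_coord m)
  fix r :: real assume r: "\<bar>r\<bar> = s"
  then have r2: "r\<^sup>2 = s\<^sup>2" by (metis power2_abs)
  have pm [measurable]: "(\<lambda>w. inner_d d (u (snd w)) (u (fst w))) \<in> borel_measurable (Q \<Otimes>\<^sub>M Q)"
    by (intro inner_d_measurable measurable_compose[OF measurable_fst m] measurable_compose[OF measurable_snd m])
  have hm: "(\<lambda>x. \<integral>\<^sup>+y. ennreal (exp (r * inner_d d (u y) (u x))) \<partial>Q) \<in> borel_measurable Q"
    by (intro Q.borel_measurable_nn_integral) (simp add: case_prod_unfold)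
  have "(\<integral>\<^sup>+f. ennreal (exp (r * inner_d d (u (f k)) (u (f l)))) \<partial>PiM I (\<lambda>_. Q))
     = (\<integral>\<^sup>+x. \<integral>\<^sup>+y. ennreal (exp (r * inner_d d (u ((x(k := y)) k)) (u ((x(k := y)) l)))) \<partial>Q \<partial>PiM I' (\<lambda>_. Q))"
    unfolding I'(1) using bm[unfolded I'(1)] by (intro nn_integral_PiM_insert Q I') auto
  also have "\<dots> = (\<integral>\<^sup>+x. \<integral>\<^sup>+y. ennreal (exp (r * inner_d d (u y) (u (x l)))) \<partial>Q \<partial>PiM I' (\<lambda>_. Q))"
    using I(4) by simp
  also have "\<dots> = (\<integral>\<^sup>+x. \<integral>\<^sup>+y. ennreal (exp (r * inner_d d (u y) (u x))) \<partial>Q \<partial>Q)"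
    using nn_integral_PiM_component[OF Q I'(2,4) hm] .
  also have "\<dots> = (\<integral>\<^sup>+x. \<integral>\<^sup>+y. ennreal (exp (bilin d (\<lambda>i j. r * id_mat i j) (u x) (u y))) \<partial>Q \<partial>Q)"
    unfolding bilin_mat_scale bilin_id_mat by (simp add: inner_d_commute)
  also have "\<dots> \<le> ennreal (2 * K * K)"
    using s r2 by (intro subgauss_exp_bilin[OF S S K(1) K(1) v v]) (simp add: frob_sq_scale frob_sq_id_mat)
  also have "\<dots> \<le> ennreal 8" using K by (intro ennreal_leI) simp
  finally show "(\<integral>\<^sup>+f. ennreal (exp (r * inner_d d (u (f k)) (u (f l)))) \<partial>PiM I (\<lambda>_. Q)) \<le> ennreal 8" .
qed

text \<open>With proxy 3 R^2 / d, the diagonal admits the inverse scale 1 / (24 R^2), and 288 = 24 *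
  4 * 3 makes the exponent 3 L. Off the diagonal sqrt d / (6 R^2) is admissible and gives 12 L, more
  than the 3 L required there.\<close>

lemma gram_tail:
  assumes S: "subgauss d (task d N R) u 2 (3 * R\<^sup>2 / d)" and d: "d > 0" and R: "R > 0" and L: "L \<ge> 0"
    and ts: "\<tau> \<in> {1..B}" "\<sigma> \<in> {1..B}"
  shows "measure (pretrain d B N R) {\<omega>\<in>space (pretrain d B N R).
      gram_bound d (288 * R\<^sup>2 * L) \<tau> \<sigma> \<le> \<bar>inner_d d (u (\<omega> \<tau>)) (u (\<omega> \<sigma>))\<bar>} \<le> 2 * exp (- (3 * L))"
proof -
  have c1: "3 * r / d * (2 * (1 / (24 * r)) * d) \<le> 1/4" if "r > 0" for r :: real
    using that d by simp
  have c2: "1 / (24 * r) * (288 * r * L) / 4 = 3 * L" if "r > 0" for r :: real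
    using that by simp
  have c3: "3 * r / d * (3 * r / d) * ((sqrt d / (6 * r))\<^sup>2 * d) \<le> 1/4" if "r > 0" for r :: real
    using that d by (simp add: power_divide power_mult_distrib) (simp add: power2_eq_square)
  have c4: "sqrt d / (6 * r) * (288 * r * L / sqrt d) / 4 = 12 * L" if "r > 0" for r :: real
    using that d by simp
  have R2: "R\<^sup>2 > 0" using R by simp
  show ?thesis
proof (cases "\<tau> = \<sigma>")
  case True
  let ?Q = "task d N R"
  have [measurable]: "(\<lambda>q. inner_d d (u q) (u q)) \<in> borel_measurable ?Q"
    by (intro inner_d_measurable subgauss_measurable[OF S])
  have "measure (pretrain d B N R) {\<omega>\<in>space (pretrain d B N R).
      gram_bound d (288 * R\<^sup>2 * L) \<tau> \<sigma> \<le> \<bar>inner_d d (u (\<omega> \<tau>)) (u (\<omega> \<sigma>))\<bar>}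
    = measure ?Q {q\<in>space ?Q. 288 * R\<^sup>2 * L \<le> \<bar>inner_d d (u q) (u q)\<bar>}"
    unfolding pretrain_eq True gram_bound_def using ts
    by (simp only: if_True refl, intro measure_PiM_component prob_space_task) auto
  also have "\<dots> \<le> 2 * exp (- (1 / (24 * R\<^sup>2) * (288 * R\<^sup>2 * L) / 4))"
    using R2 by (intro norm_tail[OF S] c1) simp_all
  also have "1 / (24 * R\<^sup>2) * (288 * R\<^sup>2 * L) / 4 = 3 * L" by (rule c2[OF R2])
  finally show ?thesis .
next
  case False
  have "measure (pretrain d B N R) {\<omega>\<in>space (pretrain d B N R).
      288 * R\<^sup>2 * L / sqrt d \<le> \<bar>inner_d d (u (\<omega> \<tau>)) (u (\<omega> \<sigma>))\<bar>}
    \<le> 2 * exp (- (sqrt d / (6 * R\<^sup>2) * (288 * R\<^sup>2 * L / sqrt d) / 4))"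
    unfolding pretrain_eq
  proof (rule inner_tail_PiM[OF S])
    show "3 * R\<^sup>2 / d * (3 * R\<^sup>2 / d) * ((sqrt d / (6 * R\<^sup>2))\<^sup>2 * d) \<le> 1/4" by (rule c3[OF R2])
  qed (use ts False d R in auto)
  also have "sqrt d / (6 * R\<^sup>2) * (288 * R\<^sup>2 * L / sqrt d) / 4 = 12 * L" by (rule c4[OF R2])
  also have "2 * exp (- (12 * L)) \<le> 2 * exp (- (3 * L))" using L by simp
  finally show ?thesis using False by (simp add: gram_bound_def)
qed
qed

text \<open>A union bound. For r = \<delta> / (2 B) each of the B margins fails with probability at
  most 4 r^2, in total 2 r \<delta> \<le> \<delta>. For q = \<delta> / (2 B^2) each of the 2 B^2
  Gram entries fails with probability at most 2 q^3, in total 2 q^2 \<delta> \<le> \<delta>.\<close>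

lemma good_data_prob:
  fixes \<delta> :: real
  assumes d: "d > 0" and B: "B \<ge> 1" and N: "N \<ge> 1" and R: "R > 0" "R\<^sup>2 \<ge> d" and \<delta>: "0 < \<delta>" "\<delta> < 1"
    and e1: "R\<^sup>2 \<ge> 256 * ln (2 * real B / \<delta>)"
    and e2: "R\<^sup>2 \<ge> 256 * (sqrt (real d / real N) * ln (2 * real B / \<delta>))"
    and L: "L = ln (2 * (real B)\<^sup>2 / \<delta>)"
  defines "E \<equiv> {\<omega>\<in>space (pretrain d B N R). good_data d B N R (288 * R\<^sup>2 * L) \<omega>}"
  shows "E \<in> sets (pretrain d B N R)" "measure (pretrain d B N R) E \<ge> 1 - 10 * \<delta>"
proof -
  let ?P = "pretrain d B N R" and ?I = "{1..B}" and ?T = "task d N R"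
  let ?K = "288 * R\<^sup>2 * L" and ?u = "task_muhat N" and ?x = "task_x N"
  define l where "l = ln (2 * real B / \<delta>)"
  have P: "prob_space ?P" unfolding pretrain_eq by (intro prob_space_PiM prob_space_task)
  interpret P: prob_space ?P by (rule P)
  have "(real B)\<^sup>2 \<ge> 1" using B by simp
  then have "1 \<le> 2 * (real B)\<^sup>2 / \<delta>" using \<delta> by simp
  then have L0: "L \<ge> 0" unfolding L by (rule ln_ge_zero)
  note S = subgauss_task[OF d N R]
  define D where "D \<tau> = {\<omega>\<in>space ?P. inner_d d (?u (\<omega> \<tau>)) (?x (\<omega> \<tau>)) < R\<^sup>2 / 2}" for \<tau>
  define G1 where "G1 w = {\<omega>\<in>space ?P. gram_bound d ?K (fst w) (snd w) \<le> \<bar>inner_d d (?u (\<omega> (fst w))) (?u (\<omega> (snd w)))\<bar>}" for w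
  define G2 where "G2 w = {\<omega>\<in>space ?P. gram_bound d ?K (fst w) (snd w) \<le> \<bar>inner_d d (?x (\<omega> (fst w))) (?x (\<omega> (snd w)))\<bar>}" for w
  have um: "(\<lambda>\<omega>. ?u (\<omega> \<tau>) j) \<in> borel_measurable ?P" and xm: "(\<lambda>\<omega>. ?x (\<omega> \<tau>) j) \<in> borel_measurable ?P"
    if "\<tau> \<in> ?I" "j < d" for \<tau> j
    unfolding pretrain_eq using that by (auto intro!: measurable_PiM_coord task_measurable)
  have D_sets: "D \<tau> \<in> sets ?P" if "\<tau> \<in> ?I" for \<tau>
  proof -
    have [measurable]: "(\<lambda>\<omega>. inner_d d (?u (\<omega> \<tau>)) (?x (\<omega> \<tau>))) \<in> borel_measurable ?P"
      using that by (intro inner_d_measurable um xm)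
    show ?thesis unfolding D_def by measurable
  qed
  have G_sets: "G1 w \<in> sets ?P" "G2 w \<in> sets ?P" if "w \<in> ?I \<times> ?I" for w
  proof -
    have [measurable]: "(\<lambda>\<omega>. inner_d d (?u (\<omega> (fst w))) (?u (\<omega> (snd w)))) \<in> borel_measurable ?P"
      "(\<lambda>\<omega>. inner_d d (?x (\<omega> (fst w))) (?x (\<omega> (snd w)))) \<in> borel_measurable ?P"
      using that by (auto intro!: inner_d_measurable um xm)
    show "G1 w \<in> sets ?P" "G2 w \<in> sets ?P" unfolding G1_def G2_def by measurable
  qed
  have E_iff: "\<omega> \<in> E \<longleftrightarrow> \<omega> \<in> space ?P \<and>
     (\<forall>\<tau>\<in>?I. \<not> inner_d d (?u (\<omega> \<tau>)) (?x (\<omega> \<tau>)) < R\<^sup>2 / 2) \<and>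
     (\<forall>\<tau>\<in>?I. \<forall>\<sigma>\<in>?I. \<bar>inner_d d (?u (\<omega> \<tau>)) (?u (\<omega> \<sigma>))\<bar> \<le> gram_bound d ?K \<tau> \<sigma> \<and>
        \<bar>inner_d d (?x (\<omega> \<tau>)) (?x (\<omega> \<sigma>))\<bar> \<le> gram_bound d ?K \<tau> \<sigma>)" for \<omega>
    unfolding E_def good_data_def muhat_eq train_x_eq by (auto simp: not_less)
  show E_sets: "E \<in> sets ?P"
  proof -
    have SG: "{\<omega>\<in>space ?P. \<bar>inner_d d (?u (\<omega> \<tau>)) (?u (\<omega> \<sigma>))\<bar> \<le> gram_bound d ?K \<tau> \<sigma>} \<in> sets ?P"
      "{\<omega>\<in>space ?P. \<bar>inner_d d (?x (\<omega> \<tau>)) (?x (\<omega> \<sigma>))\<bar> \<le> gram_bound d ?K \<tau> \<sigma>} \<in> sets ?P"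
      if "\<tau> \<in> ?I" "\<sigma> \<in> ?I" for \<tau> \<sigma>
    proof -
      have [measurable]: "(\<lambda>\<omega>. inner_d d (?u (\<omega> \<tau>)) (?u (\<omega> \<sigma>))) \<in> borel_measurable ?P"
        "(\<lambda>\<omega>. inner_d d (?x (\<omega> \<tau>)) (?x (\<omega> \<sigma>))) \<in> borel_measurable ?P"
        using that by (auto intro!: inner_d_measurable um xm)
      show "{\<omega>\<in>space ?P. \<bar>inner_d d (?u (\<omega> \<tau>)) (?u (\<omega> \<sigma>))\<bar> \<le> gram_bound d ?K \<tau> \<sigma>} \<in> sets ?P"
        "{\<omega>\<in>space ?P. \<bar>inner_d d (?x (\<omega> \<tau>)) (?x (\<omega> \<sigma>))\<bar> \<le> gram_bound d ?K \<tau> \<sigma>} \<in> sets ?P"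
        by measurable
    qed
    have SD: "{\<omega>\<in>space ?P. \<not> inner_d d (?u (\<omega> \<tau>)) (?x (\<omega> \<tau>)) < R\<^sup>2 / 2} \<in> sets ?P" if "\<tau> \<in> ?I" for \<tau>
    proof -
      have [measurable]: "(\<lambda>\<omega>. inner_d d (?u (\<omega> \<tau>)) (?x (\<omega> \<tau>))) \<in> borel_measurable ?P"
        using that by (intro inner_d_measurable um xm)
      show ?thesis by measurable
    qed
    have E_eq: "E = {\<omega>\<in>space ?P.
     (\<forall>\<tau>\<in>?I. \<not> inner_d d (?u (\<omega> \<tau>)) (?x (\<omega> \<tau>)) < R\<^sup>2 / 2) \<and>
     (\<forall>\<tau>\<in>?I. \<forall>\<sigma>\<in>?I. \<bar>inner_d d (?u (\<omega> \<tau>)) (?u (\<omega> \<sigma>))\<bar> \<le> gram_bound d ?K \<tau> \<sigma> \<and>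
        \<bar>inner_d d (?x (\<omega> \<tau>)) (?x (\<omega> \<sigma>))\<bar> \<le> gram_bound d ?K \<tau> \<sigma>)}"
      by (rule set_eqI) (simp only: E_iff mem_Collect_eq)
    show ?thesis
      unfolding E_eq
      by (intro sets.sets_Collect_conj sets.sets_Collect_finite_All SD SG) (simp_all only: finite_atLeastAtMost)
  qed
  have pos: "0 < 2 * real B / \<delta>" "0 < 2 * (real B)\<^sup>2 / \<delta>" using B \<delta> by auto
  define r where "r = \<delta> / (2 * real B)"
  have r: "exp (- (2 * l)) = r\<^sup>2"
  proof -
    have "exp (- l) = r" unfolding l_def r_def exp_minus exp_ln[OF pos(1)] by simp
    moreover have "exp (- (2 * l)) = (exp (- l))\<^sup>2" by (simp add: exp_of_nat_mult[symmetric])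
    ultimately show ?thesis by simp
  qed
  have D_le: "measure ?P (D \<tau>) \<le> 4 * r\<^sup>2" if \<tau>: "\<tau> \<in> ?I" for \<tau>
  proof -
    have [measurable]: "(\<lambda>t. inner_d d (?u t) (?x t)) \<in> borel_measurable ?T"
      by (intro inner_d_measurable task_measurable)
    have "measure ?P (D \<tau>) = measure ?T {t\<in>space ?T. inner_d d (?u t) (?x t) < R\<^sup>2 / 2}"
      unfolding D_def pretrain_eq using \<tau> by (intro measure_PiM_component prob_space_task) auto
    also have "\<dots> \<le> exp (- (R\<^sup>2 / 128)) + (exp (- (R\<^sup>2 / 128)) + 2 * exp (- (sqrt N / (2 * sqrt d) * (R\<^sup>2 / 8) / 4)))"
      by (rule task_margin_tail[OF d N])
    also have "\<dots> \<le> exp (- (2 * l)) + (exp (- (2 * l)) + 2 * exp (- (2 * l)))"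
    proof -
      \<comment> \<open>256 = 2 * 128 is what makes the exponent at least 2 l, hence the bound
        quadratic in r.\<close>
      have 1: "exp (- (R\<^sup>2 / 128)) \<le> exp (- (2 * l))" using e1 by (simp add: l_def)
      \<comment> \<open>The factor sqrt (d / N) of \<open>e2\<close> is matched to the noise-noise
        exponent: it cancels there and leaves 4 l \<ge> 2 l.\<close>
      have "sqrt N / sqrt d * R\<^sup>2 \<ge> sqrt N / sqrt d * (256 * (sqrt (real d / real N) * l))"
        using e2 unfolding l_def by (intro mult_left_mono) auto
      also have "sqrt N / sqrt d * (256 * (sqrt (real d / real N) * l)) = 256 * l"
        using d N by (simp add: real_sqrt_divide)
      finally have l: "256 * l \<le> sqrt N / sqrt d * R\<^sup>2" .
      have "1 \<le> 2 * real B / \<delta>" using B \<delta> by simp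
      then have l0: "0 \<le> l" unfolding l_def by (rule ln_ge_zero)
      have "sqrt N / (2 * sqrt d) * (R\<^sup>2 / 8) / 4 = (sqrt N / sqrt d * R\<^sup>2) / 64" by simp
      moreover have "256 * l / 64 \<le> (sqrt N / sqrt d * R\<^sup>2) / 64" using l by (rule divide_right_mono) simp
      moreover have "2 * l \<le> 256 * l / 64" using l0 by simp
      ultimately have "2 * l \<le> sqrt N / (2 * sqrt d) * (R\<^sup>2 / 8) / 4" by (simp only:)
      then have 2: "exp (- (sqrt N / (2 * sqrt d) * (R\<^sup>2 / 8) / 4)) \<le> exp (- (2 * l))" by simp
      show ?thesis using 1 2 by linarith
    qed
    also have "\<dots> = 4 * r\<^sup>2" unfolding r by simp
    finally show ?thesis .
  qed
  define q where "q = \<delta> / (2 * (real B)\<^sup>2)"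
  have q: "exp (- (3 * L)) = q ^ 3"
  proof -
    have "exp (- L) = q" unfolding L q_def exp_minus exp_ln[OF pos(2)] by simp
    moreover have "exp (- (3 * L)) = (exp (- L)) ^ 3" by (simp add: exp_of_nat_mult[symmetric])
    ultimately show ?thesis by simp
  qed
  have G_le: "measure ?P (G1 w) \<le> 2 * q ^ 3" "measure ?P (G2 w) \<le> 2 * q ^ 3" if w: "w \<in> ?I \<times> ?I" for w
    using gram_tail[OF S(1) d R(1) L0, of "fst w" B "snd w"] gram_tail[OF S(2) d R(1) L0, of "fst w" B "snd w"] w
    unfolding q G1_def G2_def by auto
  let ?bad = "(\<Union>\<tau>\<in>?I. D \<tau>) \<union> ((\<Union>w\<in>?I \<times> ?I. G1 w) \<union> (\<Union>w\<in>?I \<times> ?I. G2 w))"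
  have bad_sets: "(\<Union>\<tau>\<in>?I. D \<tau>) \<in> sets ?P" "(\<Union>w\<in>?I \<times> ?I. G1 w) \<in> sets ?P" "(\<Union>w\<in>?I \<times> ?I. G2 w) \<in> sets ?P"
    using D_sets G_sets by (intro sets.finite_UN; auto)+
  have "space ?P - E \<subseteq> ?bad"
  proof
    fix \<omega> assume "\<omega> \<in> space ?P - E"
    then have sp: "\<omega> \<in> space ?P" and n: "\<omega> \<notin> E" by auto
    show "\<omega> \<in> ?bad"
    proof (rule ccontr)
      assume nb: "\<omega> \<notin> ?bad"
      have a: "\<not> inner_d d (?u (\<omega> \<tau>)) (?x (\<omega> \<tau>)) < R\<^sup>2 / 2" if "\<tau> \<in> ?I" for \<tau>
        using nb sp that by (auto simp: D_def)
      have b: "\<omega> \<notin> G1 (\<tau>, \<sigma>)" "\<omega> \<notin> G2 (\<tau>, \<sigma>)" if "\<tau> \<in> ?I" "\<sigma> \<in> ?I" for \<tau> \<sigma>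
        using nb that by blast+
      have "\<bar>inner_d d (?u (\<omega> \<tau>)) (?u (\<omega> \<sigma>))\<bar> \<le> gram_bound d ?K \<tau> \<sigma>"
        "\<bar>inner_d d (?x (\<omega> \<tau>)) (?x (\<omega> \<sigma>))\<bar> \<le> gram_bound d ?K \<tau> \<sigma>" if "\<tau> \<in> ?I" "\<sigma> \<in> ?I" for \<tau> \<sigma>
        using b[OF that] sp by (auto simp: G1_def G2_def)
      then have "\<omega> \<in> E" unfolding E_iff using sp a by blast
      then show False using n by simp
    qed
  qed
  then have "measure ?P (space ?P - E) \<le> measure ?P ?bad"
    using bad_sets by (intro P.finite_measure_mono) auto
  also have "\<dots> \<le> (\<Sum>\<tau>\<in>?I. 4 * r\<^sup>2) + ((\<Sum>w\<in>?I \<times> ?I. 2 * q ^ 3) + (\<Sum>w\<in>?I \<times> ?I. 2 * q ^ 3))"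
  proof (intro measure_Un_le_add bad_sets sets.Un)
    show "measure ?P (\<Union>\<tau>\<in>?I. D \<tau>) \<le> (\<Sum>\<tau>\<in>?I. 4 * r\<^sup>2)"
      using D_sets by (intro order_trans[OF P.finite_measure_subadditive_finite sum_mono] D_le) auto
    show "measure ?P (\<Union>w\<in>?I \<times> ?I. G1 w) \<le> (\<Sum>w\<in>?I \<times> ?I. 2 * q ^ 3)"
      using G_sets by (intro order_trans[OF P.finite_measure_subadditive_finite sum_mono] G_le) auto
    show "measure ?P (\<Union>w\<in>?I \<times> ?I. G2 w) \<le> (\<Sum>w\<in>?I \<times> ?I. 2 * q ^ 3)"
      using G_sets by (intro order_trans[OF P.finite_measure_subadditive_finite sum_mono] G_le) auto
  qed
  also have "\<dots> = real B * (4 * r\<^sup>2) + (real B)\<^sup>2 * (4 * q ^ 3)"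
    by (simp add: power2_eq_square)
  also have "\<dots> \<le> \<delta> + \<delta>"
  proof (rule add_mono)
    have "r * (2 * real B) = \<delta>" using B by (simp add: r_def)
    then have "real B * (4 * r\<^sup>2) = \<delta> * (2 * r)" by (simp add: power2_eq_square)
    also have "\<dots> \<le> \<delta> * 1"
    proof (intro mult_left_mono)
      show "2 * r \<le> 1" using B \<delta> by (simp add: r_def)
    qed (use \<delta> in simp)
    finally show "real B * (4 * r\<^sup>2) \<le> \<delta>" by simp
    have "q * (2 * (real B)\<^sup>2) = \<delta>" using B by (simp add: q_def)
    then have "(real B)\<^sup>2 * (4 * q ^ 3) = \<delta> * (2 * q\<^sup>2)" by (simp add: power2_eq_square power3_eq_cube)
    also have "\<dots> \<le> \<delta> * 1"
    proof (intro mult_left_mono)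
      have "q \<ge> 0" using \<delta> by (simp add: q_def)
      moreover have "q \<le> 1/2" using \<open>(real B)\<^sup>2 \<ge> 1\<close> \<delta> by (simp add: q_def divide_le_eq)
      ultimately have "q\<^sup>2 \<le> (1/2)\<^sup>2" by (intro power_mono)
      then show "2 * q\<^sup>2 \<le> 1" by (simp add: power2_eq_square)
    qed (use \<delta> in simp)
    finally show "(real B)\<^sup>2 * (4 * q ^ 3) \<le> \<delta>" by simp
  qed
  finally have "measure ?P (space ?P - E) \<le> 2 * \<delta>" by simp
  then show "measure ?P E \<ge> 1 - 10 * \<delta>"
    using P.prob_compl[OF E_sets] \<delta> by simp
qed

section \<open>Choice of the constants and assembly\<close>

lemma two_exp_mono: "x \<le> y \<Longrightarrow> 2 * exp (- y) \<le> 2 * exp (- x :: real)"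
  by simp

theorem mainTheorem2:
  fixes c_p :: real
  assumes "0 < c_p" and "c_p < 1/2"
  shows "\<exists>C::real. C > 1 \<and> (\<exists>c::real. c > 0 \<and>
    (\<forall>(d::nat) (B::nat) (N::nat) (R::real) (\<delta>::real) (c_B::real) (M::nat) (Rt::real).
       0 < \<delta> \<and> \<delta> < 1 \<and> 1 \<le> B \<and> 1 \<le> N \<and> 0 < R \<and> 0 < c_B \<and> 1 \<le> M \<and> 0 < Rt \<and>
       R\<^sup>2 \<ge> C\<^sup>2 * sqrt (real d * real d) \<and>
       R\<^sup>2 \<ge> C\<^sup>2 * max (real d / real d) (max (sqrt (real d / real N)) 1) * ln (2 * real B / \<delta>) \<and>
       real B \<ge> c_B * real d \<and>
       real d \<ge> C * (ln (2 * (real B)\<^sup>2 / \<delta>)) ^ 4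
     \<longrightarrow>
       (let p = 1/2 - c_p; \<rho> = min c_B 1 / (ln (2 * (real B)\<^sup>2 / \<delta>))\<^sup>2 in
        \<exists>E \<in> sets (pretrain d B N R).
          measure (pretrain d B N R) E \<ge> 1 - 10 * \<delta> \<and>
          (\<forall>\<omega>\<in>E. (\<exists>W. is_max_margin d B N \<omega> W) \<and>
             (\<forall>W. is_max_margin d B N \<omega> W \<longrightarrow>
                memo_err_event d M Rt p W \<in> sets (test_space d M Rt p) \<and>
                measure (test_space d M Rt p) (memo_err_event d M Rt p W)
                  \<le> 4 * real M * exp (- c * \<rho> * sqrt (real d) / sqrt (real M))
                    + 8 * real M * exp (- c * \<rho> * real d / (real M * max (Rt\<^sup>2) Rt)) \<and>
                test_err_event d M Rt p W \<in> sets (test_space d M Rt p) \<and>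
                measure (test_space d M Rt p) (test_err_event d M Rt p W)
                  \<le> p + 2 * exp (- c * real M) + 2 * exp (- c * \<rho> * sqrt (real d))
                    + 4 * exp (- c * \<rho> * Rt)
                    + 2 * exp (- c * \<rho> * sqrt (real M) * Rt\<^sup>2 / sqrt (real d)))))))"
proof -
  \<comment> \<open>1728 = 6 * 288 is the loss in \<kappa>, and 345600 = 200 * 1728, where 200
    exceeds all denominators of the exponents, the largest being 192. The square of c_p suits the
    flip exponent c_p^2 / 2 and, being at most c_p, also the exponents linear in c_p.\<close>
  define c where "c = c_p\<^sup>2 / 345600"
  have cp2: "0 < c_p\<^sup>2" "c_p\<^sup>2 \<le> c_p" "c_p\<^sup>2 \<le> 1/4"
    using assms power_mono[of c_p "1/2" 2] mult_mono[of c_p 1 c_p c_p]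
    by (auto simp: power2_eq_square)
  have c: "c > 0" using cp2 by (simp add: c_def)
  have c_le: "c \<le> c_p\<^sup>2 / 2" "c \<le> 1 / 1728 / 32" "c \<le> 1 / 1728 / 96" "c \<le> 1 / 1728 / 192" "c \<le> 1 / 1728 / 144"
    "c \<le> c_p / 1728 / 192" "c \<le> c_p / 1728 / 128"
    using cp2 assms by (simp_all add: c_def)
  show ?thesis
  \<comment> \<open>C = 16, since 16^2 = 256 is the factor asked for in
    \<open>good_data_prob\<close>.\<close>
  proof (rule exI[of _ 16], rule conjI, simp, rule exI[of _ c], rule conjI, rule c, intro allI impI)
    fix d B N M :: nat and R \<delta> c_B Rt :: real
    assume A: "0 < \<delta> \<and> \<delta> < 1 \<and> 1 \<le> B \<and> 1 \<le> N \<and> 0 < R \<and> 0 < c_B \<and> 1 \<le> M \<and> 0 < Rt \<and>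
       R\<^sup>2 \<ge> 16\<^sup>2 * sqrt (real d * real d) \<and>
       R\<^sup>2 \<ge> 16\<^sup>2 * max (real d / real d) (max (sqrt (real d / real N)) 1) * ln (2 * real B / \<delta>) \<and>
       real B \<ge> c_B * real d \<and>
       real d \<ge> 16 * (ln (2 * (real B)\<^sup>2 / \<delta>)) ^ 4"
    then have \<delta>: "0 < \<delta>" "\<delta> < 1" and B: "1 \<le> B" and N: "1 \<le> N" and R: "0 < R" and cB: "0 < c_B"
      and M: "1 \<le> M" and Rt: "0 < Rt" by auto
    define L where "L = ln (2 * (real B)\<^sup>2 / \<delta>)"
    define \<rho> where "\<rho> = min c_B 1 / L\<^sup>2"
    have "(real B)\<^sup>2 \<ge> 1" using B by simp
    then have "2 \<le> 2 * (real B)\<^sup>2 / \<delta>" using \<delta> by (simp add: le_divide_eq)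
    then have "ln 2 \<le> L" unfolding L_def by (subst ln_le_cancel_iff) auto
    \<comment> \<open>B \<ge> 1 and \<delta> < 1 keep the logarithm away from 0 by an absolute
      constant, on which the passage from sqrt \<rho> to \<rho> rests.\<close>
    then have L: "1/2 \<le> L" using ln2_ge_two_thirds by linarith
    then have "0 < 16 * L ^ 4" by simp
    then have d: "d > 0" using A unfolding L_def[symmetric] by (cases d) auto
    have l0: "0 \<le> ln (2 * real B / \<delta>)" using B \<delta> by (intro ln_ge_zero) simp
    have R2: "R\<^sup>2 \<ge> d"
      using A by (simp add: real_sqrt_mult_self)
    let ?m = "max (real d / real d) (max (sqrt (real d / real N)) 1)"
    have Rm: "256 * (?m * ln (2 * real B / \<delta>)) \<le> R\<^sup>2" using A by (simp add: mult.assoc)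
    \<comment> \<open>The entry 1 of the maximum controls the centre-noise terms of the margin, the
      entry sqrt (d / N) the noise-noise term.\<close>
    have "1 * ln (2 * real B / \<delta>) \<le> ?m * ln (2 * real B / \<delta>)"
      by (intro mult_right_mono l0) simp
    then have e1: "256 * ln (2 * real B / \<delta>) \<le> R\<^sup>2" using Rm by linarith
    have "sqrt (real d / real N) * ln (2 * real B / \<delta>) \<le> ?m * ln (2 * real B / \<delta>)"
      by (intro mult_right_mono l0) simp
    then have e2: "256 * (sqrt (real d / real N) * ln (2 * real B / \<delta>)) \<le> R\<^sup>2" using Rm by linarith
    define \<beta> where "\<beta> = min c_B 1"
    have \<beta>: "0 < \<beta>" "\<beta> \<le> 1" "\<beta> * d \<le> B"
    proof -
      have "\<beta> * d \<le> c_B * d" by (intro mult_right_mono) (auto simp: \<beta>_def)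
      then show "\<beta> * d \<le> B" using A by linarith
    qed (use cB in \<open>auto simp: \<beta>_def\<close>)
    have \<rho>: "\<rho> > 0" using \<beta> L by (simp add: \<rho>_def \<beta>_def[symmetric])
    define E where "E = {\<omega>\<in>space (pretrain d B N R). good_data d B N R (288 * R\<^sup>2 * L) \<omega>}"
    have E: "E \<in> sets (pretrain d B N R)" "measure (pretrain d B N R) E \<ge> 1 - 10 * \<delta>"
      using good_data_prob[OF d B N R R2 \<delta> e1 e2 L_def] by (simp_all add: E_def)
    let ?p = "1/2 - c_p"
    have main: "(\<exists>W. is_max_margin d B N \<omega> W) \<and>
      (\<forall>W. is_max_margin d B N \<omega> W \<longrightarrow>
          memo_err_event d M Rt ?p W \<in> sets (test_space d M Rt ?p) \<and>
          measure (test_space d M Rt ?p) (memo_err_event d M Rt ?p W)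
            \<le> 4 * real M * exp (- c * \<rho> * sqrt (real d) / sqrt (real M))
              + 8 * real M * exp (- c * \<rho> * real d / (real M * max (Rt\<^sup>2) Rt)) \<and>
          test_err_event d M Rt ?p W \<in> sets (test_space d M Rt ?p) \<and>
          measure (test_space d M Rt ?p) (test_err_event d M Rt ?p W)
            \<le> ?p + 2 * exp (- c * real M) + 2 * exp (- c * \<rho> * sqrt (real d))
              + 4 * exp (- c * \<rho> * Rt)
              + 2 * exp (- c * \<rho> * sqrt (real M) * Rt\<^sup>2 / sqrt (real d)))"
      if "\<omega> \<in> E" for \<omega>
    proof (intro conjI allI impI)
      have g: "good_data d B N R (288 * R\<^sup>2 * L) \<omega>" using that by (simp add: E_def)
      show "\<exists>W. is_max_margin d B N \<omega> W"
        using max_margin_exists[OF good_data_identity_feasible[OF g R]] .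
      fix W assume W: "is_max_margin d B N \<omega> W"
      define F where "F = sqrt (frob_sq d W)"
      define \<kappa> where "\<kappa> = trace_d d W / F"
      have F: "F > 0" and \<kappa>_ge: "\<rho> * sqrt d / 1728 \<le> \<kappa>"
        using good_data_max_margin[OF g W d B R _ L \<beta>] by (simp_all add: F_def \<kappa>_def \<rho>_def \<beta>_def)
      have "0 < \<rho> * sqrt d / 1728" using \<rho> d by simp
      then have \<kappa>: "\<kappa> > 0" using \<kappa>_ge by linarith
      \<comment> \<open>Every exponent supplied by the test bounds has the form a * \<kappa> * t
        with a constant a; this is the one place where the lower bound for \<kappa> is
        converted.\<close>
      have scaled: "c * (\<rho> * sqrt d) * t \<le> a * \<kappa> * t" if "c \<le> a / 1728" "t \<ge> 0" "a \<ge> 0" for a t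
      proof -
        have "c * (\<rho> * sqrt d) \<le> a / 1728 * (\<rho> * sqrt d)"
          using that \<rho> by (intro mult_right_mono) auto
        also have "\<dots> = a * (\<rho> * sqrt d / 1728)" by simp
        also have "\<dots> \<le> a * \<kappa>" using that \<kappa>_ge by (intro mult_left_mono) auto
        finally show ?thesis using that by (intro mult_right_mono)
      qed
      have sM: "sqrt M \<ge> 1" using M by simp
      have sdd: "sqrt d * sqrt d = d" by simp
      show "memo_err_event d M Rt ?p W \<in> sets (test_space d M Rt ?p)"
        by (rule memo_error_bound(1)[OF d M Rt F_def F \<kappa>_def \<kappa>])
      show "test_err_event d M Rt ?p W \<in> sets (test_space d M Rt ?p)"
        unfolding test_err_event_def by (rule error_sets) simp
      show "measure (test_space d M Rt ?p) (memo_err_event d M Rt ?p W)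
            \<le> 4 * real M * exp (- c * \<rho> * sqrt (real d) / sqrt (real M))
              + 8 * real M * exp (- c * \<rho> * real d / (real M * max (Rt\<^sup>2) Rt))"
      proof -
        \<comment> \<open>Of the six bad events per example, two have exponents at least
          \<open>?X\<close> and four at least \<open>?Y\<close>, hence the prefactors 4 M and 8
          M.\<close>
        let ?X = "c * (\<rho> * sqrt d) * (1 / sqrt M)" and ?Y = "c * \<rho> * d / (M * max (Rt\<^sup>2) Rt)"
        have mx: "max (Rt\<^sup>2) Rt > 0" using Rt by (simp add: less_max_iff_disj)
        have x1: "?X \<le> \<kappa> / 32"
        proof -
          have "?X \<le> c * (\<rho> * sqrt d) * 1" using sM c \<rho> by (intro mult_left_mono) auto
          also have "\<dots> \<le> 1 / 32 * \<kappa> * 1" using c_le by (intro scaled) auto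
          finally show ?thesis by simp
        qed
        have x2: "?X \<le> \<kappa> / (96 * sqrt M)"
          using scaled[of "1/96" "1 / sqrt M"] c_le by simp
        \<comment> \<open>The maximum in the denominator lets one exponent serve for the \<mu>-\<mu>
          term, with s = Rt^2 and a = 192, and for the \<mu>-noise terms, with s = Rt and a =
          144.\<close>
        have Y: "?Y \<le> sqrt d * \<kappa> / (a * M * s)" if s: "0 < s" "s \<le> max (Rt\<^sup>2) Rt" and a: "a > 0" "c \<le> 1 / a / 1728" for a s
        proof -
          have "?Y \<le> c * \<rho> * d / (M * s)"
            using s M c \<rho> mx by (intro divide_left_mono mult_left_mono mult_pos_pos mult_nonneg_nonneg) auto
          also have "\<dots> = c * (\<rho> * sqrt d) * (sqrt d / (M * s))" by (simp add: sdd mult.assoc)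
          also have "\<dots> \<le> 1 / a * \<kappa> * (sqrt d / (M * s))" using a s by (intro scaled) auto
          also have "\<dots> = sqrt d * \<kappa> / (a * M * s)" by (simp add: mult_ac)
          finally show ?thesis .
        qed
        have y1: "?Y \<le> sqrt d * \<kappa> / (192 * real M * Rt\<^sup>2)" using Rt c_le by (intro Y) auto
        have y2: "?Y \<le> sqrt d * \<kappa> / (144 * real M * Rt)" using Rt c_le by (intro Y) auto
        have "measure (test_space d M Rt ?p) (memo_err_event d M Rt ?p W) \<le>
          real M * (2 * exp (- ?X) + (2 * exp (- ?X) + (2 * exp (- ?Y) + (2 * exp (- ?Y) + (2 * exp (- ?Y) + 2 * exp (- ?Y))))))"
          by (rule order_trans[OF memo_error_bound(2)[OF d M Rt F_def F \<kappa>_def \<kappa>]])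
             (intro mult_left_mono add_mono two_exp_mono x1 x2 y1 y2 of_nat_0_le_iff)
        also have "\<dots> = 4 * real M * exp (- ?X) + 8 * real M * exp (- ?Y)" by (simp add: algebra_simps)
        also have "- ?X = - c * \<rho> * sqrt (real d) / sqrt (real M)" by simp
        also have "- ?Y = - c * \<rho> * real d / (real M * max (Rt\<^sup>2) Rt)" by simp
        finally show ?thesis .
      qed
      show "measure (test_space d M Rt ?p) (test_err_event d M Rt ?p W)
            \<le> ?p + 2 * exp (- c * real M) + 2 * exp (- c * \<rho> * sqrt (real d))
              + 4 * exp (- c * \<rho> * Rt)
              + 2 * exp (- c * \<rho> * sqrt (real M) * Rt\<^sup>2 / sqrt (real d))"
      proof -
        \<comment> \<open>The majority event is one-sided and has prefactor 1, relaxed here to the 2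
          of the claim.\<close>
        have x0: "exp (- (c_p\<^sup>2 * M / 2)) \<le> 2 * exp (- (c * M))"
        proof -
          have "c * M \<le> c_p\<^sup>2 / 2 * M" using c_le by (intro mult_right_mono) auto
          then have "exp (- (c_p\<^sup>2 * M / 2)) \<le> exp (- (c * M))" by simp
          then show ?thesis using exp_ge_zero[of "- (c * M)"] by linarith
        qed
        have x1: "c * (\<rho> * sqrt d) \<le> \<kappa> / 32" using scaled[of "1/32" 1] c_le by simp
        have x2: "c * \<rho> * Rt \<le> c_p * Rt * \<kappa> / (192 * sqrt d)"
        proof -
          have "c * (\<rho> * sqrt d) * (Rt / sqrt d) \<le> c_p / 192 * \<kappa> * (Rt / sqrt d)"
            using c_le assms Rt by (intro scaled) auto
          then show ?thesis using d by (simp add: mult_ac)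
        qed
        \<comment> \<open>The signal carries 1 / d; the sqrt d contained in \<kappa> makes up for
          half of it and leaves the sqrt d of the claim.\<close>
        have x3: "c * \<rho> * sqrt M * Rt\<^sup>2 / sqrt d \<le> c_p * sqrt M * Rt\<^sup>2 * \<kappa> / (128 * d)"
        proof -
          have "c * (\<rho> * sqrt d) * (sqrt M * Rt\<^sup>2 / d) \<le> c_p / 128 * \<kappa> * (sqrt M * Rt\<^sup>2 / d)"
            using c_le assms by (intro scaled) auto
          moreover have "c * (\<rho> * sqrt d) * (sqrt M * Rt\<^sup>2 / d) = c * \<rho> * sqrt M * Rt\<^sup>2 * (sqrt d / d)" by simp
          moreover have "sqrt d / d = 1 / sqrt d" using d by (simp add: divide_simps)
          ultimately show ?thesis by (simp add: mult_ac)
        qed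
        have "measure (test_space d M Rt ?p) (test_err_event d M Rt ?p W) \<le>
          ?p + (2 * exp (- (c * M)) + (2 * exp (- (c * (\<rho> * sqrt d))) + (2 * exp (- (c * \<rho> * Rt)) + (2 * exp (- (c * \<rho> * Rt))
            + 2 * exp (- (c * \<rho> * sqrt M * Rt\<^sup>2 / sqrt d))))))"
          by (rule order_trans[OF test_error_bound[OF d M Rt assms F_def F \<kappa>_def \<kappa>]])
             (intro add_mono order_refl two_exp_mono x0 x1 x2 x3)
        then show ?thesis by (simp add: mult.assoc)
      qed
    qed
    show "let p = 1/2 - c_p; \<rho> = min c_B 1 / (ln (2 * (real B)\<^sup>2 / \<delta>))\<^sup>2 in
        \<exists>E \<in> sets (pretrain d B N R).
          measure (pretrain d B N R) E \<ge> 1 - 10 * \<delta> \<and>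
          (\<forall>\<omega>\<in>E. (\<exists>W. is_max_margin d B N \<omega> W) \<and>
             (\<forall>W. is_max_margin d B N \<omega> W \<longrightarrow>
                memo_err_event d M Rt p W \<in> sets (test_space d M Rt p) \<and>
                measure (test_space d M Rt p) (memo_err_event d M Rt p W)
                  \<le> 4 * real M * exp (- c * \<rho> * sqrt (real d) / sqrt (real M))
                    + 8 * real M * exp (- c * \<rho> * real d / (real M * max (Rt\<^sup>2) Rt)) \<and>
                test_err_event d M Rt p W \<in> sets (test_space d M Rt p) \<and>
                measure (test_space d M Rt p) (test_err_event d M Rt p W)
                  \<le> p + 2 * exp (- c * real M) + 2 * exp (- c * \<rho> * sqrt (real d))
                    + 4 * exp (- c * \<rho> * Rt)
                    + 2 * exp (- c * \<rho> * sqrt (real M) * Rt\<^sup>2 / sqrt (real d))))"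
      unfolding Let_def L_def[symmetric] \<rho>_def[symmetric]
      using E main by (intro bexI[of _ E] conjI ballI) simp_all
  qed
qed

end
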